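(* Let $\Omega\subseteq\mathbb{C}$ be a connected open set and let $T=\begin{pmatrix}T_0&S\\0&T_1\end{pmatrix}$ and $\tilde T=\begin{pmatrix}\tilde T_0&\tilde S\\0&\tilde T_1\end{pmatrix}$ be any two operators in $\mathcal{F}B_2(\Omega)$. Let $t_1$ and $\tilde t_1$ be non-vanishing holomorphic sections over $\Omega$ of the line bundles $E_{T_1}$ and $E_{\tilde T_1}$ respectively. Then $T$ and $\tilde T$ are unitarily equivalent if and only if $\mathcal{K}_{T_1}=\mathcal{K}_{\tilde T_1}$ and $\frac{\|S(t_1)\|^2}{\|t_1\|^2}=\frac{\|\tilde S(\tilde t_1)\|^2}{\|\tilde t_1\|^2}$ on $\Omega$. The same equivalence holds with the condition $\mathcal{K}_{T_1}=\mathcal{K}_{\tilde T_1}$ replaced by $\mathcal{K}_{T_0}=\mathcal{K}_{\tilde T_0}$.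
   Context: All Hilbert spaces are complex and separable and all operators are bounded and linear. For a connected open set $\Omega\subseteq\mathbb{C}$ and a positive integer $n$, $B_n(\Omega)$ (the Cowen-Douglas class) is the set of bounded operators $T$ on a Hilbert space $\mathcal{H}$ such that $\Omega\subset\sigma(T)$; $\mathrm{ran}(T-w)=\mathcal{H}$ for all $w\in\Omega$; the closed linear span of $\bigcup_{w\in\Omega}\ker(T-w)$ is $\mathcal{H}$; and $\dim\ker(T-w)=n$ for all $w\in\Omega$. For $T\in B_n(\Omega)$, $E_T=\{(w,x)\in\Omega\times\mathcal{H}: x\in\ker(T-w)\}$ is the associated rank $n$ holomorphic Hermitian vector bundle over $\Omega$; a holomorphic section of it is a holomorphic map $\gamma:\Omega\to\mathcal{H}$ with $\gamma(w)\in\ker(T-w)$. For $T\in B_1(\Omega)$ the curvature is $\mathcal{K}_T(w)=-\frac{\partial^2}{\partial w\partial\bar w}\log\|\gamma(w)\|^2$, where $\gamma$ is any non-vanishing holomorphic section of $E_T$ (the value does not depend on $\gamma$). $\mathcal{F}B_2(\Omega)$ is the set of bounded operators $T=\begin{pmatrix}T_0&S\\0&T_1\end{pmatrix}$ on an orthogonal direct sum $\mathcal{H}_0\oplus\mathcal{H}_1$, where $T_0:\mathcal{H}_0\to\mathcal{H}_0$ and $T_1:\mathcal{H}_1\to\mathcal{H}_1$ are in $B_1(\Omega)$ and $S:\mathcal{H}_1\to\mathcal{H}_0$ is a non-zero bounded operator with $T_0S=ST_1$. *)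

theory Defs
  imports "HOL-Analysis.Analysis"
begin

class complex_vector = real_vector +
  fixes scaleC :: "complex \<Rightarrow> 'a \<Rightarrow> 'a"  (infixr \<open>*\<^sub>C\<close> 75)
  assumes scaleC_add_right: "a *\<^sub>C (x + y) = a *\<^sub>C x + a *\<^sub>C y"
    and scaleC_add_left: "(a + b) *\<^sub>C x = a *\<^sub>C x + b *\<^sub>C x"
    and scaleC_scaleC: "a *\<^sub>C b *\<^sub>C x = (a * b) *\<^sub>C x"
    and scaleR_scaleC: "r *\<^sub>R x = complex_of_real r *\<^sub>C x"

text \<open>The real inner product (hence the norm and the topology) is the real part of the complex
  one, which is linear in its first argument.\<close>

class complex_inner = complex_vector + real_inner +
  fixes cinner :: "'a \<Rightarrow> 'a \<Rightarrow> complex"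
  assumes cinner_commute: "cinner x y = cnj (cinner y x)"
    and cinner_add_left: "cinner (x + y) z = cinner x z + cinner y z"
    and cinner_scaleC_left: "cinner (a *\<^sub>C x) y = a * cinner x y"
    and inner_eq_Re_cinner: "inner x y = Re (cinner x y)"

text \<open>A Polish type is complete and second countable; the latter is separability, the topology
  being metric.\<close>

class separable_hilbert = complex_inner + polish_space

global_interpretation complex_vector: vector_space "scaleC :: complex \<Rightarrow> 'a \<Rightarrow> 'a::complex_vector"
proof
  fix x :: 'a
  show "1 *\<^sub>C x = x"
    using scaleR_scaleC[of 1 x] by simp
qed (simp_all add: scaleC_add_right scaleC_add_left scaleC_scaleC)

text \<open>The product type is the orthogonal direct sum.\<close>

instantiation prod :: (complex_vector, complex_vector) complex_vector
begin

definition scaleC_prod :: "complex \<Rightarrow> 'a \<times> 'b \<Rightarrow> 'a \<times> 'b"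
  where "scaleC_prod c p = (c *\<^sub>C fst p, c *\<^sub>C snd p)"

instance
  by standard
    (simp_all add: scaleC_prod_def prod_eq_iff scaleC_add_right scaleC_add_left scaleC_scaleC
      scaleR_scaleC)

end

instantiation prod :: (complex_inner, complex_inner) complex_inner
begin

definition cinner_prod :: "'a \<times> 'b \<Rightarrow> 'a \<times> 'b \<Rightarrow> complex"
  where "cinner_prod p q = cinner (fst p) (fst q) + cinner (snd p) (snd q)"

instance
proof
  fix x y :: "'a \<times> 'b"
  show "cinner x y = cnj (cinner y x)"
    by (simp add: cinner_prod_def cinner_commute[of "fst x"] cinner_commute[of "snd x"])
qed (simp_all add: cinner_prod_def scaleC_prod_def cinner_add_left cinner_scaleC_left
      inner_prod_def inner_eq_Re_cinner algebra_simps)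

end

definition bounded_clinear :: "('a::complex_inner \<Rightarrow> 'b::complex_inner) \<Rightarrow> bool"
  where "bounded_clinear A \<longleftrightarrow> bounded_linear A \<and> (\<forall>c x. A (c *\<^sub>C x) = c *\<^sub>C A x)"

definition spectrum :: "('a::complex_inner \<Rightarrow> 'a) \<Rightarrow> complex set"
  where "spectrum A =
    {w. \<not> (\<exists>R. bounded_clinear R \<and> (\<forall>x. R (A x - w *\<^sub>C x) = x) \<and> (\<forall>x. A (R x) - w *\<^sub>C R x = x))}"

definition eigenspace :: "('a::complex_inner \<Rightarrow> 'a) \<Rightarrow> complex \<Rightarrow> 'a set"
  where "eigenspace A w = {x. A x - w *\<^sub>C x = 0}"

text \<open>The Cowen-Douglas class. As \<open>complex_vector.dim\<close> is 0 on infinite-dimensional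
  spaces, the dimension condition is meaningful only because \<open>n\<close> is positive.\<close>

definition cowen_douglas :: "nat \<Rightarrow> complex set \<Rightarrow> ('a::separable_hilbert \<Rightarrow> 'a) set"
  where "cowen_douglas n \<Omega> = {A. 0 < n \<and> bounded_clinear A \<and>
    \<Omega> \<subseteq> spectrum A \<and>
    (\<forall>w\<in>\<Omega>. range (\<lambda>x. A x - w *\<^sub>C x) = UNIV) \<and>
    closure (complex_vector.span (\<Union>w\<in>\<Omega>. eigenspace A w)) = UNIV \<and>
    (\<forall>w\<in>\<Omega>. complex_vector.dim (eigenspace A w) = n)}"

text \<open>Holomorphy of Hilbert space valued maps; \<open>holomorphic_on\<close> only covers maps of
  a field to itself.\<close>

definition vector_holomorphic_on :: "(complex \<Rightarrow> 'a::complex_inner) \<Rightarrow> complex set \<Rightarrow> bool"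
  where "vector_holomorphic_on \<gamma> \<Omega> \<longleftrightarrow>
    (\<forall>w\<in>\<Omega>. \<exists>D. (\<gamma> has_derivative (\<lambda>h. h *\<^sub>C D)) (at w within \<Omega>))"

definition nonvanishing_section ::
    "complex set \<Rightarrow> ('a::complex_inner \<Rightarrow> 'a) \<Rightarrow> (complex \<Rightarrow> 'a) \<Rightarrow> bool"
  where "nonvanishing_section \<Omega> A \<gamma> \<longleftrightarrow>
    vector_holomorphic_on \<gamma> \<Omega> \<and> (\<forall>w\<in>\<Omega>. \<gamma> w \<in> eigenspace A w \<and> \<gamma> w \<noteq> 0)"

text \<open>The Wirtinger derivatives \<open>(\<partial>\<^sub>x - \<i> \<partial>\<^sub>y) / 2\<close> and
  \<open>(\<partial>\<^sub>x + \<i> \<partial>\<^sub>y) / 2\<close>.\<close>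

definition wirtinger :: "(complex \<Rightarrow> complex) \<Rightarrow> complex \<Rightarrow> complex"
  where "wirtinger f w =
    (frechet_derivative f (at w) 1 - \<i> * frechet_derivative f (at w) \<i>) / 2"

definition wirtinger_bar :: "(complex \<Rightarrow> complex) \<Rightarrow> complex \<Rightarrow> complex"
  where "wirtinger_bar f w =
    (frechet_derivative f (at w) 1 + \<i> * frechet_derivative f (at w) \<i>) / 2"

definition section_curvature :: "(complex \<Rightarrow> 'a::complex_inner) \<Rightarrow> complex \<Rightarrow> complex"
  where "section_curvature \<gamma> w =
    - wirtinger (wirtinger_bar (\<lambda>z. complex_of_real (ln ((norm (\<gamma> z))\<^sup>2)))) w"

text \<open>For \<open>A\<close> in \<open>cowen_douglas 1 \<Omega>\<close> and \<open>w\<close> in \<open>\<Omega>\<close> the value does not depend on the chosen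
  section.\<close>

definition curvature :: "complex set \<Rightarrow> ('a::complex_inner \<Rightarrow> 'a) \<Rightarrow> complex \<Rightarrow> complex"
  where "curvature \<Omega> A w = section_curvature (SOME \<gamma>. nonvanishing_section \<Omega> A \<gamma>) w"

text \<open>The operator with matrix rows \<open>(T0, S)\<close> and \<open>(0, T1)\<close>.\<close>

definition block_op ::
    "('a::complex_inner \<Rightarrow> 'a) \<Rightarrow> ('b::complex_inner \<Rightarrow> 'a) \<Rightarrow> ('b \<Rightarrow> 'b) \<Rightarrow> 'a \<times> 'b \<Rightarrow> 'a \<times> 'b"
  where "block_op T0 S T1 = (\<lambda>(x, y). (T0 x + S y, T1 y))"

text \<open>\<open>FB2 \<Omega> T0 S T1\<close> says that \<open>block_op T0 S T1\<close>, with this decomposition, belongs to the class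
  \<open>\<F>B\<^sub>2(\<Omega>)\<close>.\<close>

definition FB2 ::
    "complex set \<Rightarrow> ('a::separable_hilbert \<Rightarrow> 'a) \<Rightarrow> ('b::separable_hilbert \<Rightarrow> 'a) \<Rightarrow> ('b \<Rightarrow> 'b) \<Rightarrow> bool"
  where "FB2 \<Omega> T0 S T1 \<longleftrightarrow>
    T0 \<in> cowen_douglas 1 \<Omega> \<and> T1 \<in> cowen_douglas 1 \<Omega> \<and>
    bounded_clinear S \<and> S \<noteq> (\<lambda>_. 0) \<and> T0 \<circ> S = S \<circ> T1"

definition unitary :: "('a::complex_inner \<Rightarrow> 'b::complex_inner) \<Rightarrow> bool"
  where "unitary U \<longleftrightarrow>
    bounded_clinear U \<and> surj U \<and> (\<forall>x y. cinner (U x) (U y) = cinner x y)"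

definition unitarily_equivalent ::
    "('a::complex_inner \<Rightarrow> 'a) \<Rightarrow> ('b::complex_inner \<Rightarrow> 'b) \<Rightarrow> bool"
  where "unitarily_equivalent A B \<longleftrightarrow> (\<exists>U. unitary U \<and> U \<circ> A = B \<circ> U)"

end

theory Submission
  imports Defs "HOL-Complex_Analysis.Complex_Analysis"
begin

text \<open>
  For necessity, let \<open>U\<close> be a unitary intertwiner with lower left corner \<open>X\<close>, and let \<open>Y\<close> be
  the lower left corner of its inverse. Then \<open>X S Y S'\<close> commutes with \<open>T1'\<close> and is a commutator
  with \<open>T1'\<close>, so it vanishes by the Kleinecke-Shirokov argument. Nonzero intertwiners are
  injective on eigenspaces over a nonempty open set, hence \<open>X\<close> or \<open>Y\<close> is zero; as \<open>U\<close> is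
  unitary, it is then diagonal, \<open>U0 \<oplus> U1\<close> with \<open>U0 S = S' U1\<close>, and the invariants agree.

  For sufficiency, it is enough to work over a small disc on which \<open>S t1\<close> has no zero and thus
  is a section of \<open>E_T0\<close>. There equality of curvatures means \<open>norm t1 = \<bar>g\<bar> norm t1'\<close>
  with \<open>g\<close> holomorphic, and equality of the quotients turns this into the same relation between
  \<open>S t1\<close> and \<open>S' t1'\<close>, and conversely. After polarization,
  \<open>t1 w \<mapsto> g w t1' w\<close> and \<open>S t1 w \<mapsto> g w S' t1' w\<close> extend to unitaries,
  the eigenvectors over any disc being total.

  That the curvature of \<open>T0\<close> is meaningful over all of \<open>\<Omega>\<close> requires a global non-vanishing section
  of \<open>E_T0\<close>; it is obtained by dividing \<open>S t1\<close> by a scalar function with the same zeros.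
\<close>

section \<open>Complex Hilbert spaces\<close>

text \<open>Necessity uses both directions because of the lower right entry of
  \<open>U T = T' U\<close>: the lower right corner \<open>X2\<close> of \<open>U\<close> satisfies
  \<open>T1' X2 - X2 T1 = X S\<close>, which mixes \<open>T1\<close> and \<open>T1'\<close>.
  Composition with \<open>Y S'\<close>, which intertwines \<open>T1'\<close> with \<open>T1\<close>,
  turns this into a commutator with \<open>T1'\<close> alone. In sufficiency the two unitaries must
  come from one and the same \<open>g\<close>; only then do they carry \<open>S\<close> to
  \<open>S'\<close>. The hypotheses provide sections of \<open>E_T1\<close> but none of
  \<open>E_T0\<close>, while \<open>curvature\<close> chooses a global section. The natural
  candidate \<open>S t1\<close> can have infinitely many zeros in \<open>\<Omega>\<close>, which
  accumulate only outside it, so a Weierstrass product on an arbitrary open set is required. Complex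
  analysis with values in a Hilbert space is reduced to the scalar theory by pairing with fixed
  vectors; the scalar bounds are uniform in the vector and therefore pass to the norm.\<close>

instance separable_hilbert \<subseteq> banach ..

lemma cinner_add_right: "cinner x (y + z) = cinner x y + cinner x z"
  for x y z :: "'a::complex_inner"
  by (metis cinner_commute cinner_add_left complex_cnj_add)

lemma cinner_scaleC_right: "cinner x (a *\<^sub>C y) = cnj a * cinner x y"
  for x y :: "'a::complex_inner"
  by (metis cinner_commute cinner_scaleC_left complex_cnj_mult)

lemma cinner_zero_left [simp]: "cinner 0 (x::'a::complex_inner) = 0"
  using cinner_add_left[of 0 0 x] by simp

lemma cinner_zero_right [simp]: "cinner (x::'a::complex_inner) 0 = 0"
  using cinner_add_right[of x 0 0] by simp

lemma cinner_diff_left: "cinner (x - y) z = cinner x z - cinner y z"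
  for x y z :: "'a::complex_inner"
  using cinner_add_left[of "x - y" y z] by simp

lemma cinner_self: "cinner x x = complex_of_real ((norm x)\<^sup>2)"
  for x :: "'a::complex_inner"
proof -
  have "Im (cinner x x) = 0"
    using arg_cong[OF cinner_commute[of x x], of Im] by simp
  moreover have "Re (cinner x x) = (norm x)\<^sup>2"
    by (simp add: power2_norm_eq_inner inner_eq_Re_cinner)
  ultimately show ?thesis
    by (simp add: complex_eq_iff)
qed

lemma norm_scaleC [simp]: "norm (a *\<^sub>C x) = cmod a * norm x"
  for x :: "'a::complex_inner"
proof -
  have "complex_of_real ((norm (a *\<^sub>C x))\<^sup>2) = (a * cnj a) * complex_of_real ((norm x)\<^sup>2)"
    by (simp only: cinner_self[symmetric] cinner_scaleC_left cinner_scaleC_right mult_ac)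
  also have "\<dots> = complex_of_real ((cmod a * norm x)\<^sup>2)"
    by (simp add: complex_norm_square[symmetric] power_mult_distrib)
  finally have "(norm (a *\<^sub>C x))\<^sup>2 = (cmod a * norm x)\<^sup>2"
    using of_real_eq_iff by blast
  then show ?thesis
    by (simp add: power2_eq_iff_nonneg)
qed

text \<open>The inequality is known for \<open>inner\<close>, the real part of
  \<open>cinner\<close>. Multiplying \<open>x\<close> by a unimodular scalar changes no norm and
  makes the complex product real and nonnegative.\<close>

lemma cinner_Cauchy_Schwarz: "cmod (cinner x y) \<le> norm x * norm y"
  for x y :: "'a::complex_inner"
proof (cases "cinner x y = 0")
  case False
  define c where "c = cnj (cinner x y) / cmod (cinner x y)"
  have c: "cmod c = 1"
    using False by (simp add: c_def norm_divide)
  have "cinner (c *\<^sub>C x) y = complex_of_real (cmod (cinner x y))"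
    using False by (simp add: c_def cinner_scaleC_left complex_norm_square power2_eq_square
        field_simps)
      (metis complex_norm_square mult.commute of_real_mult power2_eq_square)
  then have "cmod (cinner x y) = inner (c *\<^sub>C x) y"
    by (simp add: inner_eq_Re_cinner)
  also have "\<dots> \<le> norm (c *\<^sub>C x) * norm y"
    by (rule norm_cauchy_schwarz)
  finally show ?thesis
    using c by simp
qed simp

text \<open>Turns scalar estimates that are uniform in the test vector into a norm estimate; this is
  how the Cauchy inequalities reach vector-valued maps. The test vector that decides is
  \<open>x\<close> itself.\<close>

lemma norm_le_if_cinner_le:
  fixes x :: "'a::complex_inner"
  assumes "0 \<le> B" and "\<And>y. cmod (cinner x y) \<le> B * norm y"
  shows "norm x \<le> B"
proof (cases "x = 0")
  case False
  have "norm x * norm x \<le> B * norm x"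
    using assms(2)[of x] by (simp add: cinner_self power2_eq_square norm_mult)
  then show ?thesis
    using False by simp
qed (use assms in simp)

lemma scaleC_scaleR: "a *\<^sub>C (r *\<^sub>R x) = r *\<^sub>R (a *\<^sub>C x)"
  for x :: "'a::complex_vector"
  by (simp add: scaleR_scaleC mult.commute)

lemma scaleR_scaleC_left: "(r *\<^sub>R a) *\<^sub>C x = r *\<^sub>R (a *\<^sub>C x)"
  for x :: "'a::complex_vector"
  by (simp add: scaleR_scaleC scaleR_conv_of_real)

lemma bounded_bilinear_scaleC:
  "bounded_bilinear (scaleC :: complex \<Rightarrow> 'a::complex_inner \<Rightarrow> 'a)"
proof
  show "\<exists>K. \<forall>a (b::'a). norm (a *\<^sub>C b) \<le> norm a * norm b * K"
    by (rule exI[of _ 1]) simp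
qed (simp_all add: scaleC_add_left scaleC_add_right scaleC_scaleR scaleR_scaleC_left)

lemma bounded_bilinear_cinner:
  "bounded_bilinear (cinner :: 'a::complex_inner \<Rightarrow> 'a \<Rightarrow> complex)"
proof
  show "\<exists>K. \<forall>a b::'a. norm (cinner a b) \<le> norm a * norm b * K"
    by (rule exI[of _ 1]) (simp add: cinner_Cauchy_Schwarz)
qed (simp_all add: cinner_add_left cinner_add_right scaleR_scaleC cinner_scaleC_left
    cinner_scaleC_right scaleR_conv_of_real[where 'a=complex])

lemmas continuous_on_cinner [continuous_intros] =
  bounded_bilinear.continuous_on[OF bounded_bilinear_cinner]
lemmas tendsto_cinner [tendsto_intros] =
  bounded_bilinear.tendsto[OF bounded_bilinear_cinner]
lemmas tendsto_scaleC [tendsto_intros] =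
  bounded_bilinear.tendsto[OF bounded_bilinear_scaleC]
lemmas has_derivative_cinner = bounded_bilinear.FDERIV[OF bounded_bilinear_cinner]
lemmas has_derivative_scaleC = bounded_bilinear.FDERIV[OF bounded_bilinear_scaleC]

section \<open>Closed subspaces, orthogonality and totality\<close>

lemma csubspace_closure:
  fixes M :: "'a::complex_inner set"
  assumes "complex_vector.subspace M"
  shows "complex_vector.subspace (closure M)"
  unfolding complex_vector.subspace_def
proof (intro conjI allI ballI)
  show "0 \<in> closure M"
    using assms closure_subset complex_vector.subspace_0 by blast
next
  fix x y assume "x \<in> closure M" "y \<in> closure M"
  then obtain f g where "\<And>n. f n \<in> M" "f \<longlonglongrightarrow> x" "\<And>n. g n \<in> M" "g \<longlonglongrightarrow> y"
    unfolding closure_sequential by blast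
  then show "x + y \<in> closure M"
    unfolding closure_sequential
    by (intro exI[of _ "\<lambda>n. f n + g n"]) (auto intro: tendsto_add assms complex_vector.subspace_add)
next
  fix c x assume "x \<in> closure M"
  then obtain f where "\<And>n. f n \<in> M" "f \<longlonglongrightarrow> x"
    unfolding closure_sequential by blast
  then show "c *\<^sub>C x \<in> closure M"
    unfolding closure_sequential
    by (intro exI[of _ "\<lambda>n. c *\<^sub>C f n"])
      (auto intro: tendsto_scaleC assms complex_vector.subspace_scale)
qed

text \<open>The vector is \<open>v - p\<close>, with \<open>p\<close> a point of \<open>M\<close>
  closest to some \<open>v\<close> outside \<open>M\<close>; completeness supplies \<open>p\<close>
  as the limit of a minimizing sequence.\<close>

lemma orthogonal_vector_exists:
  fixes M :: "'a::separable_hilbert set"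
  assumes M: "complex_vector.subspace M" and cl: "closed M" and ne: "M \<noteq> UNIV"
  obtains x where "x \<noteq> 0" "\<And>y. y \<in> M \<Longrightarrow> cinner y x = 0"
proof -
  obtain v where v: "v \<notin> M" using ne by blast
  have M0: "0 \<in> M" using M complex_vector.subspace_0 by blast
  define d where "d = infdist v M"
  have d_le: "d \<le> norm (v - y)" if "y \<in> M" for y
    using infdist_le[OF that, of v] by (simp add: d_def dist_norm)
  have d0: "0 \<le> d" by (simp add: d_def infdist_nonneg)
  have "\<exists>y\<in>M. norm (v - y) < d + 1 / Suc n" for n
  proof -
    have "infdist v M < d + 1 / Suc n" by (simp add: d_def)
    then show ?thesis
      unfolding infdist_def using M0 cInf_lessD[of "dist v ` M"] by (auto simp: dist_norm split: if_splits)
  qed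
  then obtain y where y: "\<And>n. y n \<in> M" "\<And>n. norm (v - y n) < d + 1 / Suc n"
    by metis
  \<comment> \<open>Parallelogram law for \<open>v - y m\<close> and \<open>v - y n\<close>: the
    midpoint of \<open>y m\<close> and \<open>y n\<close> lies in \<open>M\<close>, hence at
    distance at least \<open>d\<close> from \<open>v\<close>. This makes the minimizing sequence
    Cauchy.\<close>
  have par: "(norm (y m - y n))\<^sup>2 \<le> 2 * (norm (v - y m))\<^sup>2 + 2 * (norm (v - y n))\<^sup>2 - 4 * d\<^sup>2" for m n
  proof -
    have mid: "(1/2) *\<^sub>R (y m + y n) \<in> M"
      unfolding scaleR_scaleC using M y by (intro complex_vector.subspace_scale complex_vector.subspace_add)
    have "d\<^sup>2 \<le> (norm (v - (1/2) *\<^sub>R (y m + y n)))\<^sup>2"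
      using d_le[OF mid] d0 by (rule power_mono)
    moreover have "(norm (y m - y n))\<^sup>2 + 4 * (norm (v - (1/2) *\<^sub>R (y m + y n)))\<^sup>2
        = 2 * (norm (v - y m))\<^sup>2 + 2 * (norm (v - y n))\<^sup>2"
      unfolding power2_norm_eq_inner by (simp add: inner_simps inner_commute algebra_simps)
    ultimately show ?thesis by linarith
  qed
  have lim: "(\<lambda>n. norm (v - y n)) \<longlonglongrightarrow> d"
  proof (rule tendsto_sandwich[of "\<lambda>_. d" _ _ "\<lambda>n. d + 1 / Suc n"])
    show "(\<lambda>n. d + 1 / real (Suc n)) \<longlonglongrightarrow> d"
      using tendsto_add[OF tendsto_const[of d] LIMSEQ_Suc[OF lim_1_over_n]] by (simp add: add_ac)
  qed (use y d_le in \<open>auto intro!: always_eventually less_imp_le\<close>)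
  have sq: "(\<lambda>n. (norm (v - y n))\<^sup>2) \<longlonglongrightarrow> d\<^sup>2"
    by (intro tendsto_power lim)
  have "Cauchy y"
  proof (rule metric_CauchyI)
    fix e :: real assume e: "e > 0"
    have "\<forall>\<^sub>F n in sequentially. (norm (v - y n))\<^sup>2 < d\<^sup>2 + e\<^sup>2 / 4"
      using order_tendstoD(2)[OF sq] e by simp
    then obtain N where N: "\<And>n. n \<ge> N \<Longrightarrow> (norm (v - y n))\<^sup>2 < d\<^sup>2 + e\<^sup>2 / 4"
      unfolding eventually_sequentially by blast
    have "dist (y m) (y n) < e" if "m \<ge> N" "n \<ge> N" for m n
    proof -
      have "(norm (y m - y n))\<^sup>2 < e\<^sup>2"
        using par[of m n] N[OF that(1)] N[OF that(2)] by linarith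
      then show ?thesis
        using e by (simp add: dist_norm power_less_imp_less_base)
    qed
    then show "\<exists>N. \<forall>m\<ge>N. \<forall>n\<ge>N. dist (y m) (y n) < e" by blast
  qed
  then obtain p where p: "y \<longlonglongrightarrow> p"
    using Cauchy_convergent_iff convergent_def by blast
  have pM: "p \<in> M"
    using cl p y(1) closed_sequentially by blast
  have dp: "norm (v - p) = d"
    by (rule LIMSEQ_unique[OF tendsto_norm[OF tendsto_diff[OF tendsto_const p]] lim])
  have Re0: "inner z (v - p) = 0" if z: "z \<in> M" for z
  proof (cases "z = 0")
    case False
    \<comment> \<open>The minimizer of the quadratic polynomial
      \<open>(norm (v - p - t *\<^sub>R z))\<^sup>2\<close> in \<open>t\<close>; minimality of
      \<open>d\<close> then leaves no room for a nonzero product.\<close>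
    define t where "t = inner z (v - p) / (norm z)\<^sup>2"
    have "p + t *\<^sub>R z \<in> M"
      unfolding scaleR_scaleC using M pM z
      by (intro complex_vector.subspace_scale complex_vector.subspace_add)
    then have "d\<^sup>2 \<le> (norm (v - (p + t *\<^sub>R z)))\<^sup>2"
      using d_le d0 by (intro power_mono) auto
    also have "\<dots> = (norm ((v - p) - t *\<^sub>R z))\<^sup>2"
      by (simp add: algebra_simps)
    also have "\<dots> = d\<^sup>2 - 2 * t * inner z (v - p) + t\<^sup>2 * (norm z)\<^sup>2"
      unfolding dp[symmetric] power2_norm_eq_inner
      by (simp add: inner_diff_left inner_diff_right inner_commute power2_eq_square algebra_simps)
    also have "\<dots> = d\<^sup>2 - (inner z (v - p))\<^sup>2 / (norm z)\<^sup>2"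
      using False by (simp add: t_def field_simps power2_eq_square)
    finally have "(inner z (v - p))\<^sup>2 / (norm z)\<^sup>2 \<le> 0" by simp
    then show ?thesis
      using False by (simp add: divide_le_0_iff)
  qed simp
  have "cinner z (v - p) = 0" if z: "z \<in> M" for z
  proof -
    have "Re (cinner z (v - p)) = 0"
      using Re0[OF z] by (simp add: inner_eq_Re_cinner)
    \<comment> \<open>The real part for \<open>\<i> *\<^sub>C z\<close> is minus the imaginary part
      for \<open>z\<close>.\<close>
    moreover have "Re (cinner (\<i> *\<^sub>C z) (v - p)) = 0"
      using Re0[of "\<i> *\<^sub>C z"] M z complex_vector.subspace_scale
      by (metis inner_eq_Re_cinner)
    ultimately show ?thesis
      by (simp add: complex_eq_iff cinner_scaleC_left)
  qed
  moreover have "v - p \<noteq> 0" using pM v by auto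
  ultimately show ?thesis using that by blast
qed

lemma closure_span_eq_UNIV_if:
  fixes A :: "'a::separable_hilbert set"
  assumes "\<And>x. (\<And>a. a \<in> A \<Longrightarrow> cinner a x = 0) \<Longrightarrow> x = 0"
  shows "closure (complex_vector.span A) = UNIV"
proof (rule ccontr)
  assume "closure (complex_vector.span A) \<noteq> UNIV"
  then obtain x where x: "x \<noteq> 0" "\<And>y. y \<in> closure (complex_vector.span A) \<Longrightarrow> cinner y x = 0"
    using orthogonal_vector_exists[of "closure (complex_vector.span A)"]
      csubspace_closure complex_vector.subspace_span by (metis closed_closure)
  then show False
    using assms[of x] closure_subset complex_vector.span_superset by (meson subset_iff)
qed

lemma dense_span_cinner_eq_0:
  fixes A :: "'a::complex_inner set"
  assumes d: "closure (complex_vector.span A) = UNIV" and "\<And>a. a \<in> A \<Longrightarrow> cinner a x = 0"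
  shows "x = 0"
proof -
  have "cinner y x = 0" if "y \<in> complex_vector.span A" for y
    using that by (induction rule: complex_vector.span_induct_alt)
      (simp_all add: cinner_add_left cinner_scaleC_left assms)
  moreover have "closed {y. cinner y x = 0}"
    by (intro closed_Collect_eq continuous_intros)
  ultimately have "closure (complex_vector.span A) \<subseteq> {y. cinner y x = 0}"
    by (intro closure_minimal) auto
  then have "cinner x x = 0" using d by auto
  then show ?thesis by (simp add: cinner_self)
qed

section \<open>Bounded complex-linear operators and the construction of unitaries\<close>

lemma bounded_clinear_D:
  assumes "bounded_clinear A"
  shows "bounded_linear A" "A (c *\<^sub>C x) = c *\<^sub>C A x" "A (x + y) = A x + A y" "A 0 = 0"
    "A (x - y) = A x - A y"
  using assms unfolding bounded_clinear_def
  by (auto simp: linear_simps dest!: bounded_linear.linear intro: linear_add linear_0 linear_diff)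

lemma bounded_clinear_compose:
  assumes "bounded_clinear A" "bounded_clinear B"
  shows "bounded_clinear (\<lambda>x. A (B x))"
  using assms unfolding bounded_clinear_def by (auto intro: bounded_linear_compose)

lemma bounded_clinear_eq_on_dense:
  assumes A: "bounded_clinear A" and B: "bounded_clinear B"
    and d: "closure (complex_vector.span X) = UNIV" and eq: "\<And>x. x \<in> X \<Longrightarrow> A x = B x"
  shows "A = B"
proof -
  have "A y = B y" if "y \<in> complex_vector.span X" for y
    using that by (induction rule: complex_vector.span_induct_alt)
      (simp_all add: bounded_clinear_D[OF A] bounded_clinear_D[OF B] eq)
  moreover have "closed {y. A y = B y}"
    using A B unfolding bounded_clinear_def
    by (intro closed_Collect_eq linear_continuous_on) auto
  ultimately have "closure (complex_vector.span X) \<subseteq> {y. A y = B y}"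
    by (intro closure_minimal) auto
  then show ?thesis using d by auto
qed

text \<open>The graph of the unitary is the closed span of the pairs \<open>(a i, b i)\<close>.\<close>

lemma unitary_extension:
  fixes a :: "'i \<Rightarrow> 'a::separable_hilbert" and b :: "'i \<Rightarrow> 'b::separable_hilbert"
  assumes gram: "\<And>i j. i \<in> I \<Longrightarrow> j \<in> I \<Longrightarrow> cinner (a i) (a j) = cinner (b i) (b j)"
    and da: "closure (complex_vector.span (a ` I)) = UNIV"
    and db: "closure (complex_vector.span (b ` I)) = UNIV"
  shows "\<exists>U. unitary U \<and> (\<forall>i\<in>I. U (a i) = b i)"
proof -
  define G0 where "G0 = complex_vector.span ((\<lambda>i. (a i, b i)) ` I)"
  define G where "G = closure G0"
  have subG: "complex_vector.subspace G"
    unfolding G_def G0_def by (intro csubspace_closure complex_vector.subspace_span)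
  \<comment> \<open>The two products are compared one slot at a time: one slot ranges over the span
    while the other holds a generator, and afterwards the other slot is extended too.\<close>
  have gen: "cinner (fst p) (a j) = cinner (snd p) (b j)" if "p \<in> G0" "j \<in> I" for p j
    using that(1) unfolding G0_def by (induction rule: complex_vector.span_induct_alt)
      (use that(2) in \<open>auto simp: gram cinner_add_left cinner_scaleC_left scaleC_prod_def\<close>)
  have "cinner (fst p) (fst q) = cinner (snd p) (snd q)" if "q \<in> G0" "p \<in> G0" for p q
    using that(1) unfolding G0_def by (induction rule: complex_vector.span_induct_alt)
      (use that(2) gen in \<open>auto simp: cinner_add_right cinner_scaleC_right scaleC_prod_def\<close>)
  then have iso0: "cinner (fst p) (fst q) = cinner (snd p) (snd q)" if "p \<in> G0" "q \<in> G0" for p q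
    using that by blast
  have iso: "cinner (fst p) (fst q) = cinner (snd p) (snd q)" if pq: "p \<in> G" "q \<in> G" for p q
  proof -
    obtain f g where fg: "\<And>n. f n \<in> G0" "f \<longlonglongrightarrow> p" "\<And>n. g n \<in> G0" "g \<longlonglongrightarrow> q"
      using pq unfolding G_def closure_sequential by blast
    have "(\<lambda>n. cinner (fst (f n)) (fst (g n))) \<longlonglongrightarrow> cinner (fst p) (fst q)"
      by (intro tendsto_intros fg)
    moreover have "(\<lambda>n. cinner (snd (f n)) (snd (g n))) \<longlonglongrightarrow> cinner (snd p) (snd q)"
      by (intro tendsto_intros fg)
    ultimately show ?thesis
      using LIMSEQ_unique by (simp add: iso0 fg)
  qed
  have nrm: "norm (fst p) = norm (snd p)" if "p \<in> G" for p
  proof -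
    have "complex_of_real ((norm (fst p))\<^sup>2) = complex_of_real ((norm (snd p))\<^sup>2)"
      using iso[OF that that] by (simp add: cinner_self)
    then have "(norm (fst p))\<^sup>2 = (norm (snd p))\<^sup>2"
      using of_real_eq_iff by blast
    then show ?thesis by (simp add: power2_eq_iff_nonneg)
  qed
  have diffG: "p - q \<in> G" if "p \<in> G" "q \<in> G" for p q
    using that subG by (rule complex_vector.subspace_diff[rotated])
  have G0G: "G0 \<subseteq> G" unfolding G_def by (rule closure_subset)
  have img_fst: "fst ` G0 = complex_vector.span (a ` I)"
  proof -
    have "complex_vector.span (fst ` (\<lambda>i. (a i, b i)) ` I) = fst ` G0"
      unfolding G0_def
      by (rule module_hom.span_image, unfold_locales)
        (simp_all add: scaleC_prod_def)
    then show ?thesis by (simp add: image_image)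
  qed
  have img_snd: "snd ` G0 = complex_vector.span (b ` I)"
  proof -
    have "complex_vector.span (snd ` (\<lambda>i. (a i, b i)) ` I) = snd ` G0"
      unfolding G0_def
      by (rule module_hom.span_image, unfold_locales)
        (simp_all add: scaleC_prod_def)
    then show ?thesis by (simp add: image_image)
  qed
  \<comment> \<open>Along the graph both coordinates have equal norms, so the second coordinates
    over a convergent sequence of first coordinates are Cauchy and converge by completeness.
    \<open>ex_fst\<close> is the mirror image and yields surjectivity.\<close>
  have ex_snd: "\<exists>y. (x, y) \<in> G" for x
  proof -
    have "x \<in> closure (fst ` G0)" using da img_fst by simp
    then obtain f where f: "\<And>n. f n \<in> fst ` G0" "f \<longlonglongrightarrow> x"
      unfolding closure_sequential by blast
    then obtain p where p: "\<And>n. p n \<in> G0" "\<And>n. f n = fst (p n)"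
      unfolding image_iff by metis
    have "dist (snd (p m)) (snd (p n)) = dist (f m) (f n)" for m n
      using nrm[OF diffG[of "p m" "p n"]] subsetD[OF G0G p(1)] by (simp add: dist_norm p(2))
    then have "Cauchy (\<lambda>n. snd (p n))"
      using LIMSEQ_imp_Cauchy[OF f(2)] unfolding Cauchy_def by simp
    then obtain y where y: "(\<lambda>n. snd (p n)) \<longlonglongrightarrow> y"
      using Cauchy_convergent_iff convergent_def by blast
    have "p \<longlonglongrightarrow> (x, y)"
      using tendsto_Pair[OF f(2) y] p(2) by simp
    then show ?thesis
      using p(1) unfolding G_def closure_sequential by blast
  qed
  have ex_fst: "\<exists>x. (x, y) \<in> G" for y
  proof -
    have "y \<in> closure (snd ` G0)" using db img_snd by simp
    then obtain f where f: "\<And>n. f n \<in> snd ` G0" "f \<longlonglongrightarrow> y"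
      unfolding closure_sequential by blast
    then obtain p where p: "\<And>n. p n \<in> G0" "\<And>n. f n = snd (p n)"
      unfolding image_iff by metis
    have "dist (fst (p m)) (fst (p n)) = dist (f m) (f n)" for m n
      using nrm[OF diffG[of "p m" "p n"]] subsetD[OF G0G p(1)] by (simp add: dist_norm p(2))
    then have "Cauchy (\<lambda>n. fst (p n))"
      using LIMSEQ_imp_Cauchy[OF f(2)] unfolding Cauchy_def by simp
    then obtain x where x: "(\<lambda>n. fst (p n)) \<longlonglongrightarrow> x"
      using Cauchy_convergent_iff convergent_def by blast
    have "p \<longlonglongrightarrow> (x, y)"
      using tendsto_Pair[OF x f(2)] p(2) by simp
    then show ?thesis
      using p(1) unfolding G_def closure_sequential by blast
  qed
  \<comment> \<open>The difference of the two pairs is \<open>(0, y - y')\<close>, and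
    \<open>nrm\<close> makes its second coordinate vanish.\<close>
  have uniq: "y = y'" if "(x, y) \<in> G" "(x, y') \<in> G" for x y y'
    using nrm[OF diffG[OF that]] by simp
  obtain U where U: "\<And>x. (x, U x) \<in> G" using ex_snd by metis
  have UG: "U x = y" if "(x, y) \<in> G" for x y using U uniq that by blast
  have "U (x + y) = U x + U y" for x y
    using complex_vector.subspace_add[OF subG U[of x] U[of y]] by (simp add: UG)
  moreover have Us: "U (c *\<^sub>C x) = c *\<^sub>C U x" for c x
    using complex_vector.subspace_scale[OF subG U[of x], of c] by (simp add: UG scaleC_prod_def)
  moreover have "norm (U x) = norm x" for x using nrm[OF U[of x]] by simp
  ultimately have "bounded_linear U"
    by (intro bounded_linear_intro[of _ 1]) (auto simp: scaleR_scaleC)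
  then have "unitary U"
    unfolding unitary_def bounded_clinear_def using Us iso[OF U U] ex_fst UG by (auto simp: surj_def) metis
  moreover have "U (a i) = b i" if "i \<in> I" for i
    using that G0G complex_vector.span_base[of "(a i, b i)" "(\<lambda>i. (a i, b i)) ` I"]
    by (intro UG) (auto simp: G0_def)
  ultimately show ?thesis by blast
qed

section \<open>Holomorphic maps into a Hilbert space\<close>

definition vderiv :: "(complex \<Rightarrow> 'a::complex_inner) \<Rightarrow> complex \<Rightarrow> 'a"
  where "vderiv \<gamma> w = frechet_derivative \<gamma> (at w) 1"

lemma vector_holomorphic_on_open:
  "open S \<Longrightarrow> vector_holomorphic_on \<gamma> S \<longleftrightarrow>
    (\<forall>w\<in>S. \<exists>D. (\<gamma> has_derivative (\<lambda>h. h *\<^sub>C D)) (at w))"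
  unfolding vector_holomorphic_on_def by (simp add: at_within_open[of _ S])

lemma vderiv_unique:
  assumes "(\<gamma> has_derivative (\<lambda>h. h *\<^sub>C D)) (at w)"
  shows "vderiv \<gamma> w = D"
  using frechet_derivative_at[OF assms, symmetric] by (simp add: vderiv_def)

lemma has_derivative_vderiv:
  assumes "vector_holomorphic_on \<gamma> S" "open S" "w \<in> S"
  shows "(\<gamma> has_derivative (\<lambda>h. h *\<^sub>C vderiv \<gamma> w)) (at w)"
  using assms vderiv_unique vector_holomorphic_on_open by blast

lemma vector_holomorphic_on_subset:
  assumes "vector_holomorphic_on \<gamma> S" "T \<subseteq> S"
  shows "vector_holomorphic_on \<gamma> T"
  using assms unfolding vector_holomorphic_on_def by (meson has_derivative_subset subset_iff)

lemma vector_holomorphic_on_imp_continuous_on: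
  "vector_holomorphic_on \<gamma> S \<Longrightarrow> continuous_on S \<gamma>"
  unfolding vector_holomorphic_on_def continuous_on_eq_continuous_within
  using has_derivative_continuous by blast

lemma has_derivative_cinner_const:
  assumes "(\<gamma> has_derivative (\<lambda>h. h *\<^sub>C D)) (at w)"
  shows "((\<lambda>w. cinner (\<gamma> w) x) has_field_derivative cinner D x) (at w)"
  using has_derivative_cinner[OF assms has_derivative_const[of x]]
  unfolding has_field_derivative_def
  by (rule back_subst[of "\<lambda>f. (_ has_derivative f) _"]) (simp add: fun_eq_iff cinner_scaleC_left)

lemma holomorphic_on_cinner:
  assumes "vector_holomorphic_on \<gamma> S" "open S"
  shows "(\<lambda>w. cinner (\<gamma> w) x) holomorphic_on S"
  unfolding holomorphic_on_open[OF assms(2)]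
  using has_derivative_cinner_const[OF has_derivative_vderiv[OF assms]] by blast

lemma deriv_cinner:
  assumes "vector_holomorphic_on \<gamma> S" "open S" "w \<in> S"
  shows "deriv (\<lambda>w. cinner (\<gamma> w) x) w = cinner (vderiv \<gamma> w) x"
  using has_derivative_cinner_const[OF has_derivative_vderiv[OF assms]] by (rule DERIV_imp_deriv)

lemma vector_holomorphic_on_bounded_clinear:
  assumes "bounded_clinear W" "vector_holomorphic_on \<gamma> S"
  shows "vector_holomorphic_on (\<lambda>w. W (\<gamma> w)) S"
proof -
  have "((\<lambda>w. W (\<gamma> w)) has_derivative (\<lambda>h. h *\<^sub>C W D)) (at w within S)"
    if "(\<gamma> has_derivative (\<lambda>h. h *\<^sub>C D)) (at w within S)" for w D
    using bounded_linear.has_derivative[OF bounded_clinear_D(1)[OF assms(1)] that]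
    by (simp add: bounded_clinear_D(2)[OF assms(1)])
  then show ?thesis
    using assms(2) unfolding vector_holomorphic_on_def by blast
qed

lemma has_derivative_scaleC_holomorphic:
  fixes \<gamma> :: "complex \<Rightarrow> 'a::complex_inner"
  assumes "(f has_field_derivative f') (at w)" "(\<gamma> has_derivative (\<lambda>h. h *\<^sub>C D)) (at w)"
  shows "((\<lambda>w. f w *\<^sub>C \<gamma> w) has_derivative (\<lambda>h. h *\<^sub>C (f w *\<^sub>C D + f' *\<^sub>C \<gamma> w))) (at w)"
  using has_derivative_scaleC[OF assms(1)[unfolded has_field_derivative_def] assms(2)]
  by (rule back_subst[of "\<lambda>f. (_ has_derivative f) _"])
    (simp add: fun_eq_iff scaleC_add_right mult.commute)

lemma vector_holomorphic_on_scaleC: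
  assumes "f holomorphic_on S" "vector_holomorphic_on \<gamma> S" "open S"
  shows "vector_holomorphic_on (\<lambda>w. f w *\<^sub>C \<gamma> w) S"
  using has_derivative_scaleC_holomorphic assms
  unfolding vector_holomorphic_on_open[OF assms(3)] holomorphic_on_open[OF assms(3)] by blast

text \<open>By the Cauchy inequalities, the Taylor remainders of the scalar functions
  \<open>cinner (F w) x\<close> are controlled uniformly in \<open>x\<close>, so the difference quotients of \<open>F\<close>
  satisfy a Cauchy condition.\<close>

lemma vector_holomorphic_on_if_weak:
  fixes F :: "complex \<Rightarrow> 'a::separable_hilbert"
  assumes S: "open S" and hol: "\<And>x. (\<lambda>w. cinner (F w) x) holomorphic_on S"
    and bdd: "\<And>z. z \<in> S \<Longrightarrow> \<exists>r>0. \<exists>B. \<forall>w\<in>ball z r. norm (F w) \<le> B"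
  shows "vector_holomorphic_on F S"
  unfolding vector_holomorphic_on_open[OF S]
proof
  fix z assume z: "z \<in> S"
  obtain r1 B where r1: "r1 > 0" "\<And>w. w \<in> ball z r1 \<Longrightarrow> norm (F w) \<le> B"
    using bdd[OF z] by blast
  obtain r2 where r2: "r2 > 0" "ball z r2 \<subseteq> S"
    using S z openE by blast
  \<comment> \<open>The factor 4 keeps every closed disc of radius \<open>r\<close> about a point of
    \<open>ball z r\<close> inside both given discs, as \<open>2 * r\<close> is smaller than either
    radius.\<close>
  define r where "r = min r1 r2 / 4"
  have r: "r > 0" using r1 r2 by (simp add: r_def)
  have sub: "cball u r \<subseteq> ball z r1" "cball u r \<subseteq> S" if "u \<in> ball z r" for u
  proof -
    have "cball u r \<subseteq> ball z (min r1 r2)"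
    proof
      fix y assume "y \<in> cball u r"
      then have "dist z y < r + r"
        using that dist_triangle[of z y u] by (simp add: dist_commute)
      also have "r + r < min r1 r2" using r1(1) r2(1) by (auto simp: r_def min_def)
      finally show "y \<in> ball z (min r1 r2)" by simp
    qed
    moreover have "ball z (min r1 r2) \<subseteq> ball z r1" "ball z (min r1 r2) \<subseteq> ball z r2"
      by (simp_all add: subset_ball)
    ultimately show "cball u r \<subseteq> ball z r1" "cball u r \<subseteq> S" using r2(2) by (meson order_trans)+
  qed
  have B0: "B \<ge> 0" using r1(2)[of z] r1(1) norm_ge_zero[of "F z"] by (meson centre_in_ball order_trans)
  \<comment> \<open>Cauchy's bound for the second derivative on discs of radius \<open>r\<close> is
    \<open>fact 2 * (B * norm x) / r\<^sup>2\<close>; \<open>K\<close> is this constant with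
    \<open>norm x\<close> split off.\<close>
  define K where "K = 2 * B / r\<^sup>2"
  have K0: "K \<ge> 0" using B0 by (simp add: K_def)
  define \<phi> where "\<phi> h = (1 / h) *\<^sub>C (F (z + h) - F z)" for h
  have rem: "cmod (cinner (\<phi> h) x - deriv (\<lambda>w. cinner (F w) x) z) \<le> K * norm x * cmod h"
    if h: "h \<noteq> 0" "cmod h < r" for h x
  proof -
    define f where "f = (\<lambda>w. cinner (F w) x)"
    have holf: "f holomorphic_on S" unfolding f_def by (rule hol)
    have d2: "cmod ((deriv ^^ 2) f u) \<le> K * norm x" if u: "u \<in> ball z r" for u
    proof -
      have "cmod ((deriv ^^ 2) f u) \<le> fact 2 * (B * norm x) / r ^ 2"
      proof (rule Cauchy_inequality)
        show "f holomorphic_on ball u r" "continuous_on (cball u r) f"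
          using holf sub[OF u] ball_subset_cball
          by (blast intro: holomorphic_on_subset holomorphic_on_imp_continuous_on)+
        fix y assume "cmod (u - y) = r"
        then have "norm (F y) \<le> B" using sub(1)[OF u] by (intro r1) (auto simp: dist_norm)
        then show "cmod (f y) \<le> B * norm x"
          unfolding f_def using cinner_Cauchy_Schwarz mult_right_mono norm_ge_zero order_trans by metis
      qed (use r in auto)
      then show ?thesis by (simp add: K_def)
    qed
    have subz: "ball z r \<subseteq> S" using sub(2)[of z] r ball_subset_cball by fastforce
    have "cmod ((deriv ^^ 0) f (z + h) - (\<Sum>i\<le>1. (deriv ^^ i) f z * (z + h - z) ^ i / fact i))
        \<le> K * norm x * cmod (z + h - z) ^ Suc 1 / fact 1"
    proof (rule complex_Taylor[of "ball z r" 1 "\<lambda>i. (deriv ^^ i) f"])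
      fix i :: nat and y assume "y \<in> ball z r" "i \<le> 1"
      then show "((deriv ^^ i) f has_field_derivative (deriv ^^ Suc i) f y) (at y within ball z r)"
        using has_field_derivative_higher_deriv[OF holf S] subz
        by (meson has_field_derivative_at_within subsetD)
    qed (use d2 h r in \<open>auto simp: numeral_2_eq_2 dist_norm\<close>)
    then have "cmod (f (z + h) - f z - deriv f z * h) \<le> (K * norm x * cmod h) * cmod h"
      by (simp add: algebra_simps power2_eq_square)
    moreover have "f (z + h) - f z - deriv f z * h = (cinner (\<phi> h) x - deriv f z) * h"
      using h by (simp add: \<phi>_def f_def cinner_scaleC_left cinner_diff_left field_simps)
    ultimately show ?thesis
      using h unfolding f_def[symmetric] by (simp add: norm_mult)
  qed
  \<comment> \<open>Both quotients are compared with the same scalar derivative, which cancels; the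
    constant does not depend on the test vector, so the bound passes to the norm.\<close>
  have diff: "norm (\<phi> h - \<phi> k) \<le> K * (cmod h + cmod k)"
    if "h \<noteq> 0" "cmod h < r" "k \<noteq> 0" "cmod k < r" for h k
  proof (rule norm_le_if_cinner_le)
    fix x
    have "cmod (cinner (\<phi> h - \<phi> k) x) \<le>
        cmod (cinner (\<phi> h) x - deriv (\<lambda>w. cinner (F w) x) z) +
        cmod (cinner (\<phi> k) x - deriv (\<lambda>w. cinner (F w) x) z)"
      unfolding cinner_diff_left by (rule norm_triangle_ineq4[THEN back_subst[of "\<lambda>t. t \<le> _"]]) simp
    also have "\<dots> \<le> K * norm x * cmod h + K * norm x * cmod k"
      using that by (intro add_mono rem)
    finally show "cmod (cinner (\<phi> h - \<phi> k) x) \<le> K * (cmod h + cmod k) * norm x"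
      by (simp add: algebra_simps)
  qed (use K0 in simp)
  \<comment> \<open>A sequence of nonzero increments tending to 0. The summand 2 keeps even the
    first of them strictly below \<open>r\<close>.\<close>
  define k where "k n = complex_of_real (r / (real n + 2))" for n
  have k: "k n \<noteq> 0" "cmod (k n) < r" for n
    unfolding k_def norm_of_real of_real_eq_0_iff using r by (auto simp: field_simps intro: add_pos_nonneg)
  have k_lim: "k \<longlonglongrightarrow> 0"
  proof -
    have "(\<lambda>n. r / (real n + 2)) \<longlonglongrightarrow> 0" by real_asymp
    then show ?thesis unfolding k_def by (metis tendsto_of_real of_real_0)
  qed
  have "Cauchy (\<lambda>n. \<phi> (k n))"
  proof (rule metric_CauchyI)
    fix e :: real assume e: "e > 0"
    have "(\<lambda>n. K * cmod (k n)) \<longlonglongrightarrow> K * 0"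
      by (intro tendsto_intros tendsto_norm_zero k_lim)
    then have "\<forall>\<^sub>F n in sequentially. K * cmod (k n) < e / 2"
      by (rule order_tendstoD(2)) (use e in simp)
    then obtain N where N: "\<And>n. n \<ge> N \<Longrightarrow> K * cmod (k n) < e / 2"
      unfolding eventually_sequentially by blast
    have "dist (\<phi> (k m)) (\<phi> (k n)) < e" if "m \<ge> N" "n \<ge> N" for m n
      using diff[OF k(1,2)[of m] k(1,2)[of n]] N[OF that(1)] N[OF that(2)]
      by (simp add: dist_norm algebra_simps)
    then show "\<exists>N. \<forall>m\<ge>N. \<forall>n\<ge>N. dist (\<phi> (k m)) (\<phi> (k n)) < e" by blast
  qed
  then obtain D where D: "(\<lambda>n. \<phi> (k n)) \<longlonglongrightarrow> D"
    using Cauchy_convergent_iff convergent_def by blast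
  have est: "norm (\<phi> h - D) \<le> K * cmod h" if h: "h \<noteq> 0" "cmod h < r" for h
  proof (rule tendsto_le[of sequentially])
    show "(\<lambda>n. norm (\<phi> h - \<phi> (k n))) \<longlonglongrightarrow> norm (\<phi> h - D)"
      by (intro tendsto_intros D)
    show "(\<lambda>n. K * (cmod h + cmod (k n))) \<longlonglongrightarrow> K * cmod h"
      using tendsto_mult[OF tendsto_const[of K] tendsto_add[OF tendsto_const[of "cmod h"] tendsto_norm_zero[OF k_lim]]]
      by simp
  qed (use diff[OF h k] in auto)
  have "(F has_derivative (\<lambda>h. h *\<^sub>C D)) (at z)"
    unfolding has_derivative_at
  proof
    show "bounded_linear (\<lambda>h. h *\<^sub>C D)"
      by (rule bounded_bilinear.bounded_linear_left[OF bounded_bilinear_scaleC])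
    show "(\<lambda>h. norm (F (z + h) - F z - h *\<^sub>C D) / norm h) \<midarrow>0\<rightarrow> 0"
    proof (rule Lim_null_comparison)
      have "\<forall>\<^sub>F h in at 0. h \<noteq> 0 \<and> cmod h < r"
        unfolding eventually_at using r by (intro exI[of _ r]) (auto simp: dist_norm)
      then show "\<forall>\<^sub>F h in at 0. norm (norm (F (z + h) - F z - h *\<^sub>C D) / norm h) \<le> K * cmod h"
      proof eventually_elim
        case (elim h)
        have "F (z + h) - F z - h *\<^sub>C D = h *\<^sub>C (\<phi> h - D)"
          using elim by (simp add: \<phi>_def complex_vector.scale_right_diff_distrib)
        then show ?case using est[of h] elim by simp
      qed
      show "(\<lambda>h. K * cmod h) \<midarrow>0\<rightarrow> 0"
        by (rule tendsto_mult_right_zero[OF tendsto_norm_zero[OF tendsto_ident_at]])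
    qed
  qed
  then show "\<exists>D. (F has_derivative (\<lambda>h. h *\<^sub>C D)) (at z)" by blast
qed

lemma vector_holomorphic_on_if_weak_continuous:
  fixes F :: "complex \<Rightarrow> 'a::separable_hilbert"
  assumes S: "open S" and hol: "\<And>x. (\<lambda>w. cinner (F w) x) holomorphic_on S"
    and c: "continuous_on S F"
  shows "vector_holomorphic_on F S"
proof (rule vector_holomorphic_on_if_weak[OF S hol])
  fix z assume z: "z \<in> S"
  have "F \<midarrow>z\<rightarrow> F z"
    using c S z continuous_on_eq_continuous_at isContD by blast
  then obtain r where "r > 0" "\<And>w. w \<noteq> z \<Longrightarrow> dist w z < r \<Longrightarrow> dist (F w) (F z) < 1"
    unfolding LIM_def by (meson zero_less_one)
  have "norm (F w) \<le> norm (F z) + 1" if "w \<in> ball z r" for w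
  proof (cases "w = z")
    case False
    have "norm (F w - F z) < 1"
      using \<open>\<And>w. w \<noteq> z \<Longrightarrow> dist w z < r \<Longrightarrow> dist (F w) (F z) < 1\<close>[OF False] that
      by (simp add: dist_norm dist_commute[of z] norm_minus_commute)
    then show ?thesis using norm_triangle_sub[of "F w" "F z"] by linarith
  qed simp
  with \<open>r > 0\<close> show "\<exists>r>0. \<exists>B. \<forall>w\<in>ball z r. norm (F w) \<le> B" by blast
qed

text \<open>The scalar products of \<open>vderiv \<gamma>\<close> are derivatives of holomorphic
  functions. Local boundedness is the first Cauchy inequality on discs of radius \<open>r/2\<close>,
  which stay in a compact disc where \<open>\<gamma>\<close> is bounded. It serves to differentiate
  \<open>log_partial\<close>.\<close>

lemma vector_holomorphic_on_vderiv:
  fixes \<gamma> :: "complex \<Rightarrow> 'a::separable_hilbert"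
  assumes hol: "vector_holomorphic_on \<gamma> S" and S: "open S"
  shows "vector_holomorphic_on (vderiv \<gamma>) S"
proof (rule vector_holomorphic_on_if_weak[OF S])
  fix x
  show "(\<lambda>w. cinner (vderiv \<gamma> w) x) holomorphic_on S"
    using holomorphic_deriv[OF holomorphic_on_cinner[OF hol S] S]
    by (rule holomorphic_transform) (simp add: deriv_cinner[OF hol S])
next
  fix z assume z: "z \<in> S"
  obtain r where r: "r > 0" "cball z r \<subseteq> S"
    using S z open_contains_cball by blast
  have "compact (\<gamma> ` cball z r)"
    using vector_holomorphic_on_imp_continuous_on[OF hol] r(2)
    by (intro compact_continuous_image) (auto intro: continuous_on_subset)
  then obtain B where B: "\<And>w. w \<in> cball z r \<Longrightarrow> norm (\<gamma> w) \<le> B"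
    using compact_imp_bounded bounded_iff by (metis imageI)
  have B0: "0 \<le> B" using order_trans[OF norm_ge_zero B[of z]] r by simp
  have "norm (vderiv \<gamma> u) \<le> B / (r/2)" if u: "u \<in> ball z (r/2)" for u
  proof (rule norm_le_if_cinner_le)
    fix x
    have sub: "cball u (r/2) \<subseteq> cball z r"
      using u r by (auto simp: cball_subset_cball_iff dist_commute)
    have "cmod ((deriv ^^ 1) (\<lambda>w. cinner (\<gamma> w) x) u) \<le> fact 1 * (B * norm x) / (r/2) ^ 1"
    proof (rule Cauchy_inequality)
      show "(\<lambda>w. cinner (\<gamma> w) x) holomorphic_on ball u (r/2)"
        "continuous_on (cball u (r/2)) (\<lambda>w. cinner (\<gamma> w) x)"
        using holomorphic_on_cinner[OF hol S] sub r(2) ball_subset_cball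
        by (blast intro: holomorphic_on_subset holomorphic_on_imp_continuous_on)+
      fix y assume "cmod (u - y) = r/2"
      then have "norm (\<gamma> y) \<le> B" using sub by (intro B) (auto simp: dist_norm)
      then show "cmod (cinner (\<gamma> y) x) \<le> B * norm x"
        using cinner_Cauchy_Schwarz mult_right_mono norm_ge_zero order_trans by metis
    qed (use r in auto)
    moreover have "u \<in> S" using sub r by (meson centre_in_cball half_gt_zero less_imp_le subsetD)
    ultimately show "cmod (cinner (vderiv \<gamma> u) x) \<le> B / (r/2) * norm x"
      by (simp add: deriv_cinner[OF hol S] mult_ac)
  qed (use B0 r in auto)
  then show "\<exists>r>0. \<exists>B. \<forall>w\<in>ball z r. norm (vderiv \<gamma> w) \<le> B"
    using r(1) half_gt_zero by blast
qed

section \<open>Identity theorem and zeros of vector-valued maps\<close>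

lemma vector_holomorphic_on_identity:
  assumes hol: "vector_holomorphic_on \<gamma> S" and S: "open S" "connected S"
    and N: "open N" "N \<noteq> {}" "N \<subseteq> S" and "\<And>w. w \<in> N \<Longrightarrow> cinner (\<gamma> w) x = 0" and w: "w \<in> S"
  shows "cinner (\<gamma> w) x = 0"
  using analytic_continuation_open[OF N(1) S(1) N(2) S(2) N(3), of "\<lambda>w. cinner (\<gamma> w) x" "\<lambda>_. 0" w]
    holomorphic_on_cinner[OF hol S(1)] assms by (simp add: holomorphic_on_subset)

text \<open>Pairing with the nonzero value \<open>\<gamma> v\<close> gives a scalar holomorphic
  function that is nonzero at \<open>v\<close>; its zeros are isolated, and every zero of
  \<open>\<gamma>\<close> is one of them.\<close>

lemma vector_holomorphic_isolated_zeros: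
  assumes hol: "vector_holomorphic_on \<gamma> S" and S: "open S" "connected S"
    and ne: "\<exists>w\<in>S. \<gamma> w \<noteq> 0" and z: "z \<in> S"
  shows "\<forall>\<^sub>F w in at z. \<gamma> w \<noteq> 0"
proof -
  obtain v where v: "v \<in> S" "\<gamma> v \<noteq> 0" using ne by blast
  then have "cinner (\<gamma> v) (\<gamma> v) \<noteq> 0" by (simp add: cinner_self)
  then have "\<forall>\<^sub>F w in at z. cinner (\<gamma> w) (\<gamma> v) \<noteq> 0 \<and> w \<in> S"
    using non_zero_neighbour_alt[OF holomorphic_on_cinner[OF hol S(1)] S z v(1)] by blast
  then show ?thesis by (rule eventually_mono) auto
qed

text \<open>Removable singularity: the quotient is completed by \<open>vderiv \<gamma> z0\<close>.
  Continuity at \<open>z0\<close> is the definition of the derivative, and each scalar product is a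
  removable quotient of the scalar theory, so the weak criterion applies.\<close>

lemma vector_holomorphic_divide_zero:
  fixes \<gamma> :: "complex \<Rightarrow> 'a::separable_hilbert"
  assumes hol: "vector_holomorphic_on \<gamma> S" and S: "open S" and z0: "z0 \<in> S" "\<gamma> z0 = 0"
  obtains G where "vector_holomorphic_on G S" "\<And>w. w \<in> S \<Longrightarrow> \<gamma> w = (w - z0) *\<^sub>C G w"
proof -
  define G where "G w = (if w = z0 then vderiv \<gamma> z0 else (1 / (w - z0)) *\<^sub>C \<gamma> w)" for w
  have cont: "continuous_on S G"
    unfolding continuous_on_eq_continuous_at[OF S]
  proof
    fix w assume w: "w \<in> S"
    show "isCont G w"
    proof (cases "w = z0")
      case False
      have "isCont \<gamma> w"
        using vector_holomorphic_on_imp_continuous_on[OF hol] S w continuous_on_eq_continuous_at by blast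
      then have "isCont (\<lambda>w. (1 / (w - z0)) *\<^sub>C \<gamma> w) w"
        unfolding isCont_def using False by (intro tendsto_intros) auto
      moreover have "\<forall>\<^sub>F v in nhds w. G v = (1 / (v - z0)) *\<^sub>C \<gamma> v"
        using t1_space_nhds[OF False] by (rule eventually_mono) (simp add: G_def)
      ultimately show ?thesis by (simp add: isCont_cong)
    next
      case True
      have "(\<lambda>h. norm (\<gamma> (z0 + h) - \<gamma> z0 - h *\<^sub>C vderiv \<gamma> z0) / norm h) \<midarrow>0\<rightarrow> 0"
        using has_derivative_vderiv[OF hol S z0(1)] unfolding has_derivative_at by blast
      then have "(\<lambda>h. norm (G (z0 + h) - G z0)) \<midarrow>0\<rightarrow> 0"
      proof (rule Lim_transform_eventually)
        have "norm (\<gamma> (z0 + h) - \<gamma> z0 - h *\<^sub>C vderiv \<gamma> z0) / norm h = norm (G (z0 + h) - G z0)"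
          if "h \<noteq> 0" for h
        proof -
          have "\<gamma> (z0 + h) - \<gamma> z0 - h *\<^sub>C vderiv \<gamma> z0 = h *\<^sub>C (G (z0 + h) - G z0)"
            using that z0(2) by (simp add: G_def complex_vector.scale_right_diff_distrib)
          then show ?thesis using that by simp
        qed
        then show "\<forall>\<^sub>F h in at 0. norm (\<gamma> (z0 + h) - \<gamma> z0 - h *\<^sub>C vderiv \<gamma> z0) / norm h =
            norm (G (z0 + h) - G z0)"
          by (auto simp: eventually_at_filter)
      qed
      then show ?thesis
        using True unfolding isCont_iff
        by (simp add: tendsto_norm_zero_iff LIM_zero_iff)
    qed
  qed
  have "(\<lambda>w. cinner (G w) x) holomorphic_on S" for x
  proof -
    have "(\<lambda>z. if z = z0 then deriv (\<lambda>w. cinner (\<gamma> w) x) z0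
        else (cinner (\<gamma> z) x - cinner (\<gamma> z0) x) / (z - z0)) holomorphic_on S"
      using pole_lemma[OF holomorphic_on_cinner[OF hol S]] z0(1) S by (simp add: interior_open)
    then show ?thesis
      by (rule holomorphic_transform)
        (simp add: G_def deriv_cinner[OF hol S] z0 cinner_scaleC_left)
  qed
  then have "vector_holomorphic_on G S"
    by (rule vector_holomorphic_on_if_weak_continuous[OF S _ cont])
  moreover have "\<gamma> w = (w - z0) *\<^sub>C G w" if "w \<in> S" for w
    using z0(2) by (simp add: G_def)
  ultimately show ?thesis using that by blast
qed

text \<open>Here \<open>n\<close> is the order of vanishing of a single scalar product. Each
  division lowers it by one, so the divisions stop after at most \<open>n\<close> rounds; the order
  \<open>m\<close> of \<open>\<gamma>\<close> may be smaller, since \<open>x\<close> is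
  arbitrary.\<close>

lemma vector_holomorphic_factor_aux:
  fixes \<gamma> :: "complex \<Rightarrow> 'a::separable_hilbert"
  assumes "vector_holomorphic_on \<gamma> S" and S: "open S" and z0: "z0 \<in> S"
    and g: "isCont g z0" "g z0 \<noteq> 0"
    and "\<forall>\<^sub>F w in at z0. cinner (\<gamma> w) x = (w - z0) ^ n * g w"
  shows "\<exists>m G. vector_holomorphic_on G S \<and> G z0 \<noteq> 0 \<and> (\<forall>w\<in>S. \<gamma> w = (w - z0) ^ m *\<^sub>C G w)"
  using assms(1,6)
proof (induction n arbitrary: \<gamma>)
  case 0
  have "\<gamma> z0 \<noteq> 0"
  proof
    assume z: "\<gamma> z0 = 0"
    have "isCont \<gamma> z0"
      using vector_holomorphic_on_imp_continuous_on[OF 0(1)] S z0 continuous_on_eq_continuous_at by blast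
    then have "(\<lambda>w. cinner (\<gamma> w) x) \<midarrow>z0\<rightarrow> cinner (\<gamma> z0) x"
      unfolding isCont_def by (intro tendsto_intros)
    then have "g \<midarrow>z0\<rightarrow> 0"
      using 0(2) z by (simp add: tendsto_cong)
    then show False
      using g LIM_unique unfolding isCont_def by blast
  qed
  then show ?case
    using 0(1) by (intro exI[of _ 0] exI[of _ \<gamma>]) simp
next
  case (Suc n)
  show ?case
  proof (cases "\<gamma> z0 = 0")
    case False
    then show ?thesis
      using Suc.prems(1) by (intro exI[of _ 0] exI[of _ \<gamma>]) simp
  next
    case True
    obtain H where H: "vector_holomorphic_on H S" "\<And>w. w \<in> S \<Longrightarrow> \<gamma> w = (w - z0) *\<^sub>C H w"
      using vector_holomorphic_divide_zero[OF Suc.prems(1) S z0 True] by blast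
    have "\<forall>\<^sub>F w in at z0. w \<in> S \<and> w \<noteq> z0"
      using eventually_at_in_open[OF S z0] by simp
    with Suc.prems(2) have "\<forall>\<^sub>F w in at z0. cinner (H w) x = (w - z0) ^ n * g w"
      by eventually_elim (auto simp: H(2) cinner_scaleC_left)
    then obtain m G where "vector_holomorphic_on G S" "G z0 \<noteq> 0" "\<forall>w\<in>S. H w = (w - z0) ^ m *\<^sub>C G w"
      using Suc.IH[OF H(1)] by blast
    then show ?thesis
      by (intro exI[of _ "Suc m"] exI[of _ G]) (simp add: H(2))
  qed
qed

lemma vector_holomorphic_factor:
  fixes \<gamma> :: "complex \<Rightarrow> 'a::separable_hilbert"
  assumes hol: "vector_holomorphic_on \<gamma> S" and S: "open S" "connected S" and z0: "z0 \<in> S"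
    and ne: "\<exists>w\<in>S. \<gamma> w \<noteq> 0"
  shows "\<exists>m G. vector_holomorphic_on G S \<and> G z0 \<noteq> 0 \<and> (\<forall>w\<in>S. \<gamma> w = (w - z0) ^ m *\<^sub>C G w)"
proof (cases "\<gamma> z0 = 0")
  case False
  then show ?thesis
    using hol by (intro exI[of _ 0] exI[of _ \<gamma>]) simp
next
  case True
  obtain v where v: "v \<in> S" "\<gamma> v \<noteq> 0" using ne by blast
  define f where "f w = cinner (\<gamma> w) (\<gamma> v)" for w
  have "f v \<noteq> f z0" using True v by (simp add: f_def cinner_self)
  then have nc: "\<not> f constant_on S" using v z0 unfolding constant_on_def by metis
  have holf: "f holomorphic_on S" unfolding f_def by (rule holomorphic_on_cinner[OF hol S(1)])
  have f0: "f z0 = 0" using True by (simp add: f_def)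
  obtain g r n where "0 < n" and g: "0 < r" "ball z0 r \<subseteq> S" "g holomorphic_on ball z0 r"
    "\<And>w. w \<in> ball z0 r \<Longrightarrow> f w = (w - z0) ^ n * g w" "\<And>w. w \<in> ball z0 r \<Longrightarrow> g w \<noteq> 0"
    by (blast intro: holomorphic_factor_zero_nonconstant[OF holf S z0 f0 nc])
  have "isCont g z0"
    using holomorphic_on_imp_continuous_on[OF g(3)] g(1)
    by (simp add: continuous_on_eq_continuous_at)
  moreover have "\<forall>\<^sub>F w in at z0. cinner (\<gamma> w) (\<gamma> v) = (w - z0) ^ n * g w"
    unfolding eventually_at using g(1,4)
    by (intro exI[of _ r]) (simp add: f_def dist_commute)
  moreover have "g z0 \<noteq> 0" using g(1,5) by simp
  ultimately show ?thesis
    using vector_holomorphic_factor_aux[OF hol S(1) z0] by blast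
qed

section \<open>Polarization\<close>

lemma holomorphic_eq_0_if_real_eq_0:
  assumes "f holomorphic_on ball 0 r" and "\<And>t. \<bar>t\<bar> < r \<Longrightarrow> f (complex_of_real t) = 0"
    and "w \<in> ball 0 r"
  shows "f w = 0"
proof (rule analytic_continuation[OF assms(1)])
  have r: "r > 0" using assms(3) by (metis ball_eq_empty empty_iff not_le)
  show "complex_of_real ` {-r<..<r} \<subseteq> ball 0 r" by auto
  show "0 \<in> ball (0::complex) r" using r by simp
  show "(0::complex) islimpt complex_of_real ` {-r<..<r}"
    unfolding islimpt_approachable
  proof (intro allI impI)
    fix e :: real assume "e > 0"
    define t where "t = min e r / 2"
    have "0 < t" "t < e" "t < r"
      using \<open>e > 0\<close> r by (auto simp: t_def min_def)
    then show "\<exists>x\<in>complex_of_real ` {-r<..<r}. x \<noteq> 0 \<and> dist x 0 < e"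
      by (intro bexI[of _ "complex_of_real t"]) auto
  qed
qed (use assms in auto)

text \<open>The second slot of \<open>cinner\<close> is conjugate-linear and its argument depends on
  \<open>cnj a\<close>; the two conjugations cancel, which makes the derivative complex
  linear.\<close>

lemma holomorphic_on_cinner_reflected:
  assumes hol: "vector_holomorphic_on \<gamma> S" and S: "open S" and A: "open A"
    and maps: "\<And>a. a \<in> A \<Longrightarrow> u + c * a \<in> S" "\<And>a. a \<in> A \<Longrightarrow> v + d * cnj a \<in> S"
  shows "(\<lambda>a. cinner (\<gamma> (u + c * a)) (\<gamma> (v + d * cnj a))) holomorphic_on A"
  unfolding holomorphic_on_open[OF A]
proof
  fix a assume a: "a \<in> A"
  define D where "D = vderiv \<gamma> (u + c * a)"
  define E where "E = vderiv \<gamma> (v + d * cnj a)"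
  have "((\<lambda>a. u + c * a) has_derivative (\<lambda>h. c * h)) (at a)"
    by (auto intro!: derivative_eq_intros)
  then have 1: "((\<lambda>a. \<gamma> (u + c * a)) has_derivative (\<lambda>h. (c * h) *\<^sub>C D)) (at a)"
    unfolding D_def
    by (rule has_derivative_compose[where g = \<gamma> and f = "\<lambda>a. u + c * a"])
      (rule has_derivative_vderiv[OF hol S maps(1)[OF a]])
  have "((\<lambda>a. v + d * cnj a) has_derivative (\<lambda>h. d * cnj h)) (at a)"
    by (auto intro!: derivative_eq_intros bounded_linear.has_derivative[OF bounded_linear_cnj])
  then have 2: "((\<lambda>a. \<gamma> (v + d * cnj a)) has_derivative (\<lambda>h. (d * cnj h) *\<^sub>C E)) (at a)"
    unfolding E_def
    by (rule has_derivative_compose[where g = \<gamma> and f = "\<lambda>a. v + d * cnj a"])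
      (rule has_derivative_vderiv[OF hol S maps(2)[OF a]])
  have "((\<lambda>a. cinner (\<gamma> (u + c * a)) (\<gamma> (v + d * cnj a))) has_field_derivative
      (cnj d * cinner (\<gamma> (u + c * a)) E + c * cinner D (\<gamma> (v + d * cnj a)))) (at a)"
    unfolding has_field_derivative_def using has_derivative_cinner[OF 1 2]
    by (rule back_subst[of "\<lambda>f. (_ has_derivative f) _"])
      (simp add: fun_eq_iff cinner_scaleC_left cinner_scaleC_right algebra_simps)
  then show "\<exists>f'. ((\<lambda>a. cinner (\<gamma> (u + c * a)) (\<gamma> (v + d * cnj a))) has_field_derivative f') (at a)"
    by blast
qed

lemma holomorphic_on_cinner_two_variables:
  assumes hol: "vector_holomorphic_on \<gamma> (ball w0 r)" and c: "cmod c < r/2"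
  shows "(\<lambda>a. cinner (\<gamma> (w0 + a + \<i> * c)) (\<gamma> (w0 + cnj a + \<i> * cnj c))) holomorphic_on ball 0 (r/2)"
    and "(\<lambda>b. cinner (\<gamma> (w0 + c + \<i> * b)) (\<gamma> (w0 + cnj c + \<i> * cnj b))) holomorphic_on ball 0 (r/2)"
proof -
  \<comment> \<open>\<open>cmod a + cmod b < r\<close>: working with two independent variables costs
    half the radius.\<close>
  have inball: "w0 + a + \<i> * b \<in> ball w0 r" if "cmod a < r/2" "cmod b < r/2" for a b
    using norm_triangle_ineq[of a "\<i> * b"] norm_minus_cancel[of "a + \<i> * b"] that
    by (simp add: dist_norm norm_mult)
  have "(\<lambda>a. cinner (\<gamma> ((w0 + \<i> * c) + 1 * a)) (\<gamma> ((w0 + \<i> * cnj c) + 1 * cnj a))) holomorphic_on ball 0 (r/2)"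
  proof (rule holomorphic_on_cinner_reflected[OF hol open_ball open_ball])
    fix a :: complex assume "a \<in> ball 0 (r/2)"
    then show "w0 + \<i> * c + 1 * a \<in> ball w0 r" "w0 + \<i> * cnj c + 1 * cnj a \<in> ball w0 r"
      using inball[of a c] inball[of "cnj a" "cnj c"] c by (simp_all add: ac_simps)
  qed
  then show "(\<lambda>a. cinner (\<gamma> (w0 + a + \<i> * c)) (\<gamma> (w0 + cnj a + \<i> * cnj c))) holomorphic_on ball 0 (r/2)"
    by (simp add: ac_simps)
  show "(\<lambda>b. cinner (\<gamma> (w0 + c + \<i> * b)) (\<gamma> (w0 + cnj c + \<i> * cnj b))) holomorphic_on ball 0 (r/2)"
  proof (rule holomorphic_on_cinner_reflected[OF hol open_ball open_ball])
    fix b :: complex assume "b \<in> ball 0 (r/2)"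
    then show "w0 + c + \<i> * b \<in> ball w0 r" "w0 + cnj c + \<i> * cnj b \<in> ball w0 r"
      using inball[of c b] inball[of "cnj c" "cnj b"] c by simp_all
  qed
qed

text \<open>Polarization: with \<open>w = w0 + a + \<i> b\<close> and \<open>z = w0 + cnj a + \<i> cnj b\<close> the kernel is
  holomorphic in \<open>a\<close> and in \<open>b\<close> separately, and for real \<open>a\<close>, \<open>b\<close> it is evaluated on the
  diagonal.\<close>

lemma cinner_eq_if_norm_eq:
  fixes \<gamma> :: "complex \<Rightarrow> 'a::complex_inner" and \<delta> :: "complex \<Rightarrow> 'b::complex_inner"
  assumes hol: "vector_holomorphic_on \<gamma> (ball w0 r)" "vector_holomorphic_on \<delta> (ball w0 r)"
    and eq: "\<And>w. w \<in> ball w0 r \<Longrightarrow> norm (\<gamma> w) = norm (\<delta> w)"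
    and w: "w \<in> ball w0 (r/2)" and z: "z \<in> ball w0 (r/2)"
  shows "cinner (\<gamma> w) (\<gamma> z) = cinner (\<delta> w) (\<delta> z)"
proof -
  define g where "g a b = cinner (\<gamma> (w0 + a + \<i> * b)) (\<gamma> (w0 + cnj a + \<i> * cnj b)) -
    cinner (\<delta> (w0 + a + \<i> * b)) (\<delta> (w0 + cnj a + \<i> * cnj b))" for a b
  have inball: "w0 + a + \<i> * b \<in> ball w0 r" if "cmod a < r/2" "cmod b < r/2" for a b
    using norm_triangle_ineq[of a "\<i> * b"] norm_minus_cancel[of "a + \<i> * b"] that
    by (simp add: dist_norm norm_mult)
  have hol_a: "(\<lambda>a. g a b) holomorphic_on ball 0 (r/2)" if "cmod b < r/2" for b
    unfolding g_def using that hol by (intro holomorphic_on_diff holomorphic_on_cinner_two_variables)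
  have hol_b: "(\<lambda>b. g a b) holomorphic_on ball 0 (r/2)" if "cmod a < r/2" for a
    unfolding g_def using that hol by (intro holomorphic_on_diff holomorphic_on_cinner_two_variables)
  have diag: "g (complex_of_real s) (complex_of_real t) = 0" if "\<bar>s\<bar> < r/2" "\<bar>t\<bar> < r/2" for s t
    using eq[OF inball[of "of_real s" "of_real t"]] that by (simp add: g_def cinner_self)
  \<comment> \<open>For real second argument the vanishing spreads from real to complex
    \<open>a\<close>; for each such \<open>a\<close> it then spreads from real to complex
    \<open>b\<close>.\<close>
  have 1: "g a (complex_of_real t) = 0" if "cmod a < r/2" "\<bar>t\<bar> < r/2" for a t
    using holomorphic_eq_0_if_real_eq_0[OF hol_a[of "of_real t"]] diag that by auto
  have 2: "g a b = 0" if "cmod a < r/2" "cmod b < r/2" for a b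
    using holomorphic_eq_0_if_real_eq_0[OF hol_b[of a]] 1 that by auto
  \<comment> \<open>\<open>p\<close> and \<open>q\<close> are to be \<open>a + \<i> b\<close> and
    \<open>a - \<i> b\<close>; conjugating the latter gives \<open>cnj a + \<i> cnj b\<close>, the
    offset of \<open>z\<close> from \<open>w0\<close>. Solving for \<open>a\<close> and
    \<open>b\<close> only takes averages, so both stay below \<open>r/2\<close>.\<close>
  define p where "p = w - w0"
  define q where "q = cnj (z - w0)"
  have pq: "cmod p < r/2" "cmod q < r/2"
    using w z by (auto simp: p_def q_def dist_norm norm_minus_commute simp flip: complex_cnj_diff)
  have ab: "cmod ((p + q) / 2) < r/2" "cmod (- \<i> * (p - q) / 2) < r/2"
    using pq norm_triangle_ineq[of p q] norm_triangle_ineq4[of p q]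
    by (simp_all add: norm_divide norm_mult)
  have "w0 + (p + q) / 2 + \<i> * (- \<i> * (p - q) / 2) = w"
    by (simp add: p_def field_simps)
  moreover have "w0 + cnj ((p + q) / 2) + \<i> * cnj (- \<i> * (p - q) / 2) = z"
    by (simp add: q_def field_simps)
  ultimately show ?thesis
    using 2[OF ab] unfolding g_def by simp
qed

section \<open>Curvature\<close>

text \<open>\<open>frechet_derivative\<close> is a choice among all derivatives, and the two maps
  have the same ones; so the equality also holds where no derivative exists.\<close>

lemma frechet_derivative_cong:
  assumes "open S" "w \<in> S" "\<And>z. z \<in> S \<Longrightarrow> f z = g z"
  shows "frechet_derivative f (at w) = frechet_derivative g (at w)"
proof -
  have "(f has_derivative D) (at w) \<longleftrightarrow> (g has_derivative D) (at w)" for D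
    using has_derivative_transform_within_open[of f D w UNIV S g]
      has_derivative_transform_within_open[of g D w UNIV S f] assms by auto
  then show ?thesis by (simp add: frechet_derivative_def)
qed

lemma wirtinger_cong:
  assumes "open S" "w \<in> S" "\<And>z. z \<in> S \<Longrightarrow> f z = g z"
  shows "wirtinger f w = wirtinger g w" "wirtinger_bar f w = wirtinger_bar g w"
  by (simp_all add: wirtinger_def wirtinger_bar_def frechet_derivative_cong[OF assms])

lemma wirtinger_add:
  assumes "f differentiable at w" "g differentiable at w"
  shows "wirtinger (\<lambda>z. f z + g z) w = wirtinger f w + wirtinger g w"
  using assms frechet_derivative_at[OF has_derivative_add[OF assms[unfolded frechet_derivative_works]],
      symmetric]
  by (simp add: wirtinger_def add_divide_distrib diff_divide_distrib algebra_simps)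

lemma wirtinger_cnj_holomorphic:
  assumes "(q has_field_derivative q') (at w)"
  shows "wirtinger (\<lambda>z. cnj (q z)) w = 0" "(\<lambda>z. cnj (q z)) differentiable at w"
proof -
  have D: "((\<lambda>z. cnj (q z)) has_derivative (\<lambda>h. cnj (q' * h))) (at w)"
    using bounded_linear.has_derivative[OF bounded_linear_cnj] assms
    unfolding has_field_derivative_def by blast
  then show "(\<lambda>z. cnj (q z)) differentiable at w"
    unfolding differentiable_def by blast
  show "wirtinger (\<lambda>z. cnj (q z)) w = 0"
    unfolding wirtinger_def frechet_derivative_at[OF D, symmetric] by (simp add: complex_eq_iff)
qed

text \<open>This is \<open>\<partial> ln (norm \<gamma>)\<^sup>2\<close> for holomorphic
  \<open>\<gamma>\<close>. The logarithm being real, its derivative along \<open>h\<close> is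
  \<open>2 * Re (h * log_partial \<gamma> w)\<close>, and its antiholomorphic derivative is the
  conjugate.\<close>

definition log_partial :: "(complex \<Rightarrow> 'a::complex_inner) \<Rightarrow> complex \<Rightarrow> complex"
  where "log_partial \<gamma> w = cinner (vderiv \<gamma> w) (\<gamma> w) / cinner (\<gamma> w) (\<gamma> w)"

lemma has_derivative_ln_norm:
  assumes hol: "vector_holomorphic_on \<gamma> S" and S: "open S" and w: "w \<in> S" "\<gamma> w \<noteq> 0"
  shows "((\<lambda>z. ln ((norm (\<gamma> z))\<^sup>2)) has_derivative (\<lambda>h. 2 * Re (h * log_partial \<gamma> w))) (at w)"
proof -
  define D where "D = vderiv \<gamma> w"
  have D: "(\<gamma> has_derivative (\<lambda>h. h *\<^sub>C D)) (at w)"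
    unfolding D_def by (rule has_derivative_vderiv[OF hol S w(1)])
  have pos: "0 < inner (\<gamma> w) (\<gamma> w)" using w by simp
  have "((\<lambda>z. ln (inner (\<gamma> z) (\<gamma> z))) has_derivative
      (\<lambda>h. (inner (\<gamma> w) (h *\<^sub>C D) + inner (h *\<^sub>C D) (\<gamma> w)) * inverse (inner (\<gamma> w) (\<gamma> w)))) (at w)"
    by (rule has_derivative_ln[OF pos has_derivative_inner[OF D D]])
  moreover have "(inner (\<gamma> w) (h *\<^sub>C D) + inner (h *\<^sub>C D) (\<gamma> w)) * inverse (inner (\<gamma> w) (\<gamma> w)) =
      2 * Re (h * log_partial \<gamma> w)" for h
  proof -
    have "h * log_partial \<gamma> w = cinner (h *\<^sub>C D) (\<gamma> w) / complex_of_real ((norm (\<gamma> w))\<^sup>2)"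
      by (simp add: log_partial_def D_def cinner_scaleC_left cinner_self)
    then show ?thesis
      by (simp add: Re_divide_of_real inner_commute[of "\<gamma> w"] flip: power2_norm_eq_inner of_real_power)
        (simp add: inner_eq_Re_cinner divide_inverse)
  qed
  ultimately show ?thesis by (simp add: power2_norm_eq_inner)
qed

lemma wirtinger_bar_ln_norm:
  assumes hol: "vector_holomorphic_on \<gamma> S" and S: "open S" and w: "w \<in> S" "\<gamma> w \<noteq> 0"
  shows "wirtinger_bar (\<lambda>z. complex_of_real (ln ((norm (\<gamma> z))\<^sup>2))) w = cnj (log_partial \<gamma> w)"
proof -
  have D: "((\<lambda>z. complex_of_real (ln ((norm (\<gamma> z))\<^sup>2))) has_derivative
      (\<lambda>h. complex_of_real (2 * Re (h * log_partial \<gamma> w)))) (at w)"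
    using bounded_linear.has_derivative[OF bounded_linear_of_real has_derivative_ln_norm[OF assms]] .
  show ?thesis
    unfolding wirtinger_bar_def frechet_derivative_at[OF D, symmetric]
    by (simp add: complex_eq_iff)
qed

lemma section_curvature_eq:
  assumes hol: "vector_holomorphic_on \<gamma> S" and S: "open S"
    and nz: "\<And>z. z \<in> S \<Longrightarrow> \<gamma> z \<noteq> 0" and w: "w \<in> S"
  shows "section_curvature \<gamma> w = - wirtinger (\<lambda>z. cnj (log_partial \<gamma> z)) w"
  unfolding section_curvature_def neg_equal_iff_equal
  by (rule wirtinger_cong(1)[OF S w]) (rule wirtinger_bar_ln_norm[OF hol S _ nz])

lemma section_curvature_cong_norm:
  fixes \<gamma> :: "complex \<Rightarrow> 'a::complex_inner" and \<delta> :: "complex \<Rightarrow> 'b::complex_inner"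
  assumes S: "open S" and w: "w \<in> S" and eq: "\<And>z. z \<in> S \<Longrightarrow> norm (\<gamma> z) = norm (\<delta> z)"
  shows "section_curvature \<gamma> w = section_curvature \<delta> w"
  unfolding section_curvature_def neg_equal_iff_equal
  by (rule wirtinger_cong(1)[OF S w], rule wirtinger_cong(2)[OF S]) (simp_all add: eq)

lemma differentiable_log_partial:
  fixes \<gamma> :: "complex \<Rightarrow> 'a::separable_hilbert"
  assumes hol: "vector_holomorphic_on \<gamma> S" and S: "open S" and w: "w \<in> S" "\<gamma> w \<noteq> 0"
  shows "log_partial \<gamma> differentiable at w"
proof -
  note D = has_derivative_vderiv[OF hol S w(1)]
  note D' = has_derivative_vderiv[OF vector_holomorphic_on_vderiv[OF hol S] S w(1)]
  have "(\<lambda>z. cinner (vderiv \<gamma> z) (\<gamma> z) / cinner (\<gamma> z) (\<gamma> z)) differentiable at w"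
    using has_derivative_cinner[OF D' D] has_derivative_cinner[OF D D] w
    by (intro differentiable_divide) (auto simp: differentiable_def cinner_self)
  then show ?thesis unfolding log_partial_def[abs_def] .
qed

lemma differentiable_cnj: "f differentiable at w \<Longrightarrow> (\<lambda>z. cnj (f z)) differentiable at w"
  unfolding differentiable_def using bounded_linear.has_derivative[OF bounded_linear_cnj] by blast

text \<open>Scaling adds the logarithmic derivative of \<open>g\<close> to
  \<open>log_partial\<close>. That derivative is holomorphic, so \<open>wirtinger\<close>
  annihilates its conjugate; no logarithm of \<open>g\<close> has to be chosen.\<close>

lemma section_curvature_scaleC:
  fixes \<gamma> :: "complex \<Rightarrow> 'a::separable_hilbert"
  assumes hol: "vector_holomorphic_on \<gamma> S" and S: "open S"
    and nz: "\<And>z. z \<in> S \<Longrightarrow> \<gamma> z \<noteq> 0" and w: "w \<in> S"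
    and g: "g holomorphic_on S" "\<And>z. z \<in> S \<Longrightarrow> g z \<noteq> 0"
  shows "section_curvature (\<lambda>z. g z *\<^sub>C \<gamma> z) w = section_curvature \<gamma> w"
proof -
  define q where "q z = deriv g z / g z" for z
  have holq: "q holomorphic_on S"
    unfolding q_def by (intro holomorphic_on_divide holomorphic_deriv g S) (use g in auto)
  have q': "(q has_field_derivative deriv q w) (at w)"
    using holq S w by (rule holomorphic_derivI)
  have lp: "log_partial (\<lambda>z. g z *\<^sub>C \<gamma> z) z = q z + log_partial \<gamma> z" if z: "z \<in> S" for z
  proof -
    have "vderiv (\<lambda>z. g z *\<^sub>C \<gamma> z) z = g z *\<^sub>C vderiv \<gamma> z + deriv g z *\<^sub>C \<gamma> z"
      by (intro vderiv_unique has_derivative_scaleC_holomorphic has_derivative_vderiv[OF hol S z]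
          holomorphic_derivI[OF g(1) S z])
    moreover have "cinner (\<gamma> z) (\<gamma> z) \<noteq> 0" using nz[OF z] by (simp add: cinner_self)
    ultimately show ?thesis
      using g(2)[OF z]
      by (simp add: log_partial_def q_def cinner_add_left cinner_scaleC_left cinner_scaleC_right
          field_simps)
  qed
  have "section_curvature (\<lambda>z. g z *\<^sub>C \<gamma> z) w = - wirtinger (\<lambda>z. cnj (log_partial (\<lambda>z. g z *\<^sub>C \<gamma> z) z)) w"
    by (rule section_curvature_eq[OF vector_holomorphic_on_scaleC[OF g(1) hol S] S _ w])
      (use g nz in simp)
  also have "\<dots> = - wirtinger (\<lambda>z. cnj (q z) + cnj (log_partial \<gamma> z)) w"
    by (simp add: lp wirtinger_cong(1)[OF S w, of "\<lambda>z. cnj (log_partial (\<lambda>z. g z *\<^sub>C \<gamma> z) z)"])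
  also have "\<dots> = - wirtinger (\<lambda>z. cnj (log_partial \<gamma> z)) w"
    using wirtinger_add[OF wirtinger_cnj_holomorphic(2)[OF q']
        differentiable_cnj[OF differentiable_log_partial[OF hol S w nz[OF w]]]]
      wirtinger_cnj_holomorphic(1)[OF q'] by simp
  also have "\<dots> = section_curvature \<gamma> w"
    using section_curvature_eq[OF hol S nz w] by simp
  finally show ?thesis .
qed

lemma section_curvature_eq_if_norm_eq:
  fixes \<gamma> :: "complex \<Rightarrow> 'a::complex_inner" and \<delta> :: "complex \<Rightarrow> 'b::separable_hilbert"
  assumes hol: "vector_holomorphic_on \<delta> S" and S: "open S"
    and nz: "\<And>z. z \<in> S \<Longrightarrow> \<delta> z \<noteq> 0" and w: "w \<in> S"
    and g: "g holomorphic_on S" "\<And>z. z \<in> S \<Longrightarrow> g z \<noteq> 0"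
    and eq: "\<And>z. z \<in> S \<Longrightarrow> norm (\<gamma> z) = cmod (g z) * norm (\<delta> z)"
  shows "section_curvature \<gamma> w = section_curvature \<delta> w"
proof -
  have "section_curvature \<gamma> w = section_curvature (\<lambda>z. g z *\<^sub>C \<delta> z) w"
    by (rule section_curvature_cong_norm[OF S w]) (simp add: eq)
  then show ?thesis
    using section_curvature_scaleC[OF hol S nz w g] by (rule trans)
qed

text \<open>Equality of the curvatures says that \<open>\<partial> (ln (norm \<gamma>)\<^sup>2 - ln (norm \<delta>)\<^sup>2)\<close> is
  holomorphic; \<open>g\<close> is the exponential of a primitive of it.\<close>

lemma norm_eq_if_section_curvature_eq:
  fixes \<gamma> :: "complex \<Rightarrow> 'a::separable_hilbert" and \<delta> :: "complex \<Rightarrow> 'b::separable_hilbert"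
  assumes hol: "vector_holomorphic_on \<gamma> (ball c r)" "vector_holomorphic_on \<delta> (ball c r)"
    and nz: "\<And>z. z \<in> ball c r \<Longrightarrow> \<gamma> z \<noteq> 0" "\<And>z. z \<in> ball c r \<Longrightarrow> \<delta> z \<noteq> 0"
    and eq: "\<And>z. z \<in> ball c r \<Longrightarrow> section_curvature \<gamma> z = section_curvature \<delta> z"
  shows "\<exists>g. g holomorphic_on ball c r \<and>
    (\<forall>z\<in>ball c r. g z \<noteq> 0 \<and> norm (\<gamma> z) = cmod (g z) * norm (\<delta> z))"
proof -
  define p where "p z = log_partial \<gamma> z - log_partial \<delta> z" for z
  have holp: "p holomorphic_on ball c r"
    unfolding holomorphic_on_open[OF open_ball]
  proof
    fix w assume w: "w \<in> ball c r"
    have d\<gamma>: "log_partial \<gamma> differentiable at w"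
      by (rule differentiable_log_partial[OF hol(1) open_ball w nz(1)[OF w]])
    have d\<delta>: "log_partial \<delta> differentiable at w"
      by (rule differentiable_log_partial[OF hol(2) open_ball w nz(2)[OF w]])
    have "p differentiable at w"
      unfolding p_def by (rule differentiable_diff[OF d\<gamma> d\<delta>])
    then obtain L where L: "(p has_derivative L) (at w)"
      unfolding differentiable_def by blast
    have "section_curvature \<gamma> w = - wirtinger (\<lambda>z. cnj (log_partial \<gamma> z)) w"
      by (rule section_curvature_eq[OF hol(1) open_ball nz(1) w])
    moreover have "section_curvature \<delta> w = - wirtinger (\<lambda>z. cnj (log_partial \<delta> z)) w"
      by (rule section_curvature_eq[OF hol(2) open_ball nz(2) w])
    ultimately have "wirtinger (\<lambda>z. cnj (log_partial \<gamma> z)) w = wirtinger (\<lambda>z. cnj (log_partial \<delta> z)) w"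
      using eq[OF w] by (metis neg_equal_iff_equal)
    moreover have "wirtinger (\<lambda>z. cnj (log_partial \<gamma> z)) w =
        wirtinger (\<lambda>z. cnj (log_partial \<delta> z) + cnj (p z)) w"
      by (simp add: p_def)
    moreover have "wirtinger (\<lambda>z. cnj (log_partial \<delta> z) + cnj (p z)) w =
        wirtinger (\<lambda>z. cnj (log_partial \<delta> z)) w + wirtinger (\<lambda>z. cnj (p z)) w"
      by (intro wirtinger_add differentiable_cnj d\<delta> \<open>p differentiable at w\<close>)
    ultimately have 0: "wirtinger (\<lambda>z. cnj (p z)) w = 0" by simp
    have "((\<lambda>z. cnj (p z)) has_derivative (\<lambda>h. cnj (L h))) (at w)"
      using bounded_linear.has_derivative[OF bounded_linear_cnj L] .
    \<comment> \<open>Vanishing of \<open>wirtinger\<close> on the conjugate of \<open>p\<close> is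
      the Cauchy-Riemann equation for \<open>p\<close>, in the form
      \<open>L \<i> = \<i> * L 1\<close>.\<close>
    from frechet_derivative_at[OF this, symmetric] 0 have "cnj (L 1) = \<i> * cnj (L \<i>)"
      unfolding wirtinger_def by simp
    then have "L 1 = - \<i> * L \<i>"
      by (simp add: complex_eq_iff)
    then have Li: "L \<i> = \<i> * L 1" by simp
    have linL: "linear L" using L has_derivative_linear by blast
    have "L h = L 1 * h" for h
    proof -
      have "L h = L (Re h *\<^sub>R 1 + Im h *\<^sub>R \<i>)"
        by (rule arg_cong[of _ _ L]) (simp add: complex_eq_iff)
      also have "\<dots> = Re h *\<^sub>R L 1 + Im h *\<^sub>R L \<i>"
        by (simp only: linear_add[OF linL] linear_scale[OF linL])
      also have "\<dots> = L 1 * (Re h *\<^sub>R 1 + Im h *\<^sub>R \<i>)"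
        by (simp add: Li algebra_simps)
      also have "Re h *\<^sub>R 1 + Im h *\<^sub>R \<i> = h" by (simp add: complex_eq_iff)
      finally show ?thesis .
    qed
    then have "L = (*) (L 1)" by (rule ext)
    then show "\<exists>f'. (p has_field_derivative f') (at w)"
      using L unfolding has_field_derivative_def by metis
  qed
  obtain P where P: "\<And>z. z \<in> ball c r \<Longrightarrow> (P has_field_derivative p z) (at z within ball c r)"
    using holomorphic_convex_primitive'[OF convex_ball open_ball holp] by blast
  \<comment> \<open>The difference of the two logarithms has derivative
    \<open>2 * Re (h * p z)\<close>, and \<open>P\<close> is a primitive of \<open>p\<close>; hence
    the factor 2, and \<open>u\<close> is constant on the disc.\<close>
  define u where "u z = ln ((norm (\<gamma> z))\<^sup>2) - ln ((norm (\<delta> z))\<^sup>2) - 2 * Re (P z)" for z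
  have "(u has_derivative (\<lambda>h. 0)) (at z within ball c r)" if z: "z \<in> ball c r" for z
  proof -
    have "(P has_derivative (\<lambda>h. p z * h)) (at z)"
      using P[OF z] z unfolding has_field_derivative_def by (simp add: at_within_open[OF _ open_ball])
    then have "((\<lambda>z. 2 * Re (P z)) has_derivative (\<lambda>h. 2 * Re (p z * h))) (at z)"
      by (intro has_derivative_mult_right bounded_linear.has_derivative[OF bounded_linear_Re])
    then have "(u has_derivative (\<lambda>h. 2 * Re (h * log_partial \<gamma> z) - 2 * Re (h * log_partial \<delta> z)
        - 2 * Re (p z * h))) (at z)"
      unfolding u_def
      by (intro has_derivative_diff has_derivative_ln_norm[OF hol(1) open_ball z nz(1)[OF z]]
        has_derivative_ln_norm[OF hol(2) open_ball z nz(2)[OF z]])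
    moreover have "2 * Re (h * log_partial \<gamma> z) - 2 * Re (h * log_partial \<delta> z) - 2 * Re (p z * h) = 0" for h
      by (simp add: p_def algebra_simps)
    ultimately show ?thesis by (simp add: has_derivative_at_withinI)
  qed
  then obtain k where k: "\<And>z. z \<in> ball c r \<Longrightarrow> u z = k"
    using has_derivative_zero_constant[OF convex_ball, of c r u] by blast
  \<comment> \<open>\<open>k\<close> belongs to the squared norms, so half of it goes into
    \<open>g\<close>.\<close>
  define g where "g z = exp (P z + of_real (k / 2))" for z
  have "P holomorphic_on ball c r"
    using P unfolding holomorphic_on_def field_differentiable_def by blast
  then have "g holomorphic_on ball c r"
    unfolding g_def by (intro holomorphic_intros)
  moreover have "norm (\<gamma> z) = cmod (g z) * norm (\<delta> z)" if z: "z \<in> ball c r" for z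
  proof -
    have pos: "(norm (\<gamma> z))\<^sup>2 > 0" "(norm (\<delta> z))\<^sup>2 > 0"
      using nz[OF z] by auto
    have "ln ((norm (\<gamma> z))\<^sup>2) = 2 * (Re (P z) + k / 2) + ln ((norm (\<delta> z))\<^sup>2)"
      using k[OF z] by (simp add: u_def)
    then have "exp (ln ((norm (\<gamma> z))\<^sup>2)) = exp (2 * (Re (P z) + k / 2)) * exp (ln ((norm (\<delta> z))\<^sup>2))"
      by (simp only: exp_add)
    then have "(norm (\<gamma> z))\<^sup>2 = exp (2 * (Re (P z) + k / 2)) * (norm (\<delta> z))\<^sup>2"
      using pos by simp
    also have "\<dots> = (cmod (g z) * norm (\<delta> z))\<^sup>2"
      unfolding exp_double power_mult_distrib by (simp add: g_def)
    finally show ?thesis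
      by (simp add: power2_eq_iff_nonneg)
  qed
  moreover have "g z \<noteq> 0" for z by (simp add: g_def)
  ultimately show ?thesis by (intro exI[of _ g]) simp
qed

section \<open>Holomorphic functions with prescribed zeros\<close>

text \<open>Splitting off the first \<open>N\<close> factors leaves a uniformly convergent tail
  \<open>R\<close> without zeros, so all zeros of the product are those of finitely many factors.
  The bound is that of Weierstrass factors at arguments of modulus at most 1/2.\<close>

lemma holomorphic_infinite_product:
  fixes v :: "nat \<Rightarrow> complex \<Rightarrow> complex"
  assumes hol: "\<And>n. v n holomorphic_on cball z r"
    and bound: "\<And>n w. n \<ge> N \<Longrightarrow> w \<in> cball z r \<Longrightarrow> cmod (v n w - 1) \<le> 3 * (1/2) ^ Suc n"
    and N: "N \<ge> 2"
  obtains R where "R holomorphic_on ball z r"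
    "\<And>w. w \<in> ball z r \<Longrightarrow> R w \<noteq> 0 \<and> prodinf (\<lambda>n. v n w) = (\<Prod>n<N. v n w) * R w"
    "\<And>n w. n \<ge> N \<Longrightarrow> w \<in> ball z r \<Longrightarrow> v n w \<noteq> 0"
proof -
  define c where "c n = 3 * (1/2::real) ^ Suc (n + N)" for n
  have sc: "summable c" 
    unfolding c_def
    by (intro summable_mult summable_ignore_initial_segment) (simp add: summable_Suc_iff summable_geometric)
  have bd: "cmod (v (n + N) w - 1) \<le> c n" if "w \<in> cball z r" for n w
    unfolding c_def using bound[of "n + N" w] that by simp
  \<comment> \<open>From index 2 on the bound is at most 3/8, so no factor can be 0.\<close>
  have v_nz: "v n w \<noteq> 0" if "n \<ge> N" "w \<in> cball z r" for n w
  proof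
    assume "v n w = 0"
    then have "1 \<le> 3 * (1/2::real) ^ Suc n" using bound[OF that] by simp
    also have "\<dots> \<le> 3 * (1/2) ^ Suc 2"
      using that(1) N by (intro mult_left_mono power_decreasing) auto
    finally show False by (simp add: power3_eq_cube)
  qed
  define R where "R w = prodinf (\<lambda>n. v (n + N) w)" for w
  have "uniformly_convergent_on (cball z r) (\<lambda>M w. \<Prod>n<M. v (n + N) w)"
  proof (rule uniformly_convergent_on_prod')
    show "uniformly_convergent_on (cball z r) (\<lambda>M w. \<Sum>n<M. norm (v (n + N) w - 1))"
      by (rule Weierstrass_m_test') (use bd sc in auto)
  qed (use hol in \<open>auto intro: holomorphic_on_imp_continuous_on\<close>)
  then obtain R' where R': "uniform_limit (cball z r) (\<lambda>M w. \<Prod>n<M. v (n + N) w) R' sequentially"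
    by (auto simp: uniformly_convergent_on_def)
  have conv: "convergent_prod (\<lambda>n. v (n + N) w)" if "w \<in> cball z r" for w
    by (intro abs_convergent_prod_imp_convergent_prod, unfold abs_convergent_prod_conv_summable)
      (rule summable_comparison_test'[OF sc], use bd[OF that] in simp)
  have R'R: "R' w = R w" if w: "w \<in> cball z r" for w
  proof (rule LIMSEQ_unique)
    show "(\<lambda>M. \<Prod>n<M. v (n + N) w) \<longlonglongrightarrow> R' w"
      using tendsto_uniform_limitI[OF R' w] .
    show "(\<lambda>M. \<Prod>n<M. v (n + N) w) \<longlonglongrightarrow> R w"
      unfolding R_def using has_prod_imp_tendsto'[OF convergent_prod_has_prod[OF conv[OF w]]] .
  qed
  have "R' holomorphic_on ball z r"
  proof (rule holomorphic_uniform_limit[OF _ R'])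
    have "(\<lambda>w. \<Prod>n<M. v (n + N) w) holomorphic_on cball z r" for M
      by (intro holomorphic_on_prod hol)
    then show "\<forall>\<^sub>F M in sequentially. continuous_on (cball z r) (\<lambda>w. \<Prod>n<M. v (n + N) w) \<and>
        (\<lambda>w. \<Prod>n<M. v (n + N) w) holomorphic_on ball z r"
      by (intro always_eventually allI conjI holomorphic_on_imp_continuous_on)
        (auto intro: holomorphic_on_subset[OF _ ball_subset_cball])
  qed auto
  then have "R holomorphic_on ball z r"
    by (rule holomorphic_transform) (simp add: R'R)
  moreover have "R w \<noteq> 0 \<and> prodinf (\<lambda>n. v n w) = (\<Prod>n<N. v n w) * R w" if "w \<in> ball z r" for w
  proof
    have w: "w \<in> cball z r" using that by simp
    show "R w \<noteq> 0"
      unfolding R_def using conv[OF w] v_nz[OF _ w] by (intro prodinf_nonzero) auto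
    have "convergent_prod (\<lambda>n. v n w)"
      by (rule convergent_prod_offset[OF conv[OF w]])
    then show "prodinf (\<lambda>n. v n w) = (\<Prod>n<N. v n w) * R w"
      unfolding R_def by (intro has_prod_unique[symmetric] has_prod_ignore_initial_segment')
  qed
  moreover have "v n w \<noteq> 0" if "n \<ge> N" "w \<in> ball z r" for n w
    using v_nz[OF that(1), of w] that(2) by simp
  ultimately show ?thesis by (rule that)
qed

text \<open>In the coordinate \<open>1 / (z - \<alpha>)\<close> the domain is a neighbourhood of infinity and its
  complement \<open>K\<close> (containing the image \<open>0\<close> of infinity) is bounded; each zero is paired
  with an almost nearest point \<open>\<beta> n\<close> of \<open>K\<close> and \<open>u n\<close> is the ratio
  \<open>(\<delta> - \<beta>) / (1 / (z - \<alpha>) - \<beta>)\<close> of the classical proof.\<close>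

theorem Weierstrass_prescribed_zeros:
  fixes m :: "complex \<Rightarrow> nat"
  assumes \<Omega>: "open \<Omega>" and \<alpha>: "\<alpha> \<in> \<Omega>" "m \<alpha> = 0"
    and sparse: "\<And>z. z \<in> \<Omega> \<Longrightarrow> \<forall>\<^sub>F w in at z. m w = 0"
  shows "\<exists>f. \<forall>z\<in>\<Omega>. \<exists>r>0. \<exists>g. ball z r \<subseteq> \<Omega> \<and> g holomorphic_on ball z r \<and>
    (\<forall>w\<in>ball z r. g w \<noteq> 0 \<and> f w = (w - z) ^ m z * g w)"
proof -
  define Z where "Z = {z \<in> \<Omega>. m z \<noteq> 0}"
  \<comment> \<open>Each point of \<open>Z\<close> is listed as often as its multiplicity, so one
    factor per element of \<open>I\<close> produces the right orders.\<close>
  define I where "I = Sigma Z (\<lambda>z. {..<m z})"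
  define K where "K = insert 0 ((\<lambda>b. 1 / (b - \<alpha>)) ` (- \<Omega>))"
  have Z_not_lim: "\<not> z islimpt Z" if "z \<in> \<Omega>" for z
    using sparse[OF that] unfolding islimpt_conv_frequently_at frequently_def
    by (auto simp: Z_def elim: eventually_mono)
  have "Z sparse_in \<Omega>"
    unfolding sparse_in_def using Z_not_lim \<Omega> by blast
  then have "countable (\<Omega> \<inter> Z)" by (rule sparse_imp_countable[OF \<Omega>])
  moreover have "\<Omega> \<inter> Z = Z" by (auto simp: Z_def)
  ultimately have cI: "countable I" unfolding I_def by (intro countable_SIGMA) auto
  \<comment> \<open>\<open>I\<close> may be finite; \<open>J\<close> consists of the indices that
    its enumeration really uses.\<close>
  define J where "J = to_nat_on I ` I"
  define a where "a n = fst (from_nat_into I n)" for n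
  have a_Z: "a n \<in> Z" if "n \<in> J" for n
    using that cI by (auto simp: J_def a_def I_def)
  define \<delta> where "\<delta> n = 1 / (a n - \<alpha>)" for n
  have "\<exists>\<beta>\<in>K. dist (\<delta> n) \<beta> < infdist (\<delta> n) K + 1 / Suc n" for n
  proof -
    have "infdist (\<delta> n) K < infdist (\<delta> n) K + 1 / Suc n" by simp
    then show ?thesis
      unfolding infdist_def using cInf_lessD[of "dist (\<delta> n) ` K"] by (auto simp: K_def split: if_splits)
  qed
  then obtain \<beta> where \<beta>: "\<And>n. \<beta> n \<in> K" "\<And>n. dist (\<delta> n) (\<beta> n) < infdist (\<delta> n) K + 1 / Suc n"
    by metis
  define u where "u n z = (if n \<in> J then (z - \<alpha>) * (\<delta> n - \<beta> n) / (1 - (z - \<alpha>) * \<beta> n) else 0)" for n z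
  define v where "v n z = weierstrass_factor n (u n z)" for n z
  have den: "1 - (z - \<alpha>) * b \<noteq> 0" if zb: "z \<in> \<Omega>" "b \<in> K" for z b
  proof (cases "b = 0")
    case False
    then obtain y where y: "y \<notin> \<Omega>" "b = 1 / (y - \<alpha>)" using zb(2) by (auto simp: K_def)
    then have "y - \<alpha> \<noteq> 0" "y - z \<noteq> 0" using \<alpha>(1) zb(1) by auto
    moreover from this have "1 - (z - \<alpha>) * b = (y - z) / (y - \<alpha>)"
      by (simp add: y(2) field_simps)
    ultimately show ?thesis by simp
  qed simp
  have hol_u: "u n holomorphic_on \<Omega>" for n
    unfolding u_def using den \<beta>(1) by (cases "n \<in> J") (auto intro!: holomorphic_intros)
  have hol_v: "v n holomorphic_on \<Omega>" for n
    unfolding v_def by (intro weierstrass_factor_holomorphic hol_u)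
  \<comment> \<open>So \<open>u n\<close> takes the value 1 exactly at \<open>a n\<close>, to first
    order: \<open>v n\<close> has a simple zero there and no other zero in
    \<open>\<Omega>\<close>.\<close>
  have one_minus_u: "1 - u n z = - (z - a n) / ((a n - \<alpha>) * (1 - (z - \<alpha>) * \<beta> n))"
    if "n \<in> J" "z \<in> \<Omega>" for n z
  proof -
    have "a n \<noteq> \<alpha>" using a_Z[OF that(1)] \<alpha> by (auto simp: Z_def)
    then show ?thesis
      using that(1) den[OF that(2) \<beta>(1)[of n]]
      by (simp add: u_def \<delta>_def divide_simps) (simp add: algebra_simps)
  qed
  \<comment> \<open>Points whose images keep distance \<open>e\<close> from \<open>K\<close> are
    bounded because \<open>0 \<in> K\<close>. Infinitely many of them would accumulate either inside
    \<open>\<Omega>\<close>, against sparseness, or at a point outside it, whose image lies in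
    \<open>K\<close>.\<close>
  have finite_far: "finite {z \<in> Z. e \<le> infdist (1 / (z - \<alpha>)) K}" (is "finite ?X") if e: "e > 0" for e
  proof (rule ccontr)
    assume inf: "infinite ?X"
    have "?X \<subseteq> cball \<alpha> (1 / e)"
    proof
      fix z assume z: "z \<in> ?X"
      then have "z \<noteq> \<alpha>" using \<alpha> by (auto simp: Z_def)
      have "e \<le> dist (1 / (z - \<alpha>)) 0"
        using z infdist_le[of 0 K "1 / (z - \<alpha>)"] by (simp add: K_def)
      then show "z \<in> cball \<alpha> (1 / e)"
        using e \<open>z \<noteq> \<alpha>\<close> by (simp add: dist_norm norm_divide norm_minus_commute field_simps)
    qed
    then obtain p where p: "p islimpt ?X"
      using inf Heine_Borel_imp_Bolzano_Weierstrass[OF compact_cball] by blast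
    show False
    proof (cases "p \<in> \<Omega>")
      case True
      then show False using p Z_not_lim islimpt_subset[of p ?X Z] by blast
    next
      case False
      then have pa: "p - \<alpha> \<noteq> 0" using \<alpha> by auto
      have pK: "1 / (p - \<alpha>) \<in> K" using False by (auto simp: K_def)
      have "((\<lambda>z. 1 / (z - \<alpha>)) \<longlongrightarrow> 1 / (p - \<alpha>)) (at p)"
        using pa by (intro tendsto_intros) auto
      then have "\<forall>\<^sub>F z in at p. dist (1 / (z - \<alpha>)) (1 / (p - \<alpha>)) < e"
        using e by (rule tendstoD)
      then have "\<forall>\<^sub>F z in at p. z \<notin> ?X"
      proof eventually_elim
        case (elim z)
        then show ?case using infdist_le[OF pK, of "1 / (z - \<alpha>)"] by auto
      qed
      then show False using p unfolding islimpt_conv_frequently_at frequently_def by simp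
    qed
  qed
  \<comment> \<open>Half of \<open>e\<close> bounds the distance to \<open>K\<close>, with finitely
    many exceptional indices since multiplicities are finite; the other half absorbs the slack
    \<open>1 / Suc n\<close> in the choice of \<open>\<beta> n\<close>.\<close>
  have \<delta>\<beta>: "\<exists>N. \<forall>n\<ge>N. n \<in> J \<longrightarrow> dist (\<delta> n) (\<beta> n) < e" if e: "e > 0" for e
  proof -
    define X where "X = {z \<in> Z. e / 2 \<le> infdist (1 / (z - \<alpha>)) K}"
    have "finite X" unfolding X_def using e by (intro finite_far) auto
    then have "finite (to_nat_on I ` Sigma X (\<lambda>z. {..<m z}))" by auto
    then obtain N1 where N1: "\<And>n. n \<in> to_nat_on I ` Sigma X (\<lambda>z. {..<m z}) \<Longrightarrow> n < N1"
      using finite_nat_set_iff_bounded by meson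
    obtain N2 where N2: "1 / real (Suc N2) < e / 2"
      using e nat_approx_posE[of "e/2"] by auto
    have "dist (\<delta> n) (\<beta> n) < e" if n: "n \<ge> max N1 N2" "n \<in> J" for n
    proof -
      obtain q where q: "q \<in> I" "n = to_nat_on I q" using n(2) by (auto simp: J_def)
      have aq: "a n = fst q" using q cI by (simp add: a_def)
      have "fst q \<notin> X"
        using N1[of n] n(1) q by (force simp: I_def)
      then have "infdist (\<delta> n) K < e / 2"
        using a_Z[OF n(2)] unfolding X_def \<delta>_def aq by auto
      moreover have "1 / real (Suc n) \<le> 1 / real (Suc N2)"
        using n(1) by (intro divide_left_mono) auto
      ultimately show ?thesis using \<beta>(2)[of n] N2 by linarith
    qed
    then show ?thesis by blast
  qed
  have u_small: "\<exists>r>0. cball z0 r \<subseteq> \<Omega> \<and> (\<exists>N. \<forall>n\<ge>N. \<forall>w\<in>cball z0 r. cmod (u n w) \<le> 1 / 2)"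
    if z0: "z0 \<in> \<Omega>" for z0
  proof -
    obtain s where s: "s > 0" "cball z0 s \<subseteq> \<Omega>" using \<Omega> z0 open_contains_cball by blast
    define r where "r = s / 2"
    define M where "M = cmod (z0 - \<alpha>) + r"
    \<comment> \<open>For \<open>b = 1 / (y - \<alpha>)\<close> the denominator is
      \<open>(y - w) / (y - \<alpha>)\<close>, where \<open>cmod (y - w) \<ge> r\<close> and
      \<open>cmod (y - \<alpha>) \<le> cmod (y - w) + M\<close>. As \<open>x / (x + M)\<close>
      increases with \<open>x\<close>, \<open>c\<close> bounds its modulus from below.\<close>
    define c where "c = r / (r + M)"
    have r: "r > 0" using s by (simp add: r_def)
    have M: "M > 0" using r by (simp add: M_def add_nonneg_pos)
    have c: "c > 0" "c \<le> 1" using r M by (auto simp: c_def)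
    have wM: "cmod (w - \<alpha>) \<le> M" if "w \<in> cball z0 r" for w
      using that norm_triangle_ineq[of "w - z0" "z0 - \<alpha>"] by (simp add: M_def dist_norm norm_minus_commute)
    have lower: "c \<le> cmod (1 - (w - \<alpha>) * b)" if w: "w \<in> cball z0 r" and b: "b \<in> K" for w b
    proof (cases "b = 0")
      case False
      then obtain y where y: "y \<notin> \<Omega>" "b = 1 / (y - \<alpha>)" using b by (auto simp: K_def)
      have ya: "y \<noteq> \<alpha>" using y \<alpha> by auto
      have "dist z0 y > s" using y s by (metis mem_cball not_le subsetD)
      then have yw: "cmod (y - w) \<ge> r"
        using w dist_triangle[of z0 y w] by (simp add: r_def dist_norm norm_minus_commute)
      have "cmod (y - \<alpha>) \<le> cmod (y - w) + M"
        using norm_triangle_ineq[of "y - w" "w - \<alpha>"] wM[OF w] by simp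
      have "r * (cmod (y - w) + M) \<le> cmod (y - w) * (r + M)"
        using mult_right_mono[OF yw, of M] M by (simp add: algebra_simps)
      then have "c \<le> cmod (y - w) / (cmod (y - w) + M)"
        using r M by (simp add: c_def field_simps add_nonneg_pos)
      also have "\<dots> \<le> cmod (y - w) / cmod (y - \<alpha>)"
        using ya M \<open>cmod (y - \<alpha>) \<le> cmod (y - w) + M\<close> by (intro divide_left_mono) (auto intro!: mult_pos_pos add_nonneg_pos)
      also have "\<dots> = cmod ((y - w) / (y - \<alpha>))" by (simp add: norm_divide)
      also have "(y - w) / (y - \<alpha>) = 1 - (w - \<alpha>) * b"
        using ya by (simp add: y field_simps)
      finally show ?thesis .
    qed (use c in simp)
    obtain N where N: "\<And>n. n \<ge> N \<Longrightarrow> n \<in> J \<Longrightarrow> dist (\<delta> n) (\<beta> n) < c / (2 * M)"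
      using \<delta>\<beta>[of "c / (2 * M)"] c M by auto
    have "cmod (u n w) \<le> 1 / 2" if n: "n \<ge> N" and w: "w \<in> cball z0 r" for n w
    proof (cases "n \<in> J")
      case True
      have "cmod (u n w) = cmod (w - \<alpha>) * dist (\<delta> n) (\<beta> n) / cmod (1 - (w - \<alpha>) * \<beta> n)"
        using True by (simp add: u_def norm_mult norm_divide dist_norm)
      also have "\<dots> \<le> M * (c / (2 * M)) / c"
        using wM[OF w] N[OF n True] lower[OF w \<beta>(1)[of n]] c M
        by (intro frac_le mult_mono) auto
      also have "\<dots> = 1 / 2" using c M by simp
      finally show ?thesis .
    qed (simp add: u_def)
    moreover have "cball z0 r \<subseteq> \<Omega>" using s by (auto simp: r_def)
    ultimately show ?thesis using r by blast
  qed
  define f where "f z = prodinf (\<lambda>n. v n z)" for z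
  have "\<exists>r>0. \<exists>g. ball z0 r \<subseteq> \<Omega> \<and> g holomorphic_on ball z0 r \<and>
      (\<forall>w\<in>ball z0 r. g w \<noteq> 0 \<and> f w = (w - z0) ^ m z0 * g w)" if z0: "z0 \<in> \<Omega>" for z0
  proof -
    obtain r1 N1 where r1: "r1 > 0" "cball z0 r1 \<subseteq> \<Omega>"
      and N1: "\<And>n w. n \<ge> N1 \<Longrightarrow> w \<in> cball z0 r1 \<Longrightarrow> cmod (u n w) \<le> 1 / 2"
      using u_small[OF z0] by blast
    obtain r2 where r2: "r2 > 0" "\<And>w. w \<noteq> z0 \<Longrightarrow> dist w z0 < r2 \<Longrightarrow> m w = 0"
      using sparse[OF z0] unfolding eventually_at by blast
    \<comment> \<open>2 makes the tail zero-free, and from \<open>N1\<close> on \<open>u n\<close>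
      is at most 1/2 in modulus. The radius \<open>r2\<close> excludes prescribed zeros other than
      \<open>z0\<close>.\<close>
    define N where "N = max 2 N1"
    define r where "r = min r1 r2"
    have r: "r > 0" using r1 r2 by (simp add: r_def)
    have sub: "cball z0 r \<subseteq> cball z0 r1" "ball z0 r \<subseteq> ball z0 r2" by (auto simp: r_def)
    have sub\<Omega>: "ball z0 r \<subseteq> \<Omega>" using sub(1) r1(2) ball_subset_cball by blast
    have vb: "cmod (v n w - 1) \<le> 3 * (1/2) ^ Suc n" if "n \<ge> N" "w \<in> cball z0 r" for n w
    proof -
      have u: "cmod (u n w) \<le> 1 / 2" using N1[of n w] that sub(1) by (auto simp: N_def)
      have "cmod (v n w - 1) \<le> 3 * cmod (u n w) ^ Suc n"
        unfolding v_def by (rule weierstrass_factor_bound[OF u])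
      also have "\<dots> \<le> 3 * (1/2) ^ Suc n"
        using u by (intro mult_left_mono power_mono) auto
      finally show ?thesis .
    qed
    have "v n holomorphic_on cball z0 r" for n
      using hol_v sub(1) r1(2) by (meson holomorphic_on_subset order_trans)
    then obtain R where R: "R holomorphic_on ball z0 r"
      "\<And>w. w \<in> ball z0 r \<Longrightarrow> R w \<noteq> 0 \<and> f w = (\<Prod>n<N. v n w) * R w"
      "\<And>n w. n \<ge> N \<Longrightarrow> w \<in> ball z0 r \<Longrightarrow> v n w \<noteq> 0"
      using holomorphic_infinite_product[of v z0 r N, OF _ vb] unfolding f_def N_def by auto
    define E where "E = {n \<in> J. a n = z0}"
    have v_a: "v n (a n) = 0" if "n \<in> J" for n
      using one_minus_u[OF that, of "a n"] a_Z[OF that] by (simp add: v_def weierstrass_factor_def Z_def)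
    have E_N: "E \<subseteq> {..<N}"
    proof
      fix n assume n: "n \<in> E"
      then have "v n z0 = 0" using v_a by (auto simp: E_def)
      then show "n \<in> {..<N}" using R(3)[of n z0] r by (cases "n < N") auto
    qed
    have card_E: "card E = m z0"
    proof -
      have "E = to_nat_on I ` ({z0} \<times> {..<m z0})"
        using z0 cI by (auto simp: E_def J_def a_def I_def Z_def image_iff)
      moreover have "inj_on (to_nat_on I) ({z0} \<times> {..<m z0})"
        by (rule inj_on_subset[OF inj_on_to_nat_on[OF cI]]) (use z0 in \<open>auto simp: I_def Z_def\<close>)
      ultimately show ?thesis by (simp add: card_image)
    qed
    \<comment> \<open>An index in \<open>E\<close> contributes one factor \<open>w - z0\<close>, any
      other index none; with \<open>of_bool\<close> as exponent the finite product counts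
      \<open>card E\<close>, which is \<open>m z0\<close>.\<close>
    have ex_h: "\<exists>h. h holomorphic_on ball z0 r \<and>
        (\<forall>w\<in>ball z0 r. h w \<noteq> 0 \<and> v n w = (w - z0) ^ of_bool (n \<in> E) * h w)" for n
    proof (cases "n \<in> E")
      case True
      then have n: "n \<in> J" "a n = z0" by (auto simp: E_def)
      then have az: "z0 \<noteq> \<alpha>" using a_Z[OF n(1)] \<alpha> by (auto simp: Z_def)
      define h where "h w = - exp (\<Sum>k=1..n. u n w ^ k / of_nat k) / ((z0 - \<alpha>) * (1 - (w - \<alpha>) * \<beta> n))" for w
      have "h holomorphic_on ball z0 r"
        unfolding h_def using den[OF _ \<beta>(1)[of n]] sub\<Omega> az
        by (auto intro!: holomorphic_intros holomorphic_on_subset[OF hol_u])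
      moreover have "h w \<noteq> 0 \<and> v n w = (w - z0) ^ of_bool (n \<in> E) * h w" if w: "w \<in> ball z0 r" for w
      proof -
        have w\<Omega>: "w \<in> \<Omega>" using w sub\<Omega> by blast
        have "v n w = (w - z0) * h w"
          unfolding v_def weierstrass_factor_def one_minus_u[OF n(1) w\<Omega>] h_def n(2)
          by (simp del: minus_diff_eq)
        then show ?thesis
          using den[OF w\<Omega> \<beta>(1)[of n]] az True by (simp add: h_def)
      qed
      ultimately show ?thesis by blast
    next
      case False
      have "v n w \<noteq> 0" if w: "w \<in> ball z0 r" for w
      proof (cases "n \<in> J")
        case True
        then have "a n \<noteq> z0" using False by (simp add: E_def)
        have "w \<noteq> a n"
        proof
          assume "w = a n"
          then have "m w = 0" using r2(2)[of w] w \<open>a n \<noteq> z0\<close> sub(2) by (auto simp: dist_commute)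
          then show False using a_Z[OF True] \<open>w = a n\<close> by (simp add: Z_def)
        qed
        have w\<Omega>: "w \<in> \<Omega>" using w sub\<Omega> by blast
        have "a n \<noteq> \<alpha>" using a_Z[OF True] \<alpha> by (auto simp: Z_def)
        then show ?thesis
          using one_minus_u[OF True w\<Omega>] den[OF w\<Omega> \<beta>(1)[of n]] \<open>w \<noteq> a n\<close>
          by (simp add: v_def weierstrass_factor_def)
      qed (simp add: v_def u_def)
      then show ?thesis
        using False hol_v[of n] sub\<Omega> by (intro exI[of _ "v n"]) (auto intro: holomorphic_on_subset)
    qed
    then obtain h where h: "\<And>n. h n holomorphic_on ball z0 r"
      "\<And>n w. w \<in> ball z0 r \<Longrightarrow> h n w \<noteq> 0"
      "\<And>n w. w \<in> ball z0 r \<Longrightarrow> v n w = (w - z0) ^ of_bool (n \<in> E) * h n w"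
      by metis
    define g where "g w = (\<Prod>n<N. h n w) * R w" for w
    have "g holomorphic_on ball z0 r"
      unfolding g_def by (intro holomorphic_intros h R)
    moreover have "g w \<noteq> 0 \<and> f w = (w - z0) ^ m z0 * g w" if w: "w \<in> ball z0 r" for w
    proof -
      have "(\<Sum>n<N. of_bool (n \<in> E) :: nat) = card ({..<N} \<inter> E)"
        by (simp add: sum_of_bool_eq Int_def)
      also have "{..<N} \<inter> E = E" using E_N by blast
      finally have "(\<Prod>n<N. v n w) = (w - z0) ^ m z0 * (\<Prod>n<N. h n w)"
        using h(3)[OF w] by (simp add: prod.distrib card_E flip: power_sum)
      then show ?thesis using R(2)[OF w] h(2)[OF w] by (simp add: g_def)
    qed
    ultimately show ?thesis using r sub\<Omega> by blast
  qed
  then show ?thesis by blast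
qed

text \<open>\<open>f\<close> vanishes at each point to the order of \<open>\<gamma>\<close>, and
  \<open>F\<close> is \<open>\<gamma> / f\<close>. The local factorizations of both show that the
  quotient extends holomorphically and without zeros.\<close>

lemma vector_holomorphic_divisor:
  fixes \<gamma> :: "complex \<Rightarrow> 'a::separable_hilbert"
  assumes hol: "vector_holomorphic_on \<gamma> \<Omega>" and \<Omega>: "open \<Omega>" "connected \<Omega>"
    and ne: "\<exists>w\<in>\<Omega>. \<gamma> w \<noteq> 0"
  shows "\<exists>f F. vector_holomorphic_on F \<Omega> \<and> (\<forall>w\<in>\<Omega>. F w \<noteq> 0 \<and> \<gamma> w = f w *\<^sub>C F w)"
proof -
  define Q where "Q z m G \<longleftrightarrow> vector_holomorphic_on G \<Omega> \<and> G z \<noteq> 0 \<and>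
      (\<forall>w\<in>\<Omega>. \<gamma> w = (w - z) ^ m *\<^sub>C G w)" for z m G
  have "\<forall>z\<in>\<Omega>. \<exists>m G. Q z m G"
    unfolding Q_def using vector_holomorphic_factor[OF hol \<Omega> _ ne] by simp
  then obtain m G where Q: "\<And>z. z \<in> \<Omega> \<Longrightarrow> Q z (m z) (G z)" by metis
  have mG: "\<And>z. z \<in> \<Omega> \<Longrightarrow> vector_holomorphic_on (G z) \<Omega>"
    "\<And>z. z \<in> \<Omega> \<Longrightarrow> G z z \<noteq> 0" "\<And>z w. z \<in> \<Omega> \<Longrightarrow> w \<in> \<Omega> \<Longrightarrow> \<gamma> w = (w - z) ^ m z *\<^sub>C G z w"
    using Q unfolding Q_def by simp_all
  have m0: "m z = 0" if "z \<in> \<Omega>" "\<gamma> z \<noteq> 0" for z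
    using mG(3)[OF that(1,1)] that(2) by (cases "m z") auto
  obtain \<alpha> where \<alpha>: "\<alpha> \<in> \<Omega>" "\<gamma> \<alpha> \<noteq> 0" using ne by blast
  have ev: "\<forall>\<^sub>F w in at z. m w = 0" if z: "z \<in> \<Omega>" for z
    using vector_holomorphic_isolated_zeros[OF hol \<Omega> ne z] eventually_at_in_open[OF \<Omega>(1) z]
    by eventually_elim (auto intro: m0)
  obtain f where f: "\<forall>z\<in>\<Omega>. \<exists>r>0. \<exists>g. ball z r \<subseteq> \<Omega> \<and> g holomorphic_on ball z r \<and>
      (\<forall>w\<in>ball z r. g w \<noteq> 0 \<and> f w = (w - z) ^ m z * g w)"
    using Weierstrass_prescribed_zeros[where m = m and \<Omega> = \<Omega>, OF \<Omega>(1) \<alpha>(1) m0[OF \<alpha>] ev] ..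
  define P where "P z r g \<longleftrightarrow> r > 0 \<and> ball z r \<subseteq> \<Omega> \<and> g holomorphic_on ball z r \<and>
      (\<forall>w\<in>ball z r. g w \<noteq> 0 \<and> f w = (w - z) ^ m z * g w)" for z r g
  have "\<forall>z\<in>\<Omega>. \<exists>r g. P z r g" using f unfolding P_def by blast
  then obtain r g where P: "\<And>z. z \<in> \<Omega> \<Longrightarrow> P z (r z) (g z)" by metis
  have rg: "\<And>z. z \<in> \<Omega> \<Longrightarrow> r z > 0" "\<And>z. z \<in> \<Omega> \<Longrightarrow> ball z (r z) \<subseteq> \<Omega>"
    "\<And>z. z \<in> \<Omega> \<Longrightarrow> g z holomorphic_on ball z (r z)"
    "\<And>z w. z \<in> \<Omega> \<Longrightarrow> w \<in> ball z (r z) \<Longrightarrow> g z w \<noteq> 0"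
    "\<And>z w. z \<in> \<Omega> \<Longrightarrow> w \<in> ball z (r z) \<Longrightarrow> f w = (w - z) ^ m z * g z w"
    using P unfolding P_def by simp_all
  \<comment> \<open>At a zero of \<open>f\<close> the quotient is replaced by its limit, the powers
    in the factorizations of \<open>\<gamma>\<close> and \<open>f\<close> at \<open>w\<close> having
    cancelled. By \<open>F_local\<close>, both branches are a single holomorphic expression around
    every \<open>z\<close>.\<close>
  define F where "F w = (if f w \<noteq> 0 then (1 / f w) *\<^sub>C \<gamma> w else (1 / g w w) *\<^sub>C G w w)" for w
  have F_local: "F w = (1 / g z w) *\<^sub>C G z w" if z: "z \<in> \<Omega>" and w: "w \<in> ball z (r z)" for z w
  proof (cases "f w = 0")
    case True
    then have "w = z" using rg(4,5)[OF z w] by auto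
    then show ?thesis using True by (simp add: F_def)
  next
    case False
    have "w \<in> \<Omega>" using rg(2)[OF z] w by blast
    moreover have "(w - z) ^ m z \<noteq> 0" using False rg(5)[OF z w] by auto
    ultimately show ?thesis
      using False mG(3)[OF z, of w] by (simp add: F_def rg(5)[OF z w] del: power_eq_0_iff)
  qed
  have self: "z \<in> ball z (r z)" if "z \<in> \<Omega>" for z using rg(1)[OF that] by simp
  have "vector_holomorphic_on F \<Omega>"
    unfolding vector_holomorphic_on_open[OF \<Omega>(1)]
  proof
    fix z assume z: "z \<in> \<Omega>"
    have "vector_holomorphic_on (\<lambda>w. (1 / g z w) *\<^sub>C G z w) (ball z (r z))"
      by (intro vector_holomorphic_on_scaleC holomorphic_intros rg z open_ball
          vector_holomorphic_on_subset[OF mG(1)])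
    then obtain D where D: "((\<lambda>w. (1 / g z w) *\<^sub>C G z w) has_derivative (\<lambda>h. h *\<^sub>C D)) (at z)"
      unfolding vector_holomorphic_on_open[OF open_ball] using self[OF z] by blast
    have "(F has_derivative (\<lambda>h. h *\<^sub>C D)) (at z)"
      by (rule has_derivative_transform_within_open[OF D open_ball self[OF z]]) (simp add: F_local[OF z])
    then show "\<exists>D. (F has_derivative (\<lambda>h. h *\<^sub>C D)) (at z)" by blast
  qed
  moreover have "F w \<noteq> 0" if w: "w \<in> \<Omega>" for w
    using F_local[OF w self[OF w]] rg(4)[OF w self[OF w]] mG(2)[OF w] by simp
  moreover have "\<gamma> w = f w *\<^sub>C F w" if w: "w \<in> \<Omega>" for w
    using F_local[OF w self[OF w]] rg(4,5)[OF w self[OF w]] mG(3)[OF w w] by simp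
  ultimately show ?thesis by (intro exI[of _ f] exI[of _ F]) simp
qed

lemma vector_holomorphic_on_add:
  assumes "vector_holomorphic_on \<gamma> S" "vector_holomorphic_on \<delta> S"
  shows "vector_holomorphic_on (\<lambda>w. \<gamma> w + \<delta> w) S"
  unfolding vector_holomorphic_on_def
proof
  fix w assume "w \<in> S"
  then obtain D E where "(\<gamma> has_derivative (\<lambda>h. h *\<^sub>C D)) (at w within S)"
    "(\<delta> has_derivative (\<lambda>h. h *\<^sub>C E)) (at w within S)"
    using assms unfolding vector_holomorphic_on_def by metis
  from has_derivative_add[OF this]
  have "((\<lambda>w. \<gamma> w + \<delta> w) has_derivative (\<lambda>h. h *\<^sub>C (D + E))) (at w within S)"
    by (simp add: scaleC_add_right)
  then show "\<exists>D. ((\<lambda>w. \<gamma> w + \<delta> w) has_derivative (\<lambda>h. h *\<^sub>C D)) (at w within S)" ..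
qed

text \<open>Where \<open>\<gamma>\<close> is nonzero, \<open>F\<close> is a scalar multiple of it
  and so an eigenvector. These points form a nonempty open set, and the defect \<open>\<eta>\<close>
  of the eigenvalue equation is holomorphic, so it vanishes on all of
  \<open>\<Omega>\<close>.\<close>

lemma nonvanishing_section_exists:
  fixes \<gamma> :: "complex \<Rightarrow> 'a::separable_hilbert"
  assumes A: "bounded_clinear A" and hol: "vector_holomorphic_on \<gamma> \<Omega>"
    and \<Omega>: "open \<Omega>" "connected \<Omega>" and ne: "\<exists>w\<in>\<Omega>. \<gamma> w \<noteq> 0"
    and eig: "\<And>w. w \<in> \<Omega> \<Longrightarrow> \<gamma> w \<in> eigenspace A w"
  shows "\<exists>F. nonvanishing_section \<Omega> A F"
proof -
  obtain f F where fF: "vector_holomorphic_on F \<Omega> \<and> (\<forall>w\<in>\<Omega>. F w \<noteq> 0 \<and> \<gamma> w = f w *\<^sub>C F w)"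
    using vector_holomorphic_divisor[OF hol \<Omega> ne] by (elim exE)
  then have F: "vector_holomorphic_on F \<Omega>" "\<And>w. w \<in> \<Omega> \<Longrightarrow> F w \<noteq> 0"
    "\<And>w. w \<in> \<Omega> \<Longrightarrow> \<gamma> w = f w *\<^sub>C F w"
    by simp_all
  define \<eta> where "\<eta> w = A (F w) + (- w) *\<^sub>C F w" for w
  have hol_\<eta>: "vector_holomorphic_on \<eta> \<Omega>"
    unfolding \<eta>_def
    by (intro vector_holomorphic_on_add vector_holomorphic_on_bounded_clinear[OF A]
        vector_holomorphic_on_scaleC holomorphic_intros F(1) \<Omega>(1))
  have op: "open {w\<in>\<Omega>. \<gamma> w \<noteq> 0}"
  proof -
    have "open (\<Omega> \<inter> \<gamma> -` (- {0}))"
      by (intro continuous_open_preimage vector_holomorphic_on_imp_continuous_on[OF hol] \<Omega>(1)) auto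
    moreover have "{w\<in>\<Omega>. \<gamma> w \<noteq> 0} = \<Omega> \<inter> \<gamma> -` (- {0})" by auto
    ultimately show ?thesis by simp
  qed
  have \<eta>0: "\<eta> w = 0" if "w \<in> \<Omega>" "\<gamma> w \<noteq> 0" for w
  proof -
    have "A (\<gamma> w) - w *\<^sub>C \<gamma> w = 0" using eig[OF that(1)] by (simp add: eigenspace_def)
    then have "f w *\<^sub>C A (F w) - f w *\<^sub>C w *\<^sub>C F w = 0"
      unfolding F(3)[OF that(1)] by (simp add: bounded_clinear_D(2)[OF A] mult.commute)
    then have "f w *\<^sub>C \<eta> w = 0"
      unfolding \<eta>_def by (simp only: complex_vector.scale_right_diff_distrib[symmetric]
          complex_vector.scale_minus_left add_uminus_conv_diff)
    moreover have "f w \<noteq> 0" using that F(3)[OF that(1)] by auto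
    ultimately show ?thesis by simp
  qed
  \<comment> \<open>The identity theorem asks for a fixed second argument; it is taken to be the
    value of \<open>\<eta>\<close> at the point in question.\<close>
  have "cinner (\<eta> w) (\<eta> w) = 0" if "w \<in> \<Omega>" for w
  proof (rule vector_holomorphic_on_identity[OF hol_\<eta> \<Omega> op _ _ _ that])
    show "{w\<in>\<Omega>. \<gamma> w \<noteq> 0} \<noteq> {}" using ne by blast
  qed (auto simp: \<eta>0)
  then have "\<eta> w = 0" if "w \<in> \<Omega>" for w using that by (simp add: cinner_self)
  then have "nonvanishing_section \<Omega> A F"
    using F unfolding nonvanishing_section_def eigenspace_def \<eta>_def by simp
  then show ?thesis by blast
qed

section \<open>Intertwining operators\<close>

lemma eigenspace_iff: "x \<in> eigenspace A w \<longleftrightarrow> A x = w *\<^sub>C x"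
  by (simp add: eigenspace_def)

lemma eigenspace_one_dimensional:
  assumes "A \<in> cowen_douglas 1 \<Omega>" "w \<in> \<Omega>" and x: "x \<in> eigenspace A w" "x \<noteq> 0" and y: "y \<in> eigenspace A w"
  shows "\<exists>c. y = c *\<^sub>C x"
proof -
  have d: "complex_vector.dim (eigenspace A w) = 1"
    using assms(1,2) by (simp add: cowen_douglas_def)
  obtain B where "B \<subseteq> eigenspace A w" "complex_vector.independent B"
    and B: "eigenspace A w \<subseteq> complex_vector.span B" "card B = complex_vector.dim (eigenspace A w)"
    by (rule complex_vector.basis_exists)
  have "card B = 1" using B(2) d by simp
  then obtain b where "B = {b}" by (rule card_1_singletonE)
  then have "x \<in> range (\<lambda>k. k *\<^sub>C b)" "y \<in> range (\<lambda>k. k *\<^sub>C b)"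
    using B(1) x y complex_vector.span_singleton[of b] by auto
  then obtain k l where kl: "x = k *\<^sub>C b" "y = l *\<^sub>C b" by blast
  then have "y = (l / k) *\<^sub>C x" using x(2) by auto
  then show ?thesis ..
qed

lemma intertwiner_eigenspace:
  assumes "bounded_clinear W" "\<And>x. W (A x) = B (W x)" "x \<in> eigenspace A w"
  shows "W x \<in> eigenspace B w"
  using assms(3) unfolding eigenspace_iff
  by (simp add: assms(2)[symmetric] bounded_clinear_D(2)[OF assms(1)])

text \<open>A vector orthogonal to the eigenvectors over \<open>N\<close> is orthogonal to
  \<open>\<gamma> w\<close> for \<open>w\<close> in \<open>N\<close>, hence for all \<open>w\<close>
  in \<open>\<Omega>\<close> by the identity theorem, and these are total. This is what permits
  unitaries to be built from a small disc.\<close>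

lemma eigenvectors_dense:
  assumes A: "A \<in> cowen_douglas 1 \<Omega>" and \<Omega>: "open \<Omega>" "connected \<Omega>"
    and \<gamma>: "nonvanishing_section \<Omega> A \<gamma>" and N: "open N" "N \<noteq> {}" "N \<subseteq> \<Omega>"
    and a: "\<And>w. w \<in> N \<Longrightarrow> a w \<in> eigenspace A w" "\<And>w. w \<in> N \<Longrightarrow> a w \<noteq> 0"
  shows "closure (complex_vector.span (a ` N)) = UNIV"
proof (rule closure_span_eq_UNIV_if)
  fix x assume x: "\<And>v. v \<in> a ` N \<Longrightarrow> cinner v x = 0"
  have hol: "vector_holomorphic_on \<gamma> \<Omega>" and eig: "\<And>w. w \<in> \<Omega> \<Longrightarrow> \<gamma> w \<in> eigenspace A w"
    and nz: "\<And>w. w \<in> \<Omega> \<Longrightarrow> \<gamma> w \<noteq> 0"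
    using \<gamma> by (auto simp: nonvanishing_section_def)
  have 0: "cinner (\<gamma> w) x = 0" if w: "w \<in> N" for w
  proof -
    have "w \<in> \<Omega>" using w N by blast
    then obtain c where "\<gamma> w = c *\<^sub>C a w"
      using eigenspace_one_dimensional[OF A _ a[OF w] eig] by blast
    then show ?thesis using x w by (simp add: cinner_scaleC_left)
  qed
  have 1: "cinner (\<gamma> w) x = 0" if "w \<in> \<Omega>" for w
    by (rule vector_holomorphic_on_identity[OF hol \<Omega> N 0 that])
  show "x = 0"
  proof (rule dense_span_cinner_eq_0)
    show "closure (complex_vector.span (\<Union>w\<in>\<Omega>. eigenspace A w)) = UNIV"
      using A by (simp add: cowen_douglas_def)
    fix v assume "v \<in> (\<Union>w\<in>\<Omega>. eigenspace A w)"
    then obtain w where w: "w \<in> \<Omega>" "v \<in> eigenspace A w" by blast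
    then obtain c where "v = c *\<^sub>C \<gamma> w"
      using eigenspace_one_dimensional[OF A w(1) eig[OF w(1)] nz[OF w(1)]] by blast
    then show "cinner v x = 0" using 1[OF w(1)] by (simp add: cinner_scaleC_left)
  qed
qed

lemma bounded_clinear_0: "bounded_clinear (\<lambda>_. 0)"
  by (simp add: bounded_clinear_def)

definition nonzero_on_eigenspaces :: "('a::complex_inner \<Rightarrow> 'b::complex_inner) \<Rightarrow> ('a \<Rightarrow> 'a) \<Rightarrow> complex set \<Rightarrow> bool"
  where "nonzero_on_eigenspaces W A N \<longleftrightarrow> (\<forall>w\<in>N. \<forall>x\<in>eigenspace A w. x \<noteq> 0 \<longrightarrow> W x \<noteq> 0)"

text \<open>If \<open>W (\<gamma> w)\<close> vanished throughout \<open>N\<close>, totality over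
  \<open>N\<close> would give \<open>W = 0\<close>. Starting from any \<open>N\<close> allows
  iteration, so that several nonzero operators are treated over one open set.\<close>

lemma nonzero_on_eigenspaces_exists:
  assumes A: "A \<in> cowen_douglas 1 \<Omega>" and \<Omega>: "open \<Omega>" "connected \<Omega>"
    and \<gamma>: "nonvanishing_section \<Omega> A \<gamma>" and N: "open N" "N \<noteq> {}" "N \<subseteq> \<Omega>"
    and W: "bounded_clinear W" "W \<noteq> (\<lambda>_. 0)"
  obtains N' where "open N'" "N' \<noteq> {}" "N' \<subseteq> N" "nonzero_on_eigenspaces W A N'"
proof -
  have hol: "vector_holomorphic_on \<gamma> \<Omega>" and eig: "\<And>w. w \<in> \<Omega> \<Longrightarrow> \<gamma> w \<in> eigenspace A w"
    and nz: "\<And>w. w \<in> \<Omega> \<Longrightarrow> \<gamma> w \<noteq> 0"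
    using \<gamma> by (auto simp: nonvanishing_section_def)
  define N' where "N' = N \<inter> (\<lambda>w. W (\<gamma> w)) -` (- {0})"
  have "continuous_on N (\<lambda>w. W (\<gamma> w))"
    using vector_holomorphic_on_imp_continuous_on[OF vector_holomorphic_on_bounded_clinear[OF W(1) hol]]
      N(3) by (rule continuous_on_subset)
  then have "open N'"
    unfolding N'_def by (intro continuous_open_preimage N) auto
  moreover have "N' \<noteq> {}"
  proof
    assume "N' = {}"
    then have 0: "W (\<gamma> w) = 0" if "w \<in> N" for w using that by (auto simp: N'_def)
    have "closure (complex_vector.span (\<gamma> ` N)) = UNIV"
      by (rule eigenvectors_dense[OF A \<Omega> \<gamma> N]) (use eig nz N(3) in auto)
    then have "W = (\<lambda>_. 0)"
      using 0 by (intro bounded_clinear_eq_on_dense[OF W(1) bounded_clinear_0]) auto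
    then show False using W(2) by contradiction
  qed
  moreover have "W x \<noteq> 0" if w: "w \<in> N'" and x: "x \<in> eigenspace A w" "x \<noteq> 0" for w x
  proof -
    have "w \<in> \<Omega>" using w N(3) by (auto simp: N'_def)
    then obtain c where "\<gamma> w = c *\<^sub>C x"
      using eigenspace_one_dimensional[OF A _ x eig] by blast
    moreover have "W (\<gamma> w) \<noteq> 0" using w by (simp add: N'_def)
    ultimately show ?thesis using bounded_clinear_D(2)[OF W(1)] by auto
  qed
  ultimately show ?thesis by (intro that[of N']) (auto simp: N'_def nonzero_on_eigenspaces_def)
qed

text \<open>The Kleinecke-Shirokov argument: with \<open>B = A - w\<close> one gets
  \<open>B^n (Z^n t) = n! \<phi>^n t\<close>, which grows faster than any power unless \<open>\<phi> = 0\<close>.\<close>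

lemma Kleinecke_Shirokov_eigenvalue:
  fixes A Z Q :: "'a::complex_inner \<Rightarrow> 'a"
  assumes A: "bounded_clinear A" and Z: "bounded_clinear Z"
    and comm: "\<And>x. A (Z x) = Z (A x) + Q x" and AQ: "\<And>x. A (Q x) = Q (A x)"
    and t: "t \<in> eigenspace A w" "t \<noteq> 0" and Qt: "Q t = \<phi> *\<^sub>C t"
  shows "\<phi> = 0"
proof (rule ccontr)
  assume \<phi>: "\<phi> \<noteq> 0"
  \<comment> \<open>\<open>Q\<close> is the commutator of \<open>A\<close> and \<open>Z\<close>; its
    linearity is read off from this.\<close>
  have Q_eq: "Q x = A (Z x) - Z (A x)" for x using comm[of x] by simp
  note A' = bounded_clinear_D[OF A] and Z' = bounded_clinear_D[OF Z]
  have swap: "(a - b) - (c - d) = (a - c) - (b - d)" for a b c d :: 'a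
    by (simp add: algebra_simps)
  have Q_diff: "Q (x - y) = Q x - Q y" for x y
    unfolding Q_eq A'(5) Z'(5) by (rule swap)
  have Q_scale: "Q (c *\<^sub>C x) = c *\<^sub>C Q x" for c x
    unfolding Q_eq A'(2) Z'(2) complex_vector.scale_right_diff_distrib ..
  define B where "B x = A x - w *\<^sub>C x" for x
  have B_add: "B (x + y) = B x + B y" for x y
    unfolding B_def A'(3) scaleC_add_right by (rule add_diff_add)
  have B_scale: "B (c *\<^sub>C x) = c *\<^sub>C B x" for c x
    unfolding B_def A'(2) complex_vector.scale_right_diff_distrib scaleC_scaleC mult.commute[of c] ..
  have B0: "B 0 = 0" using B_scale[of 0 0] by simp
  have BZ: "B (Z x) = Z (B x) + Q x" for x
    unfolding B_def comm Z'(5) Z'(2) by simp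
  have BQ: "B (Q x) = Q (B x)" for x
    unfolding B_def AQ Q_diff Q_scale ..
  have Bt: "B t = 0" using t(1) by (simp add: B_def eigenspace_def)
  have BnQ: "(B ^^ n) (Q x) = Q ((B ^^ n) x)" for n x
    by (induction n) (simp_all add: BQ)
  \<comment> \<open>Leibniz rule: moving one \<open>B\<close> past \<open>Z\<close> produces one
    \<open>Q\<close>, and \<open>Q\<close> commutes with \<open>B\<close>.\<close>
  have Bn_comm: "(B ^^ Suc n) (Z x) = Z ((B ^^ Suc n) x) + of_nat (Suc n) *\<^sub>C Q ((B ^^ n) x)" for n x
  proof (induction n)
    case 0
    then show ?case by (simp add: BZ)
  next
    case (Suc n)
    have "(B ^^ Suc (Suc n)) (Z x) = B (Z ((B ^^ Suc n) x)) + of_nat (Suc n) *\<^sub>C B (Q ((B ^^ n) x))"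
      using Suc.IH by (simp add: B_add B_scale)
    also have "\<dots> = Z ((B ^^ Suc (Suc n)) x) + (1 + of_nat (Suc n)) *\<^sub>C Q ((B ^^ Suc n) x)"
      by (simp add: BZ BQ scaleC_add_left del: of_nat_Suc)
    finally show ?case by (simp only: of_nat_Suc)
  qed
  have main: "(B ^^ n) ((Z ^^ n) t) = (fact n * \<phi> ^ n) *\<^sub>C t" for n
  proof (induction n)
    case (Suc n)
    \<comment> \<open>One more \<open>B\<close> annihilates the multiple of \<open>t\<close>, which
      removes the term beginning with \<open>Z\<close>.\<close>
    have "(B ^^ Suc n) ((Z ^^ n) t) = 0"
      using Suc.IH by (simp add: B_scale Bt)
    then have "(B ^^ Suc n) ((Z ^^ Suc n) t) = of_nat (Suc n) *\<^sub>C Q ((B ^^ n) ((Z ^^ n) t))"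
      using Bn_comm[of n "(Z ^^ n) t"] bounded_clinear_D(4)[OF Z] by simp
    then show ?case
      by (simp only: Suc.IH Q_scale Qt scaleC_scaleC) (simp add: mult_ac)
  qed simp
  obtain b where b: "b > 0" "\<And>x. norm (Z x) \<le> norm x * b"
    using bounded_linear.pos_bounded[OF bounded_clinear_D(1)[OF Z]] by blast
  obtain a' where a': "a' > 0" "\<And>x. norm (A x) \<le> norm x * a'"
    using bounded_linear.pos_bounded[OF bounded_clinear_D(1)[OF A]] by blast
  define a where "a = a' + cmod w"
  have a: "a > 0" using a'(1) by (simp add: a_def add_pos_nonneg)
  have Ba: "norm (B x) \<le> a * norm x" for x
    using norm_triangle_ineq4[of "A x" "w *\<^sub>C x"] a'(2)[of x] by (simp add: B_def a_def algebra_simps)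
  have Bn: "norm ((B ^^ n) x) \<le> a ^ n * norm x" for n x
  proof (induction n)
    case (Suc n)
    have "norm ((B ^^ Suc n) x) \<le> a * norm ((B ^^ n) x)" using Ba by simp
    also have "\<dots> \<le> a * (a ^ n * norm x)" using Suc.IH a by (intro mult_left_mono) auto
    finally show ?case by simp
  qed simp
  have Zn: "norm ((Z ^^ n) x) \<le> b ^ n * norm x" for n x
  proof (induction n)
    case (Suc n)
    have "norm ((Z ^^ Suc n) x) \<le> b * norm ((Z ^^ n) x)" using b(2) by (simp add: mult.commute)
    also have "\<dots> \<le> b * (b ^ n * norm x)" using Suc.IH b by (intro mult_left_mono) auto
    finally show ?case by simp
  qed simp
  define c where "c = a * b / cmod \<phi>"
  have ge: "1 \<le> inverse (fact n) * c ^ n" for n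
  proof -
    have "fact n * cmod \<phi> ^ n * norm t = norm ((B ^^ n) ((Z ^^ n) t))"
      by (simp add: main norm_mult norm_power)
    also have "\<dots> \<le> a ^ n * (b ^ n * norm t)"
      using a by (intro order_trans[OF Bn] mult_left_mono[OF Zn]) simp
    finally have "fact n * cmod \<phi> ^ n \<le> (a * b) ^ n"
      using t(2) by (simp add: power_mult_distrib)
    then show ?thesis
      using \<phi> by (simp add: c_def power_divide field_simps)
  qed
  have "(\<lambda>n. inverse (fact n) * c ^ n) \<longlonglongrightarrow> 0"
    using summable_LIMSEQ_zero[OF summable_exp] .
  then have "1 \<le> (0::real)"
    by (rule tendsto_lowerbound) (use ge in auto)
  then show False by simp
qed

section \<open>Operators on direct sums and their triangular intertwiners\<close>

lemma bounded_clinear_fst: "bounded_clinear fst"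
  by (simp add: bounded_clinear_def bounded_linear_fst scaleC_prod_def)

lemma bounded_clinear_snd: "bounded_clinear snd"
  by (simp add: bounded_clinear_def bounded_linear_snd scaleC_prod_def)

lemma bounded_clinear_Pair:
  assumes "bounded_clinear A" "bounded_clinear B"
  shows "bounded_clinear (\<lambda>x. (A x, B x))"
  using assms by (simp add: bounded_clinear_def bounded_linear_Pair scaleC_prod_def)

lemma bounded_clinear_ident: "bounded_clinear (\<lambda>x. x)"
  by (simp add: bounded_clinear_def bounded_linear_ident)

lemma bounded_clinear_entry:
  assumes "bounded_clinear U"
  shows "bounded_clinear (\<lambda>x. fst (U (x, 0)))" "bounded_clinear (\<lambda>x. snd (U (x, 0)))"
    "bounded_clinear (\<lambda>y. fst (U (0, y)))" "bounded_clinear (\<lambda>y. snd (U (0, y)))"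
proof -
  have 1: "bounded_clinear (\<lambda>x. U (x, 0))" "bounded_clinear (\<lambda>y. U (0, y))"
    by (rule bounded_clinear_compose[OF assms bounded_clinear_Pair[OF bounded_clinear_ident bounded_clinear_0]])
      (rule bounded_clinear_compose[OF assms bounded_clinear_Pair[OF bounded_clinear_0 bounded_clinear_ident]])
  show "bounded_clinear (\<lambda>x. fst (U (x, 0)))" "bounded_clinear (\<lambda>x. snd (U (x, 0)))"
    "bounded_clinear (\<lambda>y. fst (U (0, y)))" "bounded_clinear (\<lambda>y. snd (U (0, y)))"
    by (rule bounded_clinear_compose[OF bounded_clinear_fst 1(1)] bounded_clinear_compose[OF bounded_clinear_snd 1(1)]
      bounded_clinear_compose[OF bounded_clinear_fst 1(2)] bounded_clinear_compose[OF bounded_clinear_snd 1(2)])+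
qed

lemma FB2_D:
  assumes "FB2 \<Omega> T0 S T1"
  shows "T0 \<in> cowen_douglas 1 \<Omega>" "T1 \<in> cowen_douglas 1 \<Omega>" "bounded_clinear S" "S \<noteq> (\<lambda>_. 0)"
    "bounded_clinear T0" "bounded_clinear T1" "\<And>x. T0 (S x) = S (T1 x)"
  using assms unfolding FB2_def by (auto simp: cowen_douglas_def fun_eq_iff)

text \<open>Over the empty set the density condition says that 0 alone is dense, so the second space
  is trivial and \<open>S\<close> vanishes.\<close>

lemma FB2_domain_nonempty:
  fixes S :: "'b::separable_hilbert \<Rightarrow> 'a::separable_hilbert"
  assumes "FB2 \<Omega> T0 S T1"
  shows "\<Omega> \<noteq> {}"
proof
  assume "\<Omega> = {}"
  then have "(UNIV :: 'b set) = {0}"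
    using FB2_D(2)[OF assms] by (simp add: cowen_douglas_def)
  then have "x \<in> {0}" for x :: 'b
    by (rule subst) (rule UNIV_I)
  then have z: "x = 0" for x :: 'b by simp
  have "S x = S 0" for x by (rule arg_cong[OF z])
  then have "S x = 0" for x
    using bounded_clinear_D(4)[OF FB2_D(3)[OF assms]] by simp
  then show False using FB2_D(4)[OF assms] by auto
qed

text \<open>\<open>S (t w)\<close> is a holomorphic eigenvector of \<open>T0\<close>, not
  identically zero because \<open>S\<close> is nonzero and eigenvectors are total. The zeros it may
  have are divided out.\<close>

lemma FB2_section_exists:
  assumes F: "FB2 \<Omega> T0 S T1" and \<Omega>: "open \<Omega>" "connected \<Omega>" and t: "nonvanishing_section \<Omega> T1 t"
  shows "\<exists>\<gamma>. nonvanishing_section \<Omega> T0 \<gamma>"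
proof (rule nonvanishing_section_exists[OF FB2_D(5)[OF F] _ \<Omega>])
  note D = FB2_D[OF F]
  show "vector_holomorphic_on (\<lambda>w. S (t w)) \<Omega>"
    using t by (intro vector_holomorphic_on_bounded_clinear[OF D(3)]) (simp add: nonvanishing_section_def)
  show "S (t w) \<in> eigenspace T0 w" if "w \<in> \<Omega>" for w
    using t that by (intro intertwiner_eigenspace[OF D(3)]) (auto simp: D(7) nonvanishing_section_def)
  obtain N where "open N" and N: "N \<noteq> {}" "N \<subseteq> \<Omega>" "nonzero_on_eigenspaces S T1 N"
    by (rule nonzero_on_eigenspaces_exists[OF D(2) \<Omega> t \<Omega>(1) FB2_domain_nonempty[OF F] order_refl D(3,4)])
  then obtain w where "w \<in> N" by blast
  then show "\<exists>w\<in>\<Omega>. S (t w) \<noteq> 0"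
    using N t by (intro bexI[of _ w]) (auto simp: nonvanishing_section_def nonzero_on_eigenspaces_def)
qed

lemma intertwiner_triangular:
  fixes T0 :: "'a::separable_hilbert \<Rightarrow> 'a" and S :: "'b::separable_hilbert \<Rightarrow> 'a" and T1 :: "'b \<Rightarrow> 'b"
    and T0' :: "'c::separable_hilbert \<Rightarrow> 'c" and S' :: "'d::separable_hilbert \<Rightarrow> 'c" and T1' :: "'d \<Rightarrow> 'd"
  assumes \<Omega>: "open \<Omega>" "connected \<Omega>" and F: "FB2 \<Omega> T0 S T1" and F': "FB2 \<Omega> T0' S' T1'"
    and t: "nonvanishing_section \<Omega> T1 t" and t': "nonvanishing_section \<Omega> T1' t'"
    and U: "bounded_clinear U" "\<And>p. U (block_op T0 S T1 p) = block_op T0' S' T1' (U p)"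
    and V: "bounded_clinear V" "\<And>p. V (block_op T0' S' T1' p) = block_op T0 S T1 (V p)"
  shows "(\<forall>x. snd (U (x, 0)) = 0) \<or> (\<forall>x. snd (V (x, 0)) = 0)"
proof (rule ccontr)
  assume neg: "\<not> ?thesis"
  note D = FB2_D[OF F] and D' = FB2_D[OF F']
  define X where "X x = snd (U (x, 0))" for x
  define X2 where "X2 y = snd (U (0, y))" for y
  define Y where "Y x = snd (V (x, 0))" for x
  have X: "bounded_clinear X" "X \<noteq> (\<lambda>_. 0)" and X2: "bounded_clinear X2"
    and Y: "bounded_clinear Y" "Y \<noteq> (\<lambda>_. 0)"
    unfolding X_def[abs_def] X2_def[abs_def] Y_def[abs_def] using bounded_clinear_entry[OF U(1)] bounded_clinear_entry[OF V(1)] neg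
    by (auto simp: fun_eq_iff)
  have snd_block: "snd (block_op A B C p) = C (snd p)" for A :: "'e::complex_inner \<Rightarrow> 'e" and B :: "'f::complex_inner \<Rightarrow> 'e" and C p
    by (simp add: block_op_def split_beta)
  have XT: "X (T0 x) = T1' (X x)" for x
    using arg_cong[OF U(2)[of "(x, 0)"], of snd] bounded_clinear_D(4)[OF D(3)] bounded_clinear_D(4)[OF D(6)]
    by (simp add: snd_block X_def) (simp add: block_op_def)
  have YT: "Y (T0' x) = T1 (Y x)" for x
    using arg_cong[OF V(2)[of "(x, 0)"], of snd] bounded_clinear_D(4)[OF D'(3)] bounded_clinear_D(4)[OF D'(6)]
    by (simp add: snd_block Y_def) (simp add: block_op_def)
  \<comment> \<open>Lower right entry of the intertwining relation: \<open>X S\<close> measures how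
    far \<open>X2\<close> is from intertwining \<open>T1\<close> and \<open>T1'\<close>.\<close>
  have X2T: "T1' (X2 y) = X2 (T1 y) + X (S y)" for y
  proof -
    have "block_op T0 S T1 (0, y) = (S y, 0) + (0, T1 y)"
      using bounded_clinear_D(4)[OF D(5)] by (simp add: block_op_def)
    then have "U (block_op T0 S T1 (0, y)) = U (S y, 0) + U (0, T1 y)"
      using bounded_clinear_D(3)[OF U(1)] by metis
    then have "T1' (X2 y) = X (S y) + X2 (T1 y)"
      using arg_cong[OF U(2)[of "(0, y)"], of snd] by (simp add: snd_block X_def X2_def)
    then show ?thesis by (simp add: add.commute)
  qed
  \<comment> \<open>\<open>Y S'\<close> intertwines \<open>T1'\<close> with \<open>T1\<close>;
    composing the relation for \<open>X2\<close> with it on the right exhibits \<open>Q\<close> as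
    the commutator of \<open>T1'\<close> and \<open>Z\<close>.\<close>
  define Q where "Q y = X (S (Y (S' y)))" for y
  define Z where "Z y = X2 (Y (S' y))" for y
  have bZ: "bounded_clinear Z"
    unfolding Z_def[abs_def] by (intro bounded_clinear_compose[OF X2] bounded_clinear_compose[OF Y(1)] D'(3))
  have QT: "T1' (Q y) = Q (T1' y)" for y
    by (simp add: Q_def D(7) D'(7) flip: XT YT)
  have ZT: "T1' (Z y) = Z (T1' y) + Q y" for y
    by (simp add: Z_def Q_def X2T D'(7) flip: YT)
  obtain \<gamma> where \<gamma>: "nonvanishing_section \<Omega> T0 \<gamma>"
    using FB2_section_exists[OF F \<Omega> t] by (elim exE)
  obtain \<gamma>' where \<gamma>': "nonvanishing_section \<Omega> T0' \<gamma>'"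
    using FB2_section_exists[OF F' \<Omega> t'] by (elim exE)
  \<comment> \<open>The nested open sets follow the factors of \<open>Q\<close> from right to left;
    over a point of the innermost one each factor keeps the eigenvector nonzero.\<close>
  obtain N1 where N1: "open N1" "N1 \<noteq> {}" "N1 \<subseteq> \<Omega>"
    and inj1: "nonzero_on_eigenspaces S' T1' N1"
    by (rule nonzero_on_eigenspaces_exists[OF D'(2) \<Omega> t' \<Omega>(1) FB2_domain_nonempty[OF F'] order_refl D'(3,4)])
  obtain N2 where N2: "open N2" "N2 \<noteq> {}" "N2 \<subseteq> N1"
    and inj2: "nonzero_on_eigenspaces Y T0' N2"
    by (rule nonzero_on_eigenspaces_exists[OF D'(1) \<Omega> \<gamma>' N1 Y])
  have N2\<Omega>: "N2 \<subseteq> \<Omega>" using N1 N2 by blast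
  obtain N3 where N3: "open N3" "N3 \<noteq> {}" "N3 \<subseteq> N2"
    and inj3: "nonzero_on_eigenspaces S T1 N3"
    by (rule nonzero_on_eigenspaces_exists[OF D(2) \<Omega> t N2(1,2) N2\<Omega> D(3,4)])
  have N3\<Omega>: "N3 \<subseteq> \<Omega>" using N2\<Omega> N3 by blast
  obtain N4 where "open N4" and N4: "N4 \<noteq> {}" "N4 \<subseteq> N3"
    and inj4: "nonzero_on_eigenspaces X T0 N4"
    by (rule nonzero_on_eigenspaces_exists[OF D(1) \<Omega> \<gamma> N3(1,2) N3\<Omega> X])
  obtain w where w: "w \<in> N1" "w \<in> N2" "w \<in> N3" "w \<in> N4" "w \<in> \<Omega>"
    using N4 N3 N2 N1 by blast
  have e0: "t' w \<in> eigenspace T1' w" "t' w \<noteq> 0"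
    using t' w(5) by (auto simp: nonvanishing_section_def)
  have e1: "S' (t' w) \<in> eigenspace T0' w" "S' (t' w) \<noteq> 0"
    using intertwiner_eigenspace[OF D'(3) D'(7)[symmetric] e0(1)] inj1 w e0 by (simp_all add: nonzero_on_eigenspaces_def)
  have e2: "Y (S' (t' w)) \<in> eigenspace T1 w" "Y (S' (t' w)) \<noteq> 0"
    using intertwiner_eigenspace[OF Y(1) YT e1(1)] inj2 w e1 by (simp_all add: nonzero_on_eigenspaces_def)
  have e3: "S (Y (S' (t' w))) \<in> eigenspace T0 w" "S (Y (S' (t' w))) \<noteq> 0"
    using intertwiner_eigenspace[OF D(3) D(7)[symmetric] e2(1)] inj3 w e2 by (simp_all add: nonzero_on_eigenspaces_def)
  have e4: "Q (t' w) \<in> eigenspace T1' w" "Q (t' w) \<noteq> 0"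
    using intertwiner_eigenspace[OF X(1) XT e3(1)] inj4 w e3 by (simp_all add: nonzero_on_eigenspaces_def Q_def)
  obtain \<phi> where \<phi>: "Q (t' w) = \<phi> *\<^sub>C t' w"
    using eigenspace_one_dimensional[OF D'(2) w(5) e0 e4(1)] by blast
  have "\<phi> = 0"
    by (rule Kleinecke_Shirokov_eigenvalue[OF D'(6) bZ ZT QT e0 \<phi>])
  then show False using e4(2) \<phi> by simp
qed

section \<open>Unitary equivalence\<close>

lemma unitary_D:
  assumes "unitary U"
  shows "bounded_clinear U" "surj U" "\<And>x y. cinner (U x) (U y) = cinner x y"
  using assms by (auto simp: unitary_def)

lemma norm_eq_if_cinner_self_eq:
  fixes x :: "'a::complex_inner" and y :: "'b::complex_inner"
  assumes "cinner x x = cinner y y"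
  shows "norm x = norm y"
proof -
  have "complex_of_real ((norm x)\<^sup>2) = complex_of_real ((norm y)\<^sup>2)"
    using assms by (simp only: cinner_self)
  then have "(norm x)\<^sup>2 = (norm y)\<^sup>2" by (simp only: of_real_eq_iff)
  then show ?thesis by (simp add: power2_eq_iff_nonneg)
qed

lemma unitary_norm: "unitary U \<Longrightarrow> norm (U x) = norm x"
  by (rule norm_eq_if_cinner_self_eq) (rule unitary_D(3))

lemma unitary_inverse:
  assumes U: "unitary U"
  shows "unitary (inv U)" "U (inv U y) = y" "inv U (U x) = x"
proof -
  note D = unitary_D[OF U]
  have "inj U"
  proof (rule injI)
    fix x y assume "U x = U y"
    then have "norm (U (x - y)) = 0" by (simp add: bounded_clinear_D(5)[OF D(1)])
    then show "x = y" by (simp add: unitary_norm[OF U])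
  qed
  then show VU: "inv U (U x) = x" for x by (rule inv_f_f)
  show UV: "U (inv U y) = y" for y using D(2) by (rule surj_f_inv_f)
  have add: "inv U (x + y) = inv U x + inv U y" for x y
    using arg_cong[OF bounded_clinear_D(3)[OF D(1), of "inv U x" "inv U y"], of "inv U"]
    by (simp add: VU UV)
  have scale: "inv U (c *\<^sub>C x) = c *\<^sub>C inv U x" for c x
    using arg_cong[OF bounded_clinear_D(2)[OF D(1), of c "inv U x"], of "inv U"]
    by (simp add: VU UV)
  have norm: "norm (inv U x) = norm x" for x
    using unitary_norm[OF U, of "inv U x"] by (simp add: UV)
  have "bounded_linear (inv U)"
    by (rule bounded_linear_intro[of _ 1]) (simp_all add: add scale scaleR_scaleC norm)
  moreover have "surj (inv U)"
    by (rule surjI[where f = U]) (rule VU)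
  moreover have "cinner (inv U x) (inv U y) = cinner x y" for x y
    using D(3)[of "inv U x" "inv U y"] by (simp add: UV)
  ultimately show "unitary (inv U)"
    unfolding unitary_def bounded_clinear_def using scale by blast
qed

text \<open>\<open>U0\<close> is isometric, and its closed range contains the eigenvectors of
  \<open>T0'\<close>, each a multiple of some \<open>U0 (\<gamma> w)\<close>; so it is onto. As
  \<open>U\<close> keeps \<open>(0, y)\<close> orthogonal to all \<open>(x, 0)\<close>, the upper
  right entry must then vanish.\<close>

lemma unitary_diagonal:
  fixes T0 :: "'a::separable_hilbert \<Rightarrow> 'a" and S :: "'b::separable_hilbert \<Rightarrow> 'a" and T1 :: "'b \<Rightarrow> 'b"
    and T0' :: "'c::separable_hilbert \<Rightarrow> 'c" and S' :: "'d::separable_hilbert \<Rightarrow> 'c" and T1' :: "'d \<Rightarrow> 'd"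
  assumes F: "FB2 \<Omega> T0 S T1" and F': "FB2 \<Omega> T0' S' T1'" and \<gamma>: "nonvanishing_section \<Omega> T0 \<gamma>"
    and U: "unitary U" and UT: "\<And>p. U (block_op T0 S T1 p) = block_op T0' S' T1' (U p)"
    and tri: "\<And>x. snd (U (x, 0)) = 0"
  shows "\<exists>U0 U1. unitary U0 \<and> unitary U1 \<and> (\<forall>x. U0 (T0 x) = T0' (U0 x)) \<and>
    (\<forall>y. U1 (T1 y) = T1' (U1 y)) \<and> (\<forall>y. U0 (S y) = S' (U1 y))"
proof -
  note D = FB2_D[OF F] and D' = FB2_D[OF F']
  note UD = unitary_D[OF U]
  define U0 where "U0 x = fst (U (x, 0))" for x
  define U1 where "U1 y = snd (U (0, y))" for y
  have b0: "bounded_clinear U0" and b1: "bounded_clinear U1"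
    unfolding U0_def[abs_def] U1_def[abs_def] by (rule bounded_clinear_entry[OF UD(1)])+
  have Ux: "U (x, 0) = (U0 x, 0)" for x by (simp add: prod_eq_iff U0_def tri)
  have cin0: "cinner (U0 x) (U0 y) = cinner x y" for x y
    using UD(3)[of "(x, 0)" "(y, 0)"] by (simp add: Ux cinner_prod_def)
  have norm0: "norm (U0 x) = norm x" for x
    by (rule norm_eq_if_cinner_self_eq) (rule cin0)
  have T00: "block_op T0 S T1 (x, 0) = (T0 x, 0)" for x
    using bounded_clinear_D(4)[OF D(3)] bounded_clinear_D(4)[OF D(6)] by (simp add: block_op_def)
  have T0'0: "block_op T0' S' T1' (x, 0) = (T0' x, 0)" for x
    using bounded_clinear_D(4)[OF D'(3)] bounded_clinear_D(4)[OF D'(6)] by (simp add: block_op_def)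
  have int0: "U0 (T0 x) = T0' (U0 x)" for x
    using UT[of "(x, 0)"] by (simp add: T00 T0'0 Ux)
  have eig: "\<gamma> w \<in> eigenspace T0 w" "\<gamma> w \<noteq> 0" if "w \<in> \<Omega>" for w
    using \<gamma> that by (auto simp: nonvanishing_section_def)
  have "complex_vector.subspace (range U0)"
    unfolding complex_vector.subspace_def
  proof (intro conjI ballI allI)
    show "0 \<in> range U0"
      using rangeI[of U0 0] by (simp add: bounded_clinear_D(4)[OF b0])
    show "x + y \<in> range U0" if xy: "x \<in> range U0" "y \<in> range U0" for x y
    proof -
      obtain x' y' where "x = U0 x'" "y = U0 y'" using xy by blast
      then show ?thesis
        using rangeI[of U0 "x' + y'"] by (simp add: bounded_clinear_D(3)[OF b0])
    qed
    show "k *\<^sub>C x \<in> range U0" if x: "x \<in> range U0" for k x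
    proof -
      obtain x' where "x = U0 x'" using x by blast
      then show ?thesis
        using rangeI[of U0 "k *\<^sub>C x'"] by (simp add: bounded_clinear_D(2)[OF b0])
    qed
  qed
  moreover have "(\<Union>w\<in>\<Omega>. eigenspace T0' w) \<subseteq> range U0"
  proof
    fix v assume "v \<in> (\<Union>w\<in>\<Omega>. eigenspace T0' w)"
    then obtain w where w: "w \<in> \<Omega>" "v \<in> eigenspace T0' w" by blast
    have "U0 (\<gamma> w) \<in> eigenspace T0' w"
      by (rule intertwiner_eigenspace[OF b0 int0 eig(1)[OF w(1)]])
    moreover have "U0 (\<gamma> w) \<noteq> 0"
      using norm0[of "\<gamma> w"] eig(2)[OF w(1)] by (metis norm_eq_zero)
    ultimately obtain c where "v = c *\<^sub>C U0 (\<gamma> w)"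
      using eigenspace_one_dimensional[OF D'(1) w(1) _ _ w(2)] by blast
    then have "v = U0 (c *\<^sub>C \<gamma> w)" by (simp add: bounded_clinear_D(2)[OF b0])
    then show "v \<in> range U0" by simp
  qed
  ultimately have sp: "complex_vector.span (\<Union>w\<in>\<Omega>. eigenspace T0' w) \<subseteq> range U0"
    by (intro complex_vector.span_minimal)
  have "complete (range U0)"
    by (rule complete_isometric_image[of 1])
      (use bounded_clinear_D(1)[OF b0] in \<open>simp_all add: norm0 complete_UNIV\<close>)
  then have "closed (range U0)" by (rule complete_imp_closed)
  with sp have "closure (complex_vector.span (\<Union>w\<in>\<Omega>. eigenspace T0' w)) \<subseteq> range U0"
    by (rule closure_minimal)
  then have surj0: "range U0 = UNIV"
    using D'(1) by (simp add: cowen_douglas_def top.extremum_unique)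
  have un0: "unitary U0"
    unfolding unitary_def using b0 surj0 cin0 by blast
  have Uy: "U (0, y) = (0, U1 y)" for y
  proof -
    obtain x where x: "fst (U (0, y)) = U0 x" using surj0 by (metis rangeE UNIV_I)
    have "cinner (U (x, 0)) (U (0, y)) = 0"
      unfolding UD(3) by (simp add: cinner_prod_def)
    then have "cinner (U0 x) (U0 x) = 0"
      by (simp add: Ux cinner_prod_def x)
    then have "U0 x = 0" by (simp add: cinner_self)
    then show ?thesis by (simp add: prod_eq_iff U1_def x)
  qed
  have Uxy: "U (x, y) = (U0 x, U1 y)" for x y
  proof -
    have "U ((x, 0) + (0, y)) = U (x, 0) + U (0, y)"
      by (rule bounded_clinear_D(3)[OF UD(1)])
    then show ?thesis by (simp add: Ux Uy)
  qed
  have cin1: "cinner (U1 x) (U1 y) = cinner x y" for x y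
    using UD(3)[of "(0, x)" "(0, y)"] by (simp add: Uy cinner_prod_def)
  have "surj U1"
  proof (rule surjI)
    fix z
    have "U (inv U (0, z)) = (0, z)" using UD(2) by (rule surj_f_inv_f)
    then show "U1 (snd (inv U (0, z))) = z"
      using Uxy[of "fst (inv U (0, z))" "snd (inv U (0, z))"] by simp
  qed
  then have un1: "unitary U1"
    unfolding unitary_def using b1 cin1 by blast
  have T0y: "U (block_op T0 S T1 (0, y)) = (U0 (S y), U1 (T1 y))" for y
    using bounded_clinear_D(4)[OF D(5)] by (simp add: block_op_def Uxy)
  have T0y': "block_op T0' S' T1' (U (0, y)) = (S' (U1 y), T1' (U1 y))" for y
    using bounded_clinear_D(4)[OF D'(5)] by (simp add: block_op_def Uy)
  have "U0 (S y) = S' (U1 y)" "U1 (T1 y) = T1' (U1 y)" for y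
    using UT[of "(0, y)"] unfolding T0y T0y' by simp_all
  then show ?thesis using un0 un1 int0 by blast
qed

text \<open>Removes the arbitrary choice in \<open>curvature\<close> and admits sections over a
  smaller open set. Two sections of a line bundle differ by a scalar function, which does not affect
  the curvature once it is known to be holomorphic.\<close>

lemma curvature_eq_section_curvature:
  fixes A :: "'a::separable_hilbert \<Rightarrow> 'a"
  assumes A: "A \<in> cowen_douglas 1 \<Omega>" and \<Omega>: "open \<Omega>" and ex: "\<exists>\<gamma>. nonvanishing_section \<Omega> A \<gamma>"
    and D: "open D" "D \<subseteq> \<Omega>" and \<gamma>: "nonvanishing_section D A \<gamma>" and w: "w \<in> D"
  shows "curvature \<Omega> A w = section_curvature \<gamma> w"
proof -
  define \<delta> where "\<delta> = (SOME \<gamma>. nonvanishing_section \<Omega> A \<gamma>)"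
  have \<delta>: "nonvanishing_section \<Omega> A \<delta>" unfolding \<delta>_def using ex by (rule someI_ex)
  have hol\<delta>: "vector_holomorphic_on \<delta> \<Omega>" and e\<delta>: "\<And>z. z \<in> \<Omega> \<Longrightarrow> \<delta> z \<in> eigenspace A z"
    and n\<delta>: "\<And>z. z \<in> \<Omega> \<Longrightarrow> \<delta> z \<noteq> 0"
    using \<delta> by (auto simp: nonvanishing_section_def)
  have hol\<gamma>: "vector_holomorphic_on \<gamma> D" and e\<gamma>: "\<And>z. z \<in> D \<Longrightarrow> \<gamma> z \<in> eigenspace A z"
    and n\<gamma>: "\<And>z. z \<in> D \<Longrightarrow> \<gamma> z \<noteq> 0"
    using \<gamma> by (auto simp: nonvanishing_section_def)
  \<comment> \<open>A quotient of scalar products exhibits the factor as holomorphic. Its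
    denominator is nonzero at \<open>w\<close>, hence on the neighbourhood \<open>N\<close>, and
    curvature is local.\<close>
  define d where "d z = cinner (\<delta> z) (\<delta> w)" for z
  define g where "g z = cinner (\<gamma> z) (\<delta> w) / d z" for z
  define N where "N = D \<inter> d -` (- {0})"
  have hold: "d holomorphic_on D"
    unfolding d_def by (rule holomorphic_on_cinner[OF vector_holomorphic_on_subset[OF hol\<delta> D(2)] D(1)])
  have N: "open N" unfolding N_def
    by (intro continuous_open_preimage holomorphic_on_imp_continuous_on hold D) auto
  have ND: "N \<subseteq> D" by (auto simp: N_def)
  have N\<Omega>: "N \<subseteq> \<Omega>" using ND D(2) by blast
  have wN: "w \<in> N" using w n\<delta>[of w] D(2) by (auto simp: N_def d_def cinner_self)
  have d0: "d z \<noteq> 0" if "z \<in> N" for z using that by (simp add: N_def)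
  have g: "g holomorphic_on N"
    unfolding g_def
    by (intro holomorphic_on_divide holomorphic_on_subset[OF hold ND] d0
        holomorphic_on_subset[OF holomorphic_on_cinner[OF hol\<gamma> D(1)] ND])
  have eq: "\<gamma> z = g z *\<^sub>C \<delta> z" if z: "z \<in> N" for z
  proof -
    have zD: "z \<in> D" and z\<Omega>: "z \<in> \<Omega>" using z ND N\<Omega> by auto
    obtain c where c: "\<gamma> z = c *\<^sub>C \<delta> z"
      using eigenspace_one_dimensional[OF A z\<Omega> e\<delta>[OF z\<Omega>] n\<delta>[OF z\<Omega>] e\<gamma>[OF zD]] by (elim exE)
    then have "g z = c"
      using d0[OF z] by (simp add: g_def d_def cinner_scaleC_left)
    then show ?thesis using c by simp
  qed
  have g0: "g z \<noteq> 0" if "z \<in> N" for z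
  proof
    assume "g z = 0"
    then have "\<gamma> z = 0" using eq[OF that] by simp
    then show False using n\<gamma>[of z] that ND by blast
  qed
  have "section_curvature \<gamma> w = section_curvature \<delta> w"
  proof (rule section_curvature_eq_if_norm_eq[OF vector_holomorphic_on_subset[OF hol\<delta> N\<Omega>] N _ wN g g0])
    show "\<delta> z \<noteq> 0" if "z \<in> N" for z using n\<delta> that N\<Omega> by blast
    show "norm (\<gamma> z) = cmod (g z) * norm (\<delta> z)" if "z \<in> N" for z
      using arg_cong[OF eq[OF that], of norm] by simp
  qed
  then show ?thesis by (simp add: curvature_def \<delta>_def)
qed

lemma curvature_unitary_invariant:
  fixes A :: "'a::separable_hilbert \<Rightarrow> 'a" and B :: "'b::separable_hilbert \<Rightarrow> 'b"
  assumes A: "A \<in> cowen_douglas 1 \<Omega>" and B: "B \<in> cowen_douglas 1 \<Omega>" and \<Omega>: "open \<Omega>"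
    and \<gamma>: "nonvanishing_section \<Omega> A \<gamma>"
    and U: "unitary U" "\<And>x. U (A x) = B (U x)" and w: "w \<in> \<Omega>"
  shows "curvature \<Omega> A w = curvature \<Omega> B w"
proof -
  have U\<gamma>: "nonvanishing_section \<Omega> B (\<lambda>z. U (\<gamma> z))"
    unfolding nonvanishing_section_def
  proof (intro conjI ballI)
    show "vector_holomorphic_on (\<lambda>z. U (\<gamma> z)) \<Omega>"
      by (rule vector_holomorphic_on_bounded_clinear[OF unitary_D(1)[OF U(1)]])
        (use \<gamma> in \<open>simp add: nonvanishing_section_def\<close>)
    fix z assume z: "z \<in> \<Omega>"
    show "U (\<gamma> z) \<in> eigenspace B z"
      using \<gamma> z by (intro intertwiner_eigenspace[where A = A and W = U, OF unitary_D(1)[OF U(1)] U(2)])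
        (simp add: nonvanishing_section_def)
    have "norm (U (\<gamma> z)) \<noteq> 0"
      using \<gamma> z by (simp add: unitary_norm[OF U(1)] nonvanishing_section_def)
    then show "U (\<gamma> z) \<noteq> 0" by simp
  qed
  have "curvature \<Omega> A w = section_curvature \<gamma> w"
    by (rule curvature_eq_section_curvature[OF A \<Omega> exI[of _ \<gamma>] \<Omega> order_refl \<gamma> w]) (rule \<gamma>)
  also have "\<dots> = section_curvature (\<lambda>z. U (\<gamma> z)) w"
    by (rule section_curvature_cong_norm[OF \<Omega> w]) (simp add: unitary_norm[OF U(1)])
  also have "\<dots> = curvature \<Omega> B w"
    by (rule curvature_eq_section_curvature[OF B \<Omega> exI[of _ "\<lambda>z. U (\<gamma> z)"] \<Omega> order_refl U\<gamma> w, symmetric])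
      (rule U\<gamma>)
  finally show ?thesis .
qed

text \<open>Necessity yields both curvature conditions at once. The relation is symmetric in the two
  operators, so the case of a triangular inverse reduces to that of a triangular
  \<open>U\<close>.\<close>

definition same_invariants ::
    "complex set \<Rightarrow> ('a::separable_hilbert \<Rightarrow> 'a) \<Rightarrow> ('b::separable_hilbert \<Rightarrow> 'a) \<Rightarrow> ('b \<Rightarrow> 'b) \<Rightarrow> (complex \<Rightarrow> 'b) \<Rightarrow>
      ('c::separable_hilbert \<Rightarrow> 'c) \<Rightarrow> ('d::separable_hilbert \<Rightarrow> 'c) \<Rightarrow> ('d \<Rightarrow> 'd) \<Rightarrow> (complex \<Rightarrow> 'd) \<Rightarrow> bool"
  where "same_invariants \<Omega> T0 S T1 t T0' S' T1' t' \<longleftrightarrow> (\<forall>w\<in>\<Omega>.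
    curvature \<Omega> T0 w = curvature \<Omega> T0' w \<and> curvature \<Omega> T1 w = curvature \<Omega> T1' w \<and>
    (norm (S (t w)))\<^sup>2 / (norm (t w))\<^sup>2 = (norm (S' (t' w)))\<^sup>2 / (norm (t' w))\<^sup>2)"

text \<open>The eigenspaces are lines, so \<open>U1 (t w) = c *\<^sub>C t' w\<close>; by
  \<open>U0 S = S' U1\<close> the same \<open>c\<close> relates \<open>S (t w)\<close> and
  \<open>S' (t' w)\<close>, and its modulus cancels in the quotient.\<close>

lemma same_invariants_if_triangular:
  fixes T0 :: "'a::separable_hilbert \<Rightarrow> 'a" and S :: "'b::separable_hilbert \<Rightarrow> 'a" and T1 :: "'b \<Rightarrow> 'b"
    and T0' :: "'c::separable_hilbert \<Rightarrow> 'c" and S' :: "'d::separable_hilbert \<Rightarrow> 'c" and T1' :: "'d \<Rightarrow> 'd"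
  assumes \<Omega>: "open \<Omega>" "connected \<Omega>" and F: "FB2 \<Omega> T0 S T1" and F': "FB2 \<Omega> T0' S' T1'"
    and t: "nonvanishing_section \<Omega> T1 t" and t': "nonvanishing_section \<Omega> T1' t'"
    and U: "unitary U" and UT: "\<And>p. U (block_op T0 S T1 p) = block_op T0' S' T1' (U p)"
    and tri: "\<And>x. snd (U (x, 0)) = 0"
  shows "same_invariants \<Omega> T0 S T1 t T0' S' T1' t'"
proof -
  note D = FB2_D[OF F] and D' = FB2_D[OF F']
  obtain \<gamma> where \<gamma>: "nonvanishing_section \<Omega> T0 \<gamma>"
    using FB2_section_exists[OF F \<Omega> t] by (elim exE)
  obtain U0 U1 where UU: "unitary U0 \<and> unitary U1 \<and> (\<forall>x. U0 (T0 x) = T0' (U0 x)) \<and>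
      (\<forall>y. U1 (T1 y) = T1' (U1 y)) \<and> (\<forall>y. U0 (S y) = S' (U1 y))"
    using unitary_diagonal[OF F F' \<gamma> U UT tri] by (elim exE)
  then have u: "unitary U0" "unitary U1" and i0: "\<And>x. U0 (T0 x) = T0' (U0 x)"
    and i1: "\<And>y. U1 (T1 y) = T1' (U1 y)" and iS: "\<And>y. U0 (S y) = S' (U1 y)"
    by simp_all
  show ?thesis
    unfolding same_invariants_def
  proof (intro ballI conjI)
    fix w assume w: "w \<in> \<Omega>"
    show "curvature \<Omega> T0 w = curvature \<Omega> T0' w"
      by (rule curvature_unitary_invariant[OF D(1) D'(1) \<Omega>(1) \<gamma> u(1) i0 w])
    show "curvature \<Omega> T1 w = curvature \<Omega> T1' w"
      by (rule curvature_unitary_invariant[OF D(2) D'(2) \<Omega>(1) t u(2) i1 w])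
    have tw: "t w \<in> eigenspace T1 w" "t w \<noteq> 0" "t' w \<in> eigenspace T1' w" "t' w \<noteq> 0"
      using t t' w by (auto simp: nonvanishing_section_def)
    have "U1 (t w) \<in> eigenspace T1' w"
      by (rule intertwiner_eigenspace[OF unitary_D(1)[OF u(2)] i1 tw(1)])
    then obtain c where c: "U1 (t w) = c *\<^sub>C t' w"
      using eigenspace_one_dimensional[OF D'(2) w tw(3,4)] by blast
    have nt: "norm (t w) = cmod c * norm (t' w)"
      using unitary_norm[OF u(2), of "t w"] by (simp add: c)
    have nS: "norm (S (t w)) = cmod c * norm (S' (t' w))"
      using unitary_norm[OF u(1), of "S (t w)"] by (simp add: iS c bounded_clinear_D(2)[OF D'(3)])
    have "c \<noteq> 0" using nt tw(2) by auto
    then show "(norm (S (t w)))\<^sup>2 / (norm (t w))\<^sup>2 = (norm (S' (t' w)))\<^sup>2 / (norm (t' w))\<^sup>2"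
      by (simp add: nt nS power_mult_distrib)
  qed
qed

lemma same_invariants_sym:
  "same_invariants \<Omega> T0 S T1 t T0' S' T1' t' \<Longrightarrow> same_invariants \<Omega> T0' S' T1' t' T0 S T1 t"
  by (simp add: same_invariants_def)

lemma same_invariants_if_unitarily_equivalent:
  fixes T0 :: "'a::separable_hilbert \<Rightarrow> 'a" and S :: "'b::separable_hilbert \<Rightarrow> 'a" and T1 :: "'b \<Rightarrow> 'b"
    and T0' :: "'c::separable_hilbert \<Rightarrow> 'c" and S' :: "'d::separable_hilbert \<Rightarrow> 'c" and T1' :: "'d \<Rightarrow> 'd"
  assumes \<Omega>: "open \<Omega>" "connected \<Omega>" and F: "FB2 \<Omega> T0 S T1" and F': "FB2 \<Omega> T0' S' T1'"
    and t: "nonvanishing_section \<Omega> T1 t" and t': "nonvanishing_section \<Omega> T1' t'"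
    and eq: "unitarily_equivalent (block_op T0 S T1) (block_op T0' S' T1')"
  shows "same_invariants \<Omega> T0 S T1 t T0' S' T1' t'"
proof -
  obtain U where U: "unitary U" and UT': "U \<circ> block_op T0 S T1 = block_op T0' S' T1' \<circ> U"
    using eq unfolding unitarily_equivalent_def by blast
  have UT: "U (block_op T0 S T1 p) = block_op T0' S' T1' (U p)" for p
    using fun_cong[OF UT', of p] by simp
  define V where "V = inv U"
  have V: "unitary V" unfolding V_def by (rule unitary_inverse(1)[OF U])
  have VT: "V (block_op T0' S' T1' p) = block_op T0 S T1 (V p)" for p
    using arg_cong[OF UT[of "V p"], of V] by (simp add: V_def unitary_inverse[OF U])
  have "(\<forall>x. snd (U (x, 0)) = 0) \<or> (\<forall>x. snd (V (x, 0)) = 0)"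
    by (rule intertwiner_triangular[OF \<Omega> F F' t t' unitary_D(1)[OF U] UT unitary_D(1)[OF V] VT])
  then show ?thesis
  proof
    assume a: "\<forall>x. snd (U (x, 0)) = 0"
    show ?thesis
      by (rule same_invariants_if_triangular[OF \<Omega> F F' t t' U UT]) (use a in simp)
  next
    assume a: "\<forall>x. snd (V (x, 0)) = 0"
    show ?thesis
      by (rule same_invariants_sym, rule same_invariants_if_triangular[OF \<Omega> F' F t' t V VT]) (use a in simp)
  qed
qed

text \<open>As one \<open>g\<close> serves both spaces, \<open>U0 (S (t w))\<close> and
  \<open>S' (U1 (t w))\<close> are the same vector. Totality extends this to
  \<open>U0 S = S' U1\<close>, which makes the direct sum of \<open>U0\<close> and \<open>U1\<close>
  an intertwiner.\<close>

lemma unitarily_equivalent_if_local: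
  fixes T0 :: "'a::separable_hilbert \<Rightarrow> 'a" and S :: "'b::separable_hilbert \<Rightarrow> 'a" and T1 :: "'b \<Rightarrow> 'b"
    and T0' :: "'c::separable_hilbert \<Rightarrow> 'c" and S' :: "'d::separable_hilbert \<Rightarrow> 'c" and T1' :: "'d \<Rightarrow> 'd"
  assumes \<Omega>: "open \<Omega>" "connected \<Omega>" and F: "FB2 \<Omega> T0 S T1" and F': "FB2 \<Omega> T0' S' T1'"
    and t: "nonvanishing_section \<Omega> T1 t" and t': "nonvanishing_section \<Omega> T1' t'"
    and r: "r > 0" "ball c r \<subseteq> \<Omega>"
    and nz: "\<And>w. w \<in> ball c r \<Longrightarrow> S (t w) \<noteq> 0" "\<And>w. w \<in> ball c r \<Longrightarrow> S' (t' w) \<noteq> 0"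
    and g: "g holomorphic_on ball c r" "\<And>w. w \<in> ball c r \<Longrightarrow> g w \<noteq> 0"
    and n1: "\<And>w. w \<in> ball c r \<Longrightarrow> norm (t w) = cmod (g w) * norm (t' w)"
    and n0: "\<And>w. w \<in> ball c r \<Longrightarrow> norm (S (t w)) = cmod (g w) * norm (S' (t' w))"
  shows "unitarily_equivalent (block_op T0 S T1) (block_op T0' S' T1')"
proof -
  note D = FB2_D[OF F] and D' = FB2_D[OF F']
  \<comment> \<open>Polarization is available on half the disc, and eigenvectors over that are still
    total.\<close>
  define N where "N = ball c (r / 2)"
  have N: "open N" "N \<noteq> {}" using r by (auto simp: N_def)
  have Nb: "w \<in> ball c r" if "w \<in> N" for w using that r by (simp add: N_def)
  have N\<Omega>: "N \<subseteq> \<Omega>" using Nb r(2) by blast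
  have hol: "vector_holomorphic_on t \<Omega>" "vector_holomorphic_on t' \<Omega>"
    and e: "\<And>w. w \<in> \<Omega> \<Longrightarrow> t w \<in> eigenspace T1 w" "\<And>w. w \<in> \<Omega> \<Longrightarrow> t' w \<in> eigenspace T1' w"
    and tnz: "\<And>w. w \<in> \<Omega> \<Longrightarrow> t w \<noteq> 0" "\<And>w. w \<in> \<Omega> \<Longrightarrow> t' w \<noteq> 0"
    using t t' by (auto simp: nonvanishing_section_def)
  define s where "s w = g w *\<^sub>C t' w" for w
  have hol_t: "vector_holomorphic_on t (ball c r)"
    by (rule vector_holomorphic_on_subset[OF hol(1) r(2)])
  have hol_s: "vector_holomorphic_on s (ball c r)"
    unfolding s_def by (rule vector_holomorphic_on_scaleC[OF g(1) vector_holomorphic_on_subset[OF hol(2) r(2)] open_ball])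
  have hol_St: "vector_holomorphic_on (\<lambda>w. S (t w)) (ball c r)"
    by (rule vector_holomorphic_on_bounded_clinear[OF D(3) hol_t])
  have hol_Ss: "vector_holomorphic_on (\<lambda>w. S' (s w)) (ball c r)"
    by (rule vector_holomorphic_on_bounded_clinear[OF D'(3) hol_s])
  have S's: "S' (s w) = g w *\<^sub>C S' (t' w)" for w
    by (simp add: s_def bounded_clinear_D(2)[OF D'(3)])
  have gram1: "cinner (t w) (t z) = cinner (s w) (s z)" if "w \<in> N" "z \<in> N" for w z
    by (rule cinner_eq_if_norm_eq[OF hol_t hol_s _ that[unfolded N_def]]) (simp add: s_def n1)
  have gram0: "cinner (S (t w)) (S (t z)) = cinner (S' (s w)) (S' (s z))" if "w \<in> N" "z \<in> N" for w z
    by (rule cinner_eq_if_norm_eq[OF hol_St hol_Ss _ that[unfolded N_def]]) (simp add: S's n0)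
  have es: "s w \<in> eigenspace T1' w" if "w \<in> \<Omega>" for w
    using e(2)[OF that] by (simp add: eigenspace_iff s_def bounded_clinear_D(2)[OF D'(6)] mult.commute)
  have eS: "S (t w) \<in> eigenspace T0 w" if "w \<in> \<Omega>" for w
    by (rule intertwiner_eigenspace[OF D(3) D(7)[symmetric] e(1)[OF that]])
  have eS': "S' (s w) \<in> eigenspace T0' w" if "w \<in> \<Omega>" for w
    by (rule intertwiner_eigenspace[OF D'(3) D'(7)[symmetric] es[OF that]])
  have in\<Omega>: "w \<in> \<Omega>" if "w \<in> N" for w using that N\<Omega> by blast
  have s0: "s w \<noteq> 0" if "w \<in> N" for w
    using g(2)[OF Nb[OF that]] tnz(2)[OF in\<Omega>[OF that]] by (simp add: s_def)
  have S's0: "S' (s w) \<noteq> 0" if "w \<in> N" for w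
    using g(2)[OF Nb[OF that]] nz(2)[OF Nb[OF that]] by (simp add: S's)
  obtain \<gamma> where \<gamma>: "nonvanishing_section \<Omega> T0 \<gamma>"
    using FB2_section_exists[OF F \<Omega> t] by (elim exE)
  obtain \<gamma>' where \<gamma>': "nonvanishing_section \<Omega> T0' \<gamma>'"
    using FB2_section_exists[OF F' \<Omega> t'] by (elim exE)
  have d1: "closure (complex_vector.span (t ` N)) = UNIV"
    by (rule eigenvectors_dense[OF D(2) \<Omega> t N N\<Omega> e(1)[OF in\<Omega>] tnz(1)[OF in\<Omega>]])
  have d1': "closure (complex_vector.span (s ` N)) = UNIV"
    by (rule eigenvectors_dense[OF D'(2) \<Omega> t' N N\<Omega> es[OF in\<Omega>] s0])
  have d0: "closure (complex_vector.span ((\<lambda>w. S (t w)) ` N)) = UNIV"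
    by (rule eigenvectors_dense[OF D(1) \<Omega> \<gamma> N N\<Omega> eS[OF in\<Omega>] nz(1)[OF Nb]])
  have d0': "closure (complex_vector.span ((\<lambda>w. S' (s w)) ` N)) = UNIV"
    by (rule eigenvectors_dense[OF D'(1) \<Omega> \<gamma>' N N\<Omega> eS'[OF in\<Omega>] S's0])
  obtain U1 where "unitary U1 \<and> (\<forall>w\<in>N. U1 (t w) = s w)"
    using unitary_extension[OF _ d1 d1'] gram1 by blast
  then have U1: "unitary U1" "\<And>w. w \<in> N \<Longrightarrow> U1 (t w) = s w" by simp_all
  obtain U0 where "unitary U0 \<and> (\<forall>w\<in>N. U0 (S (t w)) = S' (s w))"
    using unitary_extension[OF _ d0 d0'] gram0 by blast
  then have U0: "unitary U0" "\<And>w. w \<in> N \<Longrightarrow> U0 (S (t w)) = S' (s w)" by simp_all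
  note b0 = unitary_D(1)[OF U0(1)] and b1 = unitary_D(1)[OF U1(1)]
  have i1: "(\<lambda>y. U1 (T1 y)) = (\<lambda>y. T1' (U1 y))"
  proof (rule bounded_clinear_eq_on_dense[OF bounded_clinear_compose[OF b1 D(6)] bounded_clinear_compose[OF D'(6) b1] d1])
    fix x assume "x \<in> t ` N"
    then obtain w where w: "w \<in> N" "x = t w" by blast
    have "U1 (T1 (t w)) = w *\<^sub>C s w"
      using e(1)[OF in\<Omega>[OF w(1)]] by (simp add: eigenspace_iff bounded_clinear_D(2)[OF b1] U1(2)[OF w(1)])
    moreover have "T1' (U1 (t w)) = w *\<^sub>C s w"
      using es[OF in\<Omega>[OF w(1)]] by (simp add: eigenspace_iff U1(2)[OF w(1)])
    ultimately show "U1 (T1 x) = T1' (U1 x)" by (simp add: w(2))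
  qed
  have i0: "(\<lambda>y. U0 (T0 y)) = (\<lambda>y. T0' (U0 y))"
  proof (rule bounded_clinear_eq_on_dense[OF bounded_clinear_compose[OF b0 D(5)] bounded_clinear_compose[OF D'(5) b0] d0])
    fix x assume "x \<in> (\<lambda>w. S (t w)) ` N"
    then obtain w where w: "w \<in> N" "x = S (t w)" by blast
    have "U0 (T0 (S (t w))) = w *\<^sub>C S' (s w)"
      using eS[OF in\<Omega>[OF w(1)]] by (simp add: eigenspace_iff bounded_clinear_D(2)[OF b0] U0(2)[OF w(1)])
    moreover have "T0' (U0 (S (t w))) = w *\<^sub>C S' (s w)"
      using eS'[OF in\<Omega>[OF w(1)]] by (simp add: eigenspace_iff U0(2)[OF w(1)])
    ultimately show "U0 (T0 x) = T0' (U0 x)" by (simp add: w(2))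
  qed
  have iS: "(\<lambda>y. U0 (S y)) = (\<lambda>y. S' (U1 y))"
    by (rule bounded_clinear_eq_on_dense[OF bounded_clinear_compose[OF b0 D(3)] bounded_clinear_compose[OF D'(3) b1] d1])
      (auto simp: U0(2) U1(2))
  define U where "U p = (U0 (fst p), U1 (snd p))" for p
  have "bounded_clinear U"
    unfolding U_def[abs_def]
    by (intro bounded_clinear_Pair bounded_clinear_compose[OF b0] bounded_clinear_compose[OF b1]
        bounded_clinear_fst bounded_clinear_snd)
  moreover have "surj U"
  proof (rule surjI)
    fix p
    show "U (inv U0 (fst p), inv U1 (snd p)) = p"
      by (simp add: U_def unitary_inverse(2)[OF U0(1)] unitary_inverse(2)[OF U1(1)])
  qed
  moreover have "cinner (U p) (U q) = cinner p q" for p q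
    by (simp add: U_def cinner_prod_def unitary_D(3)[OF U0(1)] unitary_D(3)[OF U1(1)])
  ultimately have "unitary U" unfolding unitary_def by simp
  moreover have "U \<circ> block_op T0 S T1 = block_op T0' S' T1' \<circ> U"
    using fun_cong[OF i0] fun_cong[OF i1] fun_cong[OF iS]
    by (auto simp: fun_eq_iff block_op_def U_def bounded_clinear_D(3)[OF b0])
  ultimately show ?thesis
    unfolding unitarily_equivalent_def by (intro exI[of _ U] conjI)
qed

lemma unitarily_equivalent_if_curvature_eq:
  fixes T0 :: "'a::separable_hilbert \<Rightarrow> 'a" and S :: "'b::separable_hilbert \<Rightarrow> 'a" and T1 :: "'b \<Rightarrow> 'b"
    and T0' :: "'c::separable_hilbert \<Rightarrow> 'c" and S' :: "'d::separable_hilbert \<Rightarrow> 'c" and T1' :: "'d \<Rightarrow> 'd"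
  assumes \<Omega>: "open \<Omega>" "connected \<Omega>" and F: "FB2 \<Omega> T0 S T1" and F': "FB2 \<Omega> T0' S' T1'"
    and t: "nonvanishing_section \<Omega> T1 t" and t': "nonvanishing_section \<Omega> T1' t'"
    and ratio: "\<And>w. w \<in> \<Omega> \<Longrightarrow>
      (norm (S (t w)))\<^sup>2 / (norm (t w))\<^sup>2 = (norm (S' (t' w)))\<^sup>2 / (norm (t' w))\<^sup>2"
    and curv: "(\<forall>w\<in>\<Omega>. curvature \<Omega> T1 w = curvature \<Omega> T1' w) \<or> (\<forall>w\<in>\<Omega>. curvature \<Omega> T0 w = curvature \<Omega> T0' w)"
  shows "unitarily_equivalent (block_op T0 S T1) (block_op T0' S' T1')"
proof -
  note D = FB2_D[OF F] and D' = FB2_D[OF F']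
  have hol: "vector_holomorphic_on t \<Omega>" "vector_holomorphic_on t' \<Omega>"
    and e: "\<And>w. w \<in> \<Omega> \<Longrightarrow> t w \<in> eigenspace T1 w" "\<And>w. w \<in> \<Omega> \<Longrightarrow> t' w \<in> eigenspace T1' w"
    and tnz: "\<And>w. w \<in> \<Omega> \<Longrightarrow> t w \<noteq> 0" "\<And>w. w \<in> \<Omega> \<Longrightarrow> t' w \<noteq> 0"
    using t t' by (auto simp: nonvanishing_section_def)
  obtain N where N: "open N" "N \<noteq> {}" "N \<subseteq> \<Omega>" "nonzero_on_eigenspaces S T1 N"
    by (rule nonzero_on_eigenspaces_exists[OF D(2) \<Omega> t \<Omega>(1) FB2_domain_nonempty[OF F] order_refl D(3,4)])
  obtain c where "c \<in> N" using N(2) by blast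
  then obtain r where r: "r > 0" "ball c r \<subseteq> N" using N(1) openE by metis
  define B where "B = ball c r"
  have oB: "open B" by (simp add: B_def)
  have B\<Omega>: "B \<subseteq> \<Omega>" using r N(3) by (auto simp: B_def)
  have in\<Omega>: "w \<in> \<Omega>" if "w \<in> B" for w using that B\<Omega> by blast
  have Snz: "S (t w) \<noteq> 0" if "w \<in> B" for w
    using N(4) that r(2) e(1)[OF in\<Omega>[OF that]] tnz(1)[OF in\<Omega>[OF that]]
    unfolding nonzero_on_eigenspaces_def B_def by blast
  have ratio': "norm (S (t w)) * norm (t' w) = norm (S' (t' w)) * norm (t w)" if "w \<in> \<Omega>" for w
  proof -
    have "(norm (S (t w)) / norm (t w))\<^sup>2 = (norm (S' (t' w)) / norm (t' w))\<^sup>2"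
      using ratio[OF that] by (simp add: power_divide)
    then have "norm (S (t w)) / norm (t w) = norm (S' (t' w)) / norm (t' w)"
      by (simp add: power2_eq_iff_nonneg)
    then show ?thesis using tnz[OF that] by (simp add: field_simps)
  qed
  \<comment> \<open>Equality of the quotients makes \<open>S (t w)\<close> and
    \<open>S' (t' w)\<close> vanish at the same points, so one disc serves both operators.\<close>
  have S'nz: "S' (t' w) \<noteq> 0" if "w \<in> B" for w
    using ratio'[OF in\<Omega>[OF that]] Snz[OF that] tnz(2)[OF in\<Omega>[OF that]] by auto
  have sec1: "nonvanishing_section B T1 t" "nonvanishing_section B T1' t'"
    using t t' B\<Omega> vector_holomorphic_on_subset[OF hol(1) B\<Omega>] vector_holomorphic_on_subset[OF hol(2) B\<Omega>]
    by (auto simp: nonvanishing_section_def)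
  have sec0: "nonvanishing_section B T0 (\<lambda>w. S (t w))"
    using vector_holomorphic_on_bounded_clinear[OF D(3) vector_holomorphic_on_subset[OF hol(1) B\<Omega>]]
      intertwiner_eigenspace[OF D(3) D(7)[symmetric] e(1)[OF in\<Omega>]] Snz
    by (simp add: nonvanishing_section_def)
  have sec0': "nonvanishing_section B T0' (\<lambda>w. S' (t' w))"
    using vector_holomorphic_on_bounded_clinear[OF D'(3) vector_holomorphic_on_subset[OF hol(2) B\<Omega>]]
      intertwiner_eigenspace[OF D'(3) D'(7)[symmetric] e(2)[OF in\<Omega>]] S'nz
    by (simp add: nonvanishing_section_def)
  have "\<exists>g. g holomorphic_on B \<and> (\<forall>w\<in>B. g w \<noteq> 0 \<and> norm (t w) = cmod (g w) * norm (t' w) \<and>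
      norm (S (t w)) = cmod (g w) * norm (S' (t' w)))"
    using curv
  proof
    assume c: "\<forall>w\<in>\<Omega>. curvature \<Omega> T1 w = curvature \<Omega> T1' w"
    have "section_curvature t w = section_curvature t' w" if w: "w \<in> B" for w
      using c in\<Omega>[OF w] curvature_eq_section_curvature[OF D(2) \<Omega>(1) exI[of _ t] oB B\<Omega> sec1(1) w]
        curvature_eq_section_curvature[OF D'(2) \<Omega>(1) exI[of _ t'] oB B\<Omega> sec1(2) w] t t' by simp
    then have "\<exists>g. g holomorphic_on B \<and> (\<forall>z\<in>B. g z \<noteq> 0 \<and> norm (t z) = cmod (g z) * norm (t' z))"
      using sec1 unfolding B_def nonvanishing_section_def
      by (intro norm_eq_if_section_curvature_eq) auto
    then obtain g where g: "g holomorphic_on B \<and> (\<forall>z\<in>B. g z \<noteq> 0 \<and> norm (t z) = cmod (g z) * norm (t' z))"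
      by (elim exE)
    have "norm (S (t w)) = cmod (g w) * norm (S' (t' w))" if w: "w \<in> B" for w
      using ratio'[OF in\<Omega>[OF w]] g w tnz(2)[OF in\<Omega>[OF w]] by simp
    then show ?thesis using g by (intro exI[of _ g]) simp
  next
    assume c: "\<forall>w\<in>\<Omega>. curvature \<Omega> T0 w = curvature \<Omega> T0' w"
    have "section_curvature (\<lambda>w. S (t w)) w = section_curvature (\<lambda>w. S' (t' w)) w" if w: "w \<in> B" for w
      using c in\<Omega>[OF w] curvature_eq_section_curvature[OF D(1) \<Omega>(1) FB2_section_exists[OF F \<Omega> t] oB B\<Omega> sec0 w]
        curvature_eq_section_curvature[OF D'(1) \<Omega>(1) FB2_section_exists[OF F' \<Omega> t'] oB B\<Omega> sec0' w] by simp
    then have "\<exists>g. g holomorphic_on B \<and>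
        (\<forall>z\<in>B. g z \<noteq> 0 \<and> norm (S (t z)) = cmod (g z) * norm (S' (t' z)))"
      using sec0 sec0' unfolding B_def nonvanishing_section_def
      by (intro norm_eq_if_section_curvature_eq) auto
    then obtain g where g: "g holomorphic_on B \<and>
        (\<forall>z\<in>B. g z \<noteq> 0 \<and> norm (S (t z)) = cmod (g z) * norm (S' (t' z)))"
      by (elim exE)
    have "norm (t w) = cmod (g w) * norm (t' w)" if w: "w \<in> B" for w
      using ratio'[OF in\<Omega>[OF w]] g w S'nz[OF w] by simp
    then show ?thesis using g by (intro exI[of _ g]) simp
  qed
  then obtain g where "g holomorphic_on B \<and> (\<forall>w\<in>B. g w \<noteq> 0 \<and> norm (t w) = cmod (g w) * norm (t' w) \<and>
      norm (S (t w)) = cmod (g w) * norm (S' (t' w)))" by (elim exE)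
  then show ?thesis
    using B\<Omega> Snz S'nz unfolding B_def
    by (intro unitarily_equivalent_if_local[OF \<Omega> F F' t t' r(1), of c g]) auto
qed

theorem theorem2p10:
  fixes \<Omega> :: "complex set"
    and T0 :: "'a::separable_hilbert \<Rightarrow> 'a" and S :: "'b::separable_hilbert \<Rightarrow> 'a" and T1 :: "'b \<Rightarrow> 'b"
    and T0' :: "'c::separable_hilbert \<Rightarrow> 'c" and S' :: "'d::separable_hilbert \<Rightarrow> 'c" and T1' :: "'d \<Rightarrow> 'd"
    and t1 :: "complex \<Rightarrow> 'b" and t1' :: "complex \<Rightarrow> 'd"
  assumes "open \<Omega>" and "connected \<Omega>"
    and "FB2 \<Omega> T0 S T1" and "FB2 \<Omega> T0' S' T1'"
    and "nonvanishing_section \<Omega> T1 t1" and "nonvanishing_section \<Omega> T1' t1'"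
  shows "(unitarily_equivalent (block_op T0 S T1) (block_op T0' S' T1') \<longleftrightarrow>
      (\<forall>w\<in>\<Omega>. curvature \<Omega> T1 w = curvature \<Omega> T1' w) \<and>
      (\<forall>w\<in>\<Omega>. (norm (S (t1 w)))\<^sup>2 / (norm (t1 w))\<^sup>2 = (norm (S' (t1' w)))\<^sup>2 / (norm (t1' w))\<^sup>2)) \<and>
    (unitarily_equivalent (block_op T0 S T1) (block_op T0' S' T1') \<longleftrightarrow>
      (\<forall>w\<in>\<Omega>. curvature \<Omega> T0 w = curvature \<Omega> T0' w) \<and>
      (\<forall>w\<in>\<Omega>. (norm (S (t1 w)))\<^sup>2 / (norm (t1 w))\<^sup>2 = (norm (S' (t1' w)))\<^sup>2 / (norm (t1' w))\<^sup>2))"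
  (is "(?E \<longleftrightarrow> ?K1 \<and> ?R) \<and> (?E \<longleftrightarrow> ?K0 \<and> ?R)")
proof -
  have "?K1 \<and> ?R" "?K0 \<and> ?R" if ?E
    using same_invariants_if_unitarily_equivalent[OF assms that]
    by (simp_all add: same_invariants_def)
  moreover have ?E if ?R "?K1 \<or> ?K0"
    by (rule unitarily_equivalent_if_curvature_eq[OF assms _ that(2)]) (use that(1) in simp)
  ultimately show ?thesis by blast
qed

end
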